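(* Let $\tau_0>0$ be a constant and let $f$ be an analytic function on $(-\epsilon_0,\epsilon_0)$, for some $\epsilon_0>0$, given by $$f(s)=\sum_{j=0}^\infty a_js^j,$$ with $|a_j|\le M^j$ for $j\ge1$, for some $M>0$. Let $\mathcal X=\{X_i\}_{i\ge1}$ be a sequence of spherical harmonics with $X_i\in\mathscr E_i$, and let $\{P_\alpha(\mathcal X)\}_{\alpha\in\varLambda}$ be the family of smooth functions on $\mathbb S^1$ determined by $\mathcal X$ (as defined in the context). Assume that, for any $i\ge1$, $$\|X_i\|_{L^2(\mathbb S^1)}\le\tilde A^i,$$ for some constant $\tilde A>0$. Then there exists a positive constant $t_0$, depending only on $a_0$, $\tau_0$, $\tilde A$ and $M$, such that the series $$\sum_{\alpha\in\varLambda}P_\alpha(\mathcal X)(\theta)e^{-\langle\alpha,\rho\rangle t}$$ converges in the $C^m$-sense to a smooth function $v$ on $[t_0,\infty)\times\mathbb S^1$, for any $m\ge0$. Moreover, $v$ is a solution of $$\partial_{tt}v+\partial_{\theta\theta}v=e^{-\tau_0t}f(v)$$ on $[t_0,\infty)\times\mathbb S^1$ with exponential decay (i.e. $|v(t,\theta)|\le C_*e^{-\gamma t}$ on $[t_0,\infty)\times\mathbb S^1$ for some positive constants $C_*,\gamma$), and its asymptotic behavior as $t\to\infty$ is determined by $\mathcal X$: for every $\ell\ge1$ there is a constant $C_\ell>0$ such that, for all $(t,\theta)\in[t_0,\infty)\times\mathbb S^1$, $$\Big|v(t,\theta)-\sum_{j=1}^\ell P_j(\mathcal X)(\theta)e^{-\mu_jt}\Big|\le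 C_\ell e^{-\mu_{\ell+1}t},$$ where $\{\mu_\ell\}_{\ell\ge1}$ is the index set associated with $\tau_0$ and $\{P_\ell(\mathcal X)\}_{\ell\ge1}$ is the sequence of smooth functions on $\mathbb S^1$ determined by $\mathcal X$.
   Context: $\mathbb S^1$ is the unit circle with angular variable $\theta$; $\mathscr E_0$ is the space of constants, and $\mathscr E_i=\mathrm{span}_{\mathbb R}\{\cos(i\theta),\sin(i\theta)\}$ for $i\ge1$. $\mathbb Z_+$ denotes the nonnegative integers. Set $\rho_0=\tau_0$, $\rho_i=i$ for $i\ge1$, and $\rho=\{\rho_i\}_{i\ge0}$. Multi-indices. $\varLambda$ is the set of all nonzero sequences $\alpha=\{\alpha_i\}_{i\ge0}$ with $\alpha_i\in\mathbb Z_+$ and $\alpha_i=0$ for all but finitely many $i$; $e_i$ ($i\ge0$) is the sequence whose $i$-th component is $1$ and all others $0$; $|\alpha|=\sum_{i\ge0}\alpha_i$; $\langle\alpha,\rho\rangle=\sum_{i\ge0}\alpha_i\rho_i$. The family $P_\alpha=P_\alpha(\mathcal X)$. $P_{e_0}=a_0/\rho_0^2$, $P_{e_i}=X_i$ for $i\ge1$, and inductively for $|\alpha|\ge2$: (i) if $\alpha_0=0$, $P_\alpha=0$; (ii) if $\alpha_0\ge1$, $P_\alpha$ is the unique solution of $$\partial_{\theta\theta}P_\alpha+\langle\alpha,\rho\rangle^2P_\alpha=\sum_{j=1}^{|\alpha|-1}\sum_{\beta_1+\cdots+\beta_j=\alpha-e_0}a_jP_{\beta_1}\cdots P_{\beta_j}\quad\text{on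 }\mathbb S^1$$ that is orthogonal to $\mathrm{Ker}(\partial_{\theta\theta}+\langle\alpha,\rho\rangle^2)$ in $L^2(\mathbb S^1)$; the inner sum is over ordered tuples $(\beta_1,\dots,\beta_j)\in\varLambda^j$. Index set. The index set associated with $\tau_0$ is the set of all nonzero sums $\sum_{i\ge0}m_i\rho_i$ with $m_i\in\mathbb Z_+$, finitely many $m_i>0$; it is written as a strictly increasing sequence $\{\mu_\ell\}_{\ell\ge1}$ of positive numbers. The sequence $P_\ell=P_\ell(\mathcal X)$ is determined recursively in $\ell\geq 1$ by: (1) if $\mu_\ell<\rho_0$, then $\mu_\ell=\ell$ and $P_\ell=X_\ell$; (2) if $\mu_\ell=\rho_0$, then $P_\ell=a_0/\rho_0^2$ if $\rho_0$ is not an integer, and $P_\ell=a_0/\rho_0^2+X_{\rho_0}$ if $\rho_0$ is an integer; (3) if $\mu_\ell>\rho_0$ and $\mu_\ell\ne\rho_0+\mu_m$ for all $m\ge1$, then $\mu_\ell$ is an integer and $P_\ell=X_{\mu_\ell}$; (4) if $\mu_\ell>\rho_0$ and $\mu_\ell=\rho_0+\mu_m$ for some $1\le m<\ell$, consider $$(\ast)\qquad \partial_{\theta\theta}P+\mu_\ell^2P=\sum_{j=1}^m a_j\sum_{\mu_{k_1}+\cdots+\mu_{k_j}=\mu_m}P_{k_1}\cdots P_{k_j}\quad\text{on }\mathbb S^1,$$ the inner sum being over all tuples $(k_1,\dots,k_j)$ of positive integers with the indicated property. (4a) If $\mu_\ell$ is not an integer, $P_\ell$ is the unique solution of $(\ast)$.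 (4b) If $\mu_\ell$ is an integer, $P_\ell=X_{\mu_\ell}+Q_\ell$, where $Q_\ell$ is the unique solution of $(\ast)$ orthogonal to $\mathscr E_{\mu_\ell}$ in $L^2(\mathbb S^1)$. (The letters used as subscripts distinguish $P_\alpha$, $\alpha\in\varLambda$, from $P_\ell$, $\ell$ a positive integer.) Convergence in the $C^m$-sense means that the series and the series of its derivatives in $(t,\theta)$ up to order $m$ converge uniformly on $[t_0,\infty)\times\mathbb S^1$; sums over the countable set $\varLambda$ are unordered sums.
   Formalization: Since t_0 may not depend on epsilon_0, v can leave (-epsilon_0, epsilon_0), where f(v) would be undefined; f is therefore taken to be the sum of its power series on the whole interval of convergence, and v is shown to take its values there. *)

theory Defs
  imports "HOL-Analysis.Analysis" "HOL-Library.Poly_Mapping"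
begin

section \<open>Functions on the circle\<close>

text \<open>Functions on the unit circle are rendered as 2 pi-periodic functions of the angle.\<close>

definition smooth_circle :: "(real \<Rightarrow> real) \<Rightarrow> bool" where
  "smooth_circle p \<longleftrightarrow> (\<forall>\<theta>. p (\<theta> + 2 * pi) = p \<theta>) \<and> (\<forall>n \<theta>. (deriv ^^ n) p differentiable at \<theta>)"

definition L2_inner :: "(real \<Rightarrow> real) \<Rightarrow> (real \<Rightarrow> real) \<Rightarrow> real" where
  "L2_inner p q = integral {0..2 * pi} (\<lambda>\<theta>. p \<theta> * q \<theta>)"

definition L2_norm :: "(real \<Rightarrow> real) \<Rightarrow> real" where
  "L2_norm p = sqrt (L2_inner p p)"

text \<open>For \<open>i = 0\<close> this is the space of constants.\<close>

definition harmonics :: "nat \<Rightarrow> (real \<Rightarrow> real) set" where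
  "harmonics i = {\<lambda>\<theta>. c * cos (real i * \<theta>) + d * sin (real i * \<theta>) | c d. True}"

definition solves :: "real \<Rightarrow> (real \<Rightarrow> real) \<Rightarrow> (real \<Rightarrow> real) \<Rightarrow> bool" where
  "solves \<kappa> g p \<longleftrightarrow> smooth_circle p \<and> (\<forall>\<theta>. deriv (deriv p) \<theta> + \<kappa>\<^sup>2 * p \<theta> = g \<theta>)"

definition kernel :: "real \<Rightarrow> (real \<Rightarrow> real) set" where
  "kernel \<kappa> = {q. solves \<kappa> (\<lambda>_. 0) q}"

definition orthogonal_to :: "(real \<Rightarrow> real) \<Rightarrow> (real \<Rightarrow> real) set \<Rightarrow> bool" where
  "orthogonal_to p S \<longleftrightarrow> (\<forall>q\<in>S. L2_inner p q = 0)"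


section \<open>Multi-indices and the index set\<close>

definition rho :: "real \<Rightarrow> nat \<Rightarrow> real" where
  "rho \<tau> i = (if i = 0 then \<tau> else real i)"

definition multi_indices :: "(nat \<Rightarrow>\<^sub>0 nat) set" where
  "multi_indices = UNIV - {0}"

definition unit_index :: "nat \<Rightarrow> (nat \<Rightarrow>\<^sub>0 nat)" where
  "unit_index i = Poly_Mapping.single i 1"

definition size_index :: "(nat \<Rightarrow>\<^sub>0 nat) \<Rightarrow> nat" where
  "size_index \<alpha> = (\<Sum>i\<in>Poly_Mapping.keys \<alpha>. Poly_Mapping.lookup \<alpha> i)"

definition pairing :: "real \<Rightarrow> (nat \<Rightarrow>\<^sub>0 nat) \<Rightarrow> real" where
  "pairing \<tau> \<alpha> = (\<Sum>i\<in>Poly_Mapping.keys \<alpha>. real (Poly_Mapping.lookup \<alpha> i) * rho \<tau> i)"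

definition index_set :: "real \<Rightarrow> real set" where
  "index_set \<tau> = range (pairing \<tau>) - {0}"

text \<open>
  The increasing enumeration of the index set starts at \<open>mu \<tau> 1\<close>; the value \<open>mu \<tau> 0 = 0\<close>
  only seeds the recursion and does not belong to the index set.
\<close>

primrec mu :: "real \<Rightarrow> nat \<Rightarrow> real" where
  "mu \<tau> 0 = 0"
| "mu \<tau> (Suc l) = (LEAST x. x \<in> index_set \<tau> \<and> mu \<tau> l < x)"

lemma size_index_superset:
  assumes "finite K" "Poly_Mapping.keys \<alpha> \<subseteq> K"
  shows "size_index \<alpha> = (\<Sum>i\<in>K. Poly_Mapping.lookup \<alpha> i)"
  unfolding size_index_def
  by (rule sum.mono_neutral_left) (use assms in \<open>auto simp: in_keys_iff\<close>)

lemma size_index_add: "size_index (\<alpha> + \<beta>) = size_index \<alpha> + size_index \<beta>"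
proof -
  let ?K = "Poly_Mapping.keys \<alpha> \<union> Poly_Mapping.keys \<beta>"
  have "Poly_Mapping.keys (\<alpha> + \<beta>) \<subseteq> ?K"
    by (rule Poly_Mapping.keys_add)
  then show ?thesis
    by (simp add: size_index_superset[of ?K] lookup_add sum.distrib)
qed

lemma size_index_sum_list: "\<beta> \<in> set \<beta>s \<Longrightarrow> size_index \<beta> \<le> size_index (sum_list \<beta>s)"
  by (induction \<beta>s) (auto simp: size_index_add)

lemma size_index_minus_unit:
  assumes "Poly_Mapping.lookup \<alpha> 0 \<noteq> 0"
  shows "size_index (\<alpha> - unit_index 0) < size_index \<alpha>"
proof -
  have "\<alpha> = (\<alpha> - unit_index 0) + unit_index 0"
    using assms
    by (intro poly_mapping_eqI)
      (auto simp: unit_index_def lookup_add lookup_minus lookup_single when_def)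
  then have "size_index \<alpha> = size_index (\<alpha> - unit_index 0) + size_index (unit_index 0)"
    by (metis size_index_add)
  moreover have "size_index (unit_index 0) = 1"
    by (simp add: size_index_def unit_index_def)
  ultimately show ?thesis by simp
qed

lemma finite_index_set_le:
  assumes "\<tau> > 0"
  shows "finite {x \<in> index_set \<tau>. x \<le> c}"
proof -
  let ?A = "{..nat \<lceil>c / \<tau>\<rceil>} \<times> {..nat \<lceil>c\<rceil>}"
  have "{x \<in> index_set \<tau>. x \<le> c} \<subseteq> (\<lambda>(p, q). real p * \<tau> + real q) ` ?A"
  proof
    fix x assume "x \<in> {x \<in> index_set \<tau>. x \<le> c}"
    then obtain \<alpha> where x: "x = pairing \<tau> \<alpha>" "x \<le> c"
      by (auto simp: index_set_def)
    let ?p = "Poly_Mapping.lookup \<alpha> 0"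
    let ?q = "\<Sum>i\<in>Poly_Mapping.keys \<alpha> - {0}. Poly_Mapping.lookup \<alpha> i * i"
    have "pairing \<tau> \<alpha> = real ?p * \<tau> + real ?q"
    proof (cases "0 \<in> Poly_Mapping.keys \<alpha>")
      case True
      then show ?thesis
        by (simp add: pairing_def sum.remove[where x = 0] rho_def)
    next
      case False
      then show ?thesis
        by (auto simp: pairing_def rho_def in_keys_iff intro!: sum.cong)
    qed
    moreover from this x assms have "real ?p * \<tau> \<le> c" "real ?q \<le> c"
      using mult_nonneg_nonneg[of "real ?p" \<tau>] by (linarith, linarith)
    then have "?p \<le> nat \<lceil>c / \<tau>\<rceil>" "?q \<le> nat \<lceil>c\<rceil>"
      using assms by (simp add: pos_le_divide_eq[symmetric], linarith)+
    ultimately show "x \<in> (\<lambda>(p, q). real p * \<tau> + real q) ` ?A"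
      using x by (intro image_eqI[of _ _ "(?p, ?q)"]) auto
  qed
  then show ?thesis
    by (rule finite_subset) auto
qed

lemma mu_Suc:
  assumes "\<tau> > 0"
  shows "mu \<tau> (Suc l) \<in> index_set \<tau>" and "mu \<tau> l < mu \<tau> (Suc l)"
    and "x \<in> index_set \<tau> \<Longrightarrow> mu \<tau> l < x \<Longrightarrow> mu \<tau> (Suc l) \<le> x"
proof -
  obtain n where n: "n > 0" "mu \<tau> l < real n"
    using reals_Archimedean2[of "max 0 (mu \<tau> l)"] by auto
  have "pairing \<tau> (unit_index n) = real n"
    using n by (simp add: pairing_def unit_index_def rho_def)
  then have nI: "real n \<in> index_set \<tau>"
    using n unfolding index_set_def by (metis DiffI of_nat_0_less_iff order_less_irrefl rangeI singletonD)
  let ?S = "{x \<in> index_set \<tau>. x \<le> real n} \<inter> {x. mu \<tau> l < x}"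
  have S: "finite ?S" "?S \<noteq> {}"
    using finite_index_set_le[OF assms] nI n by auto
  have Min: "Min ?S \<in> index_set \<tau>" "mu \<tau> l < Min ?S" "Min ?S \<le> real n"
    using Min_in[OF S] by auto
  have least: "Min ?S \<le> y" if "y \<in> index_set \<tau> \<and> mu \<tau> l < y" for y
    using that Min(3) Min_le[OF S(1), of y] by (cases "y \<le> real n") auto
  have "mu \<tau> (Suc l) = Min ?S"
    unfolding mu.simps by (rule Least_equality) (use Min least in auto)
  then show "mu \<tau> (Suc l) \<in> index_set \<tau>" "mu \<tau> l < mu \<tau> (Suc l)"
    "x \<in> index_set \<tau> \<Longrightarrow> mu \<tau> l < x \<Longrightarrow> mu \<tau> (Suc l) \<le> x"
    using Min least by auto
qed

lemma strict_mono_mu: "\<tau> > 0 \<Longrightarrow> strict_mono (mu \<tau>)"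
  by (simp add: strict_mono_Suc_iff mu_Suc(2) del: mu.simps)

lemma mu_nonneg: "\<tau> > 0 \<Longrightarrow> 0 \<le> mu \<tau> l"
  using strict_mono_less_eq[OF strict_mono_mu, of \<tau> 0 l] by simp


section \<open>The two families determined by the harmonics\<close>

definition index_tuples :: "(nat \<Rightarrow>\<^sub>0 nat) \<Rightarrow> nat \<Rightarrow> (nat \<Rightarrow>\<^sub>0 nat) list set" where
  "index_tuples \<alpha> j = {\<beta>s. length \<beta>s = j \<and> set \<beta>s \<subseteq> multi_indices \<and> sum_list \<beta>s = \<alpha>}"

definition mu_tuples :: "real \<Rightarrow> nat \<Rightarrow> nat \<Rightarrow> nat list set" where
  "mu_tuples \<tau> m j = {ks. length ks = j \<and> set ks \<subseteq> {1..} \<and> (\<Sum>k\<leftarrow>ks. mu \<tau> k) = mu \<tau> m}"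

text \<open>
  The first two parameters are the exponent \<open>\<tau>\<close> and the coefficients \<open>a\<close> of the
  nonlinearity; the value \<open>X 0\<close> of the third one plays no role. Positivity of \<open>\<tau>\<close> is needed
  for the recursion defining \<open>P_seq\<close> to be well-founded.
\<close>

locale harmonic_data =
  fixes \<tau> :: real and a :: "nat \<Rightarrow> real" and X :: "nat \<Rightarrow> real \<Rightarrow> real"
  assumes tau_pos: "\<tau> > 0"
begin

function P_multi :: "(nat \<Rightarrow>\<^sub>0 nat) \<Rightarrow> real \<Rightarrow> real" where
  "P_multi \<alpha> =
    (if \<alpha> = unit_index 0 then (\<lambda>\<theta>. a 0 / (rho \<tau> 0)\<^sup>2)
     else if \<exists>i\<ge>1. \<alpha> = unit_index i then X (THE i. \<alpha> = unit_index i)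
     else if Poly_Mapping.lookup \<alpha> 0 = 0 then (\<lambda>\<theta>. 0)
     else (THE p.
       solves (pairing \<tau> \<alpha>)
         (\<lambda>\<theta>. \<Sum>j = 1..size_index \<alpha> - 1. \<Sum>\<beta>s\<in>index_tuples (\<alpha> - unit_index 0) j.
            a j * (\<Prod>\<beta>\<leftarrow>\<beta>s. P_multi \<beta> \<theta>)) p
       \<and> orthogonal_to p (kernel (pairing \<tau> \<alpha>))))"
  by auto
termination
proof (relation "Wellfounded.measure size_index")
  fix \<alpha> :: "nat \<Rightarrow>\<^sub>0 nat" and j \<beta>s \<beta>
  assume "Poly_Mapping.lookup \<alpha> 0 \<noteq> 0" "\<beta>s \<in> index_tuples (\<alpha> - unit_index 0) j" "\<beta> \<in> set \<beta>s"
  then show "(\<beta>, \<alpha>) \<in> Wellfounded.measure size_index"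
    using size_index_sum_list[of \<beta> \<beta>s] size_index_minus_unit[of \<alpha>]
    by (auto simp: index_tuples_def)
qed auto

lemma mu_shift_the:
  assumes "\<exists>m\<ge>1. mu \<tau> l = rho \<tau> 0 + mu \<tau> m"
  shows "(THE m. m \<ge> 1 \<and> mu \<tau> l = rho \<tau> 0 + mu \<tau> m) < l"
proof -
  obtain m where m: "m \<ge> 1" "mu \<tau> l = rho \<tau> 0 + mu \<tau> m"
    using assms by auto
  have "(THE m. m \<ge> 1 \<and> mu \<tau> l = rho \<tau> 0 + mu \<tau> m) = m"
    using m strict_mono_eq[OF strict_mono_mu[OF tau_pos]] by (intro the_equality) auto
  moreover have "m < l"
    using m tau_pos strict_mono_less[OF strict_mono_mu[OF tau_pos], of m l] by (simp add: rho_def)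
  ultimately show ?thesis by simp
qed

lemma mu_tuples_le:
  assumes "ks \<in> mu_tuples \<tau> m j" "k \<in> set ks"
  shows "k \<le> m"
proof -
  have "mu \<tau> k \<le> (\<Sum>k\<leftarrow>ks. mu \<tau> k)"
    using assms(2) mu_nonneg[OF tau_pos] by (intro member_le_sum_list) auto
  then have "mu \<tau> k \<le> mu \<tau> m"
    using assms(1) by (simp add: mu_tuples_def)
  then show ?thesis
    by (simp add: strict_mono_less_eq[OF strict_mono_mu[OF tau_pos]])
qed

function P_seq :: "nat \<Rightarrow> real \<Rightarrow> real" where
  "P_seq l =
    (if mu \<tau> l < rho \<tau> 0 then X l
     else if mu \<tau> l = rho \<tau> 0 then
       (if rho \<tau> 0 \<notin> \<int> then (\<lambda>\<theta>. a 0 / (rho \<tau> 0)\<^sup>2)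
        else (\<lambda>\<theta>. a 0 / (rho \<tau> 0)\<^sup>2 + X (nat \<lfloor>rho \<tau> 0\<rfloor>) \<theta>))
     else if \<not> (\<exists>m\<ge>1. mu \<tau> l = rho \<tau> 0 + mu \<tau> m) then X (nat \<lfloor>mu \<tau> l\<rfloor>)
     else
       (let m = (THE m. m \<ge> 1 \<and> mu \<tau> l = rho \<tau> 0 + mu \<tau> m);
            g = (\<lambda>\<theta>. \<Sum>j = 1..m. a j * (\<Sum>ks\<in>mu_tuples \<tau> m j. \<Prod>k\<leftarrow>ks. P_seq k \<theta>))
        in if mu \<tau> l \<notin> \<int> then (THE p. solves (mu \<tau> l) g p)
           else (\<lambda>\<theta>. X (nat \<lfloor>mu \<tau> l\<rfloor>) \<theta> +
             (THE q. solves (mu \<tau> l) g q \<and> orthogonal_to q (harmonics (nat \<lfloor>mu \<tau> l\<rfloor>))) \<theta>)))"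
  by auto
termination
proof (relation "Wellfounded.measure id")
  fix l m j ks k
  assume "\<not> \<not> (\<exists>m\<ge>1. mu \<tau> l = rho \<tau> 0 + mu \<tau> m)"
    and "m = (THE m. m \<ge> 1 \<and> mu \<tau> l = rho \<tau> 0 + mu \<tau> m)"
    and "ks \<in> mu_tuples \<tau> m j" "k \<in> set ks"
  then show "(k, l) \<in> Wellfounded.measure id"
    using mu_shift_the[of l] mu_tuples_le[of ks m j k] by simp
qed auto

end


section \<open>Convergence and smoothness on the half-cylinder\<close>

text \<open>
  Functions of \<open>(t, \<theta>)\<close> are curried. On \<open>[t\<^sub>0, \<infinity>)\<close> times the circle, derivatives in \<open>t\<close> are taken
  within the half-line, hence are one-sided at \<open>t = t\<^sub>0\<close>.
\<close>

datatype coord = Time | Angle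

fun partial :: "real \<Rightarrow> coord \<Rightarrow> (real \<Rightarrow> real \<Rightarrow> real) \<Rightarrow> real \<Rightarrow> real \<Rightarrow> real" where
  "partial t\<^sub>0 Time u = (\<lambda>t \<theta>. vector_derivative (\<lambda>s. u s \<theta>) (at t within {t\<^sub>0..}))"
| "partial t\<^sub>0 Angle u = (\<lambda>t \<theta>. vector_derivative (\<lambda>x. u t x) (at \<theta>))"

fun has_partial :: "real \<Rightarrow> coord \<Rightarrow> (real \<Rightarrow> real \<Rightarrow> real) \<Rightarrow> bool" where
  "has_partial t\<^sub>0 Time u \<longleftrightarrow> (\<forall>t\<ge>t\<^sub>0. \<forall>\<theta>. (\<lambda>s. u s \<theta>) differentiable (at t within {t\<^sub>0..}))"
| "has_partial t\<^sub>0 Angle u \<longleftrightarrow> (\<forall>t\<ge>t\<^sub>0. \<forall>\<theta>. (\<lambda>x. u t x) differentiable (at \<theta>))"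

definition partials :: "real \<Rightarrow> coord list \<Rightarrow> (real \<Rightarrow> real \<Rightarrow> real) \<Rightarrow> real \<Rightarrow> real \<Rightarrow> real" where
  "partials t\<^sub>0 w u = foldr (partial t\<^sub>0) w u"

definition smooth_cylinder :: "real \<Rightarrow> (real \<Rightarrow> real \<Rightarrow> real) \<Rightarrow> bool" where
  "smooth_cylinder t\<^sub>0 u \<longleftrightarrow>
    (\<forall>t\<ge>t\<^sub>0. \<forall>\<theta>. u t (\<theta> + 2 * pi) = u t \<theta>) \<and>
    (\<forall>w. continuous_on ({t\<^sub>0..} \<times> UNIV) (\<lambda>(t, \<theta>). partials t\<^sub>0 w u t \<theta>) \<and>
         (\<forall>c. has_partial t\<^sub>0 c (partials t\<^sub>0 w u)))"

text \<open>Unordered sums: the limit is along the finite subsets of the index set \<open>A\<close>.\<close>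

definition Cm_has_sum ::
  "real \<Rightarrow> nat \<Rightarrow> ('i \<Rightarrow> real \<Rightarrow> real \<Rightarrow> real) \<Rightarrow> 'i set \<Rightarrow> (real \<Rightarrow> real \<Rightarrow> real) \<Rightarrow> bool" where
  "Cm_has_sum t\<^sub>0 m u A v \<longleftrightarrow>
    (\<forall>w. length w \<le> m \<longrightarrow>
      uniform_limit ({t\<^sub>0..} \<times> UNIV)
        (\<lambda>F (t, \<theta>). \<Sum>i\<in>F. partials t\<^sub>0 w (u i) t \<theta>)
        (\<lambda>(t, \<theta>). partials t\<^sub>0 w v t \<theta>)
        (finite_subsets_at_top A))"


section \<open>The nonlinearity\<close>

text \<open>
  \<open>f\<close> is given on \<open>(-\<epsilon>, \<epsilon>)\<close> by the power series with coefficients \<open>a\<close>; if that series converges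
  on a larger interval, \<open>f\<close> also denotes its sum (the analytic continuation) there.
  This matters because the starting time \<open>t\<^sub>0\<close> of the solution may not depend on \<open>\<epsilon>\<close>, so the
  solution need not take its values in \<open>(-\<epsilon>, \<epsilon>)\<close>.
\<close>

definition given_by_power_series :: "(real \<Rightarrow> real) \<Rightarrow> (nat \<Rightarrow> real) \<Rightarrow> real \<Rightarrow> bool" where
  "given_by_power_series f a \<epsilon> \<longleftrightarrow>
    (\<forall>s. \<bar>s\<bar> < \<epsilon> \<longrightarrow> (\<lambda>j. a j * s ^ j) sums f s) \<and>
    (\<forall>s. ereal \<bar>s\<bar> < conv_radius a \<longrightarrow> (\<lambda>j. a j * s ^ j) sums f s)"

end

theory Submission
  imports Defs
begin

text \<open>The right-hand side of the equation for the function with index \<open>\<alpha>\<close> is a trigonometric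
  polynomial whose degree \<open>d\<close> is the contribution of the positive entries to \<open>pairing \<tau> \<alpha>\<close>. Hence
  \<open>\<kappa> = pairing \<tau> \<alpha>\<close> exceeds \<open>d\<close> by at least \<open>\<tau>\<close>: there is no resonance, and solving the equation
  costs at most a factor \<open>1 / \<tau>\<^sup>2\<close> in the Wiener norm. The Wiener norms, weighted by the exponentials at a
  large time, are therefore dominated by the solution of a scalar recursion whose total sum stays
  bounded. The series can then be differentiated termwise, a derivative costing one factor
  \<open>\<kappa>\<close>, and the differential equation is the rearrangement of an absolutely convergent multiple series.
  Collecting all \<open>\<alpha>\<close> with the same pairing gives the expansion in the \<open>mu\<close>-indexed functions,
  by uniqueness of the solutions orthogonal to the kernel.\<close>

subsection \<open>Trigonometric polynomials\<close>

text \<open>\<open>trig d B p\<close>: \<open>p\<close> is a trigonometric polynomial of degree at most \<open>d\<close> whose Wiener norm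
  is at most \<open>B\<close>.  Negative frequencies are allowed so that the product rule needs no case
  distinction, and phases so that differentiation maps harmonics to harmonics.\<close>

inductive trig :: "nat \<Rightarrow> real \<Rightarrow> (real \<Rightarrow> real) \<Rightarrow> bool" for d where
  trig_zero: "0 \<le> B \<Longrightarrow> trig d B (\<lambda>_. 0)"
| trig_cos: "\<bar>n\<bar> \<le> int d \<Longrightarrow> trig d \<bar>c\<bar> (\<lambda>\<theta>. c * cos (real_of_int n * \<theta> + \<phi>))"
| trig_add: "trig d B p \<Longrightarrow> trig d C q \<Longrightarrow> trig d (B + C) (\<lambda>\<theta>. p \<theta> + q \<theta>)"

lemma trig_nonneg: "trig d B p \<Longrightarrow> 0 \<le> B"
  by (induction rule: trig.induct) auto

lemma trig_mono:
  assumes "trig d B p" "d \<le> d'" "B \<le> C"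
  shows "trig d' C p"
proof -
  have "trig d' B p"
    using assms(1)
  proof induction
    case (trig_cos n c \<phi>)
    with assms(2) show ?case by (intro trig.trig_cos) auto
  qed (auto intro: trig.intros)
  from trig_add[OF this trig_zero[of "C - B" d']] assms(3) show ?thesis by simp
qed

lemma trig_const: "trig d \<bar>c\<bar> (\<lambda>_. c)"
  using trig_cos[of 0 d c 0] by simp

lemma trig_scale:
  assumes "trig d B p"
  shows "trig d (\<bar>k\<bar> * B) (\<lambda>\<theta>. k * p \<theta>)"
  using assms
proof induction
  case (trig_cos n c \<phi>)
  then show ?case using trig.trig_cos[of n d "k * c" \<phi>] by (simp add: abs_mult mult.assoc)
next
  case (trig_add B p C q)
  then show ?case using trig.trig_add[OF trig_add.IH] by (simp add: distrib_left)
qed (simp add: trig_zero)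

lemma trig_sum:
  assumes "\<And>i. i \<in> I \<Longrightarrow> trig d (B i) (p i)"
  shows "trig d (\<Sum>i\<in>I. B i) (\<lambda>\<theta>. \<Sum>i\<in>I. p i \<theta>)"
  using assms
proof (induction I rule: infinite_finite_induct)
  case (insert x F)
  then show ?case using trig_add[of d "B x" "p x"] by auto
qed (auto intro: trig_zero)

lemma trig_mult_cos:
  assumes "trig e B q" "\<bar>n\<bar> \<le> int d"
  shows "trig (d + e) (\<bar>c\<bar> * B) (\<lambda>\<theta>. c * cos (real_of_int n * \<theta> + \<phi>) * q \<theta>)"
  using assms(1)
proof induction
  case (trig_cos m b \<psi>)
  have "\<bar>n + m\<bar> \<le> int (d + e)" "\<bar>n - m\<bar> \<le> int (d + e)"
    using trig_cos assms(2) by auto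
  from trig_add[OF trig.trig_cos[OF this(1), of "c * b / 2" "\<phi> + \<psi>"]
      trig.trig_cos[OF this(2), of "c * b / 2" "\<phi> - \<psi>"]]
  have "trig (d + e) (\<bar>c\<bar> * \<bar>b\<bar>) (\<lambda>\<theta>. c * b / 2 * cos (real_of_int (n + m) * \<theta> + (\<phi> + \<psi>)) +
      c * b / 2 * cos (real_of_int (n - m) * \<theta> + (\<phi> - \<psi>)))"
    by (simp add: abs_mult mult.commute)
  moreover have "c * cos (real_of_int n * \<theta> + \<phi>) * (b * cos (real_of_int m * \<theta> + \<psi>)) =
     c * b / 2 * cos (real_of_int (n + m) * \<theta> + (\<phi> + \<psi>)) +
      c * b / 2 * cos (real_of_int (n - m) * \<theta> + (\<phi> - \<psi>))" for \<theta>
  proof -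
    have *: "real_of_int (n + m) * \<theta> + (\<phi> + \<psi>) = (real_of_int n * \<theta> + \<phi>) + (real_of_int m * \<theta> + \<psi>)"
      "real_of_int (n - m) * \<theta> + (\<phi> - \<psi>) = (real_of_int n * \<theta> + \<phi>) - (real_of_int m * \<theta> + \<psi>)"
      by (auto simp: algebra_simps)
    have "c * cos x * (b * cos y) = c * b / 2 * cos (x + y) + c * b / 2 * cos (x - y)" for x y
      by (simp add: cos_add cos_diff algebra_simps)
    then show ?thesis unfolding * .
  qed
  ultimately show ?case by simp
next
  case (trig_add B p C q)
  then show ?case using trig.trig_add[OF trig_add.IH] by (simp add: distrib_left)
qed (simp add: trig_zero)

lemma trig_mult:
  assumes "trig d B p" "trig e C q"
  shows "trig (d + e) (B * C) (\<lambda>\<theta>. p \<theta> * q \<theta>)"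
  using assms(1)
proof induction
  case (trig_cos n c \<phi>)
  then show ?case using trig_mult_cos[OF assms(2)] by simp
next
  case (trig_add B p C q)
  then show ?case using trig.trig_add[OF trig_add.IH] by (simp add: distrib_right)
next
  case (trig_zero B)
  then show ?case using trig_nonneg[OF assms(2)] by (simp add: trig.trig_zero)
qed

lemma trig_prod_list:
  assumes "\<And>i. i \<in> set is \<Longrightarrow> trig (d i) (B i) (p i)"
  shows "trig (\<Sum>i\<leftarrow>is. d i) (\<Prod>i\<leftarrow>is. B i) (\<lambda>\<theta>. \<Prod>i\<leftarrow>is. p i \<theta>)"
  using assms
proof (induction "is")
  case Nil
  show ?case using trig_const[of 0 1] by simp
next
  case (Cons i "is")
  then show ?case using trig_mult[of "d i" "B i" "p i"] by auto
qed

lemma trig_bound: "trig d B p \<Longrightarrow> \<bar>p \<theta>\<bar> \<le> B"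
proof (induction rule: trig.induct)
  case (trig_cos n c \<phi>)
  then show ?case using mult_left_mono[OF abs_cos_le_one, of "\<bar>c\<bar>"] by (simp add: abs_mult)
qed auto

lemma trig_periodic: "trig d B p \<Longrightarrow> p (\<theta> + 2 * pi) = p \<theta>"
proof (induction rule: trig.induct)
  case (trig_cos n c \<phi>)
  have "cos (real_of_int n * (\<theta> + 2 * pi) + \<phi>) = cos (real_of_int n * \<theta> + \<phi> + of_int n * (2 * pi))"
    by (simp add: algebra_simps)
  also have "\<dots> = cos (real_of_int n * \<theta> + \<phi>)"
    using cos_int_2pin[of n] sin_int_2pin[of n] by (simp add: cos_add mult.commute[of _ "2 * pi"])
  finally show ?case by simp
qed auto

lemma trig_deriv:
  assumes "trig d B p"
  shows "\<exists>p'. trig d (real d * B) p' \<and> (\<forall>\<theta>. (p has_real_derivative p' \<theta>) (at \<theta>))"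
  using assms
proof induction
  case (trig_zero B)
  then show ?case using trig.trig_zero[of "real d * B" d] by (intro exI[of _ "\<lambda>_. 0"]) auto
next
  case (trig_cos n c \<phi>)
  have "trig d \<bar>c * of_int n\<bar> (\<lambda>\<theta>. c * of_int n * cos (real_of_int n * \<theta> + (\<phi> + pi / 2)))"
    using trig_cos by (rule trig.trig_cos)
  moreover have "\<bar>c * of_int n\<bar> \<le> real d * \<bar>c\<bar>"
  proof -
    have "\<bar>of_int n :: real\<bar> \<le> real d" using trig_cos by linarith
    then show ?thesis by (simp add: abs_mult mult.commute mult_left_mono)
  qed
  moreover have "cos (x + (\<phi> + pi / 2)) = - sin (x + \<phi>)" for x
    using cos_add[of "x + \<phi>" "pi/2"] by (simp add: add.assoc)
  ultimately show ?case
    by (intro exI[of _ "\<lambda>\<theta>. c * of_int n * cos (real_of_int n * \<theta> + (\<phi> + pi / 2))"])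
      (auto intro: trig_mono intro!: derivative_eq_intros)
next
  case (trig_add B p C q)
  then obtain p' q' where "trig d (real d * B) p'" "\<And>\<theta>. (p has_real_derivative p' \<theta>) (at \<theta>)"
    "trig d (real d * C) q'" "\<And>\<theta>. (q has_real_derivative q' \<theta>) (at \<theta>)" by auto
  then show ?case
    by (intro exI[of _ "\<lambda>\<theta>. p' \<theta> + q' \<theta>"])
      (auto simp: distrib_left intro: trig.trig_add intro!: derivative_eq_intros)
qed

lemma trig_deriv':
  assumes "trig d B p"
  shows "trig d (real d * B) (deriv p)" "(p has_real_derivative deriv p \<theta>) (at \<theta>)"
proof -
  from trig_deriv[OF assms] obtain p' where p': "trig d (real d * B) p'"
    "\<And>\<theta>. (p has_real_derivative p' \<theta>) (at \<theta>)" by auto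
  then have "deriv p = p'" by (auto intro!: ext DERIV_imp_deriv)
  with p' show "trig d (real d * B) (deriv p)" "(p has_real_derivative deriv p \<theta>) (at \<theta>)"
    by auto
qed

lemma trig_higher_deriv:
  assumes "trig d B p"
  shows "trig d (real d ^ n * B) ((deriv ^^ n) p)"
proof (induction n)
  case (Suc n)
  then show ?case using trig_deriv'(1)[OF Suc] by (simp add: mult.assoc)
qed (use assms in simp)

lemma trig_smooth:
  assumes "trig d B p"
  shows "smooth_circle p"
  unfolding smooth_circle_def
proof (intro conjI allI)
  show "p (\<theta> + 2 * pi) = p \<theta>" for \<theta> using trig_periodic[OF assms] .
  show "(deriv ^^ n) p differentiable at \<theta>" for n \<theta>
    using trig_deriv'(2)[OF trig_higher_deriv[OF assms]] real_differentiable_def by blast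
qed

lemma trig_solve:
  assumes "trig d B g" "\<tau> > 0" "\<kappa> \<ge> real d + \<tau>"
  shows "\<exists>p. trig d (B / \<tau>\<^sup>2) p \<and> (\<forall>\<theta>. deriv (deriv p) \<theta> + \<kappa>\<^sup>2 * p \<theta> = g \<theta>)"
  using assms(1)
proof induction
  case (trig_zero B)
  then show ?case using trig.trig_zero[of "B / \<tau>\<^sup>2" d] by (intro exI[of _ "\<lambda>_. 0"]) auto
next
  case (trig_cos n c \<phi>)
  define k where "k = \<kappa>\<^sup>2 - (of_int n)\<^sup>2"
  define p where "p = (\<lambda>\<theta>. c / k * cos (real_of_int n * \<theta> + \<phi>))"
  have n: "\<bar>of_int n :: real\<bar> \<le> real d" using trig_cos by linarith
  have "k = (\<kappa> - \<bar>of_int n\<bar>) * (\<kappa> + \<bar>of_int n\<bar>)"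
    by (simp add: k_def power2_eq_square algebra_simps flip: of_int_mult)
  also have "\<dots> \<ge> \<tau> * \<tau>"
    using n assms(2,3) by (intro mult_mono) auto
  finally have k: "\<tau>\<^sup>2 \<le> k" by (simp add: power2_eq_square)
  then have "k > 0" using assms(2) by (smt (verit) zero_less_power)
  have "trig d \<bar>c / k\<bar> p" unfolding p_def using trig_cos by (rule trig.trig_cos)
  moreover have "\<bar>c / k\<bar> \<le> \<bar>c\<bar> / \<tau>\<^sup>2"
    using k \<open>k > 0\<close> assms(2) by (simp add: abs_divide) (intro divide_left_mono, auto)
  ultimately have "trig d (\<bar>c\<bar> / \<tau>\<^sup>2) p" by (rule trig_mono[OF _ order_refl])
  moreover have "deriv (deriv p) \<theta> + \<kappa>\<^sup>2 * p \<theta> = c * cos (real_of_int n * \<theta> + \<phi>)" for \<theta>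
  proof -
    have "deriv p = (\<lambda>\<theta>. - (c / k * of_int n * sin (real_of_int n * \<theta> + \<phi>)))"
      unfolding p_def using \<open>k > 0\<close>
      by (intro ext DERIV_imp_deriv) (auto intro!: derivative_eq_intros)
    then have "deriv (deriv p) \<theta> = - (c / k * (of_int n)\<^sup>2 * cos (real_of_int n * \<theta> + \<phi>))"
      using \<open>k > 0\<close> by (auto intro!: DERIV_imp_deriv derivative_eq_intros simp: power2_eq_square)
    then have "deriv (deriv p) \<theta> + \<kappa>\<^sup>2 * p \<theta> = c / k * (\<kappa>\<^sup>2 - (of_int n)\<^sup>2) * cos (real_of_int n * \<theta> + \<phi>)"
      unfolding p_def by (simp only: left_diff_distrib right_diff_distrib) (simp add: ac_simps)
    with \<open>k > 0\<close> show ?thesis unfolding k_def[symmetric] by simp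
  qed
  ultimately show ?case by blast
next
  case (trig_add B p C q)
  then obtain p1 q1 where *: "trig d (B / \<tau>\<^sup>2) p1" "\<And>\<theta>. deriv (deriv p1) \<theta> + \<kappa>\<^sup>2 * p1 \<theta> = p \<theta>"
     "trig d (C / \<tau>\<^sup>2) q1" "\<And>\<theta>. deriv (deriv q1) \<theta> + \<kappa>\<^sup>2 * q1 \<theta> = q \<theta>" by blast
  have "deriv (\<lambda>\<theta>. p1 \<theta> + q1 \<theta>) = (\<lambda>\<theta>. deriv p1 \<theta> + deriv q1 \<theta>)"
    using trig_deriv'(2)[OF *(1)] trig_deriv'(2)[OF *(3)]
    by (intro ext DERIV_imp_deriv) (auto intro!: derivative_eq_intros)
  moreover have "deriv (\<lambda>\<theta>. deriv p1 \<theta> + deriv q1 \<theta>) = (\<lambda>\<theta>. deriv (deriv p1) \<theta> + deriv (deriv q1) \<theta>)"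
    using trig_deriv'(2)[OF trig_deriv'(1)[OF *(1)]] trig_deriv'(2)[OF trig_deriv'(1)[OF *(3)]]
    by (intro ext DERIV_imp_deriv) (auto intro!: derivative_eq_intros)
  ultimately have "deriv (deriv (\<lambda>\<theta>. p1 \<theta> + q1 \<theta>)) \<theta> + \<kappa>\<^sup>2 * (p1 \<theta> + q1 \<theta>) = p \<theta> + q \<theta>" for \<theta>
    using *(2)[of \<theta>, symmetric] *(4)[of \<theta>, symmetric] by (simp add: algebra_simps)
  moreover have "trig d ((B + C) / \<tau>\<^sup>2) (\<lambda>\<theta>. p1 \<theta> + q1 \<theta>)"
    using trig.trig_add[OF *(1,3)] by (simp add: add_divide_distrib)
  ultimately show ?case by (intro exI[of _ "\<lambda>\<theta>. p1 \<theta> + q1 \<theta>"]) simp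
qed

lemma trig_second_deriv_sum:
  assumes "\<And>i. i \<in> I \<Longrightarrow> trig d (B i) (p i)"
  shows "deriv (deriv (\<lambda>\<theta>. \<Sum>i\<in>I. p i \<theta>)) = (\<lambda>\<theta>. \<Sum>i\<in>I. deriv (deriv (p i)) \<theta>)"
proof -
  have "deriv (\<lambda>\<theta>. \<Sum>i\<in>I. p i \<theta>) = (\<lambda>\<theta>. \<Sum>i\<in>I. deriv (p i) \<theta>)"
    using trig_deriv'(2)[OF assms] by (intro ext DERIV_imp_deriv) (auto intro!: DERIV_sum)
  moreover have "deriv (\<lambda>\<theta>. \<Sum>i\<in>I. deriv (p i) \<theta>) = (\<lambda>\<theta>. \<Sum>i\<in>I. deriv (deriv (p i)) \<theta>)"
    using trig_deriv'(2)[OF trig_deriv'(1)[OF assms]]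
    by (intro ext DERIV_imp_deriv) (auto intro!: DERIV_sum)
  ultimately show ?thesis by simp
qed

subsection \<open>The equation on the circle\<close>

lemma smooth_circle_deriv:
  assumes "smooth_circle p"
  shows "(p has_real_derivative deriv p \<theta>) (at \<theta>)"
    "(deriv p has_real_derivative deriv (deriv p) \<theta>) (at \<theta>)"
proof -
  have d: "(deriv ^^ n) p differentiable at \<theta>" for n \<theta>
    using assms by (auto simp: smooth_circle_def)
  from d[of 0] d[of 1] show "(p has_real_derivative deriv p \<theta>) (at \<theta>)"
    "(deriv p has_real_derivative deriv (deriv p) \<theta>) (at \<theta>)"
    by (auto simp: DERIV_deriv_iff_real_differentiable)
qed

lemma smooth_circle_deriv_periodic:
  assumes "smooth_circle p"
  shows "deriv p (\<theta> + 2 * pi) = deriv p \<theta>"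
proof -
  have "((\<lambda>x. p (x + 2 * pi)) has_real_derivative deriv p (\<theta> + 2 * pi)) (at \<theta>)"
    using smooth_circle_deriv(1)[OF assms, of "\<theta> + 2 * pi"] by (simp only: DERIV_shift)
  moreover have "(\<lambda>x. p (x + 2 * pi)) = p" using assms by (auto simp: smooth_circle_def)
  ultimately show ?thesis
    using smooth_circle_deriv(1)[OF assms, of \<theta>] by (metis DERIV_unique)
qed

lemma smooth_circle_continuous:
  assumes "smooth_circle p"
  shows "continuous_on S p"
  using smooth_circle_deriv(1)[OF assms] DERIV_isCont continuous_at_imp_continuous_on by blast

lemma kernel_imp_cos_sin:
  assumes "q \<in> kernel \<kappa>" "\<kappa> > 0"
  shows "\<exists>c d. q = (\<lambda>\<theta>. c * cos (\<kappa> * \<theta>) + d * sin (\<kappa> * \<theta>))"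
proof -
  have s: "smooth_circle q" and eq: "deriv (deriv q) \<theta> = - \<kappa>\<^sup>2 * q \<theta>" for \<theta>
    using assms by (auto simp: kernel_def solves_def eq_neg_iff_add_eq_0)
  define u where "u = (\<lambda>\<theta>. q \<theta> * cos (\<kappa> * \<theta>) - deriv q \<theta> / \<kappa> * sin (\<kappa> * \<theta>))"
  define w where "w = (\<lambda>\<theta>. q \<theta> * sin (\<kappa> * \<theta>) + deriv q \<theta> / \<kappa> * cos (\<kappa> * \<theta>))"
  note D = smooth_circle_deriv[OF s]
  have "(u has_real_derivative 0) (at \<theta>)" for \<theta>
    unfolding u_def using assms(2)
    by (auto intro!: derivative_eq_intros D(1)[THEN DERIV_cong] D(2)[THEN DERIV_cong]
        simp: eq power2_eq_square field_simps)
  then have u: "u \<theta> = u 0" for \<theta> using DERIV_isconst_all by blast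
  have "(w has_real_derivative 0) (at \<theta>)" for \<theta>
    unfolding w_def using assms(2)
    by (auto intro!: derivative_eq_intros D(1)[THEN DERIV_cong] D(2)[THEN DERIV_cong]
        simp: eq power2_eq_square field_simps)
  then have w: "w \<theta> = w 0" for \<theta> using DERIV_isconst_all by blast
  have "q \<theta> = u 0 * cos (\<kappa> * \<theta>) + w 0 * sin (\<kappa> * \<theta>)" for \<theta>
  proof -
    have "(x * C - y * S) * C + (x * S + y * C) * S = x * (C\<^sup>2 + S\<^sup>2)" for x y C S :: real
      by (simp add: algebra_simps power2_eq_square)
    from this[of "q \<theta>" "cos (\<kappa> * \<theta>)" "deriv q \<theta> / \<kappa>" "sin (\<kappa> * \<theta>)"]
    have "q \<theta> = u \<theta> * cos (\<kappa> * \<theta>) + w \<theta> * sin (\<kappa> * \<theta>)"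
      by (simp add: u_def w_def)
    then show ?thesis by (simp only: u[of \<theta>] w[of \<theta>])
  qed
  then show ?thesis by blast
qed

lemma kernel_noninteger:
  assumes "q \<in> kernel \<kappa>" "\<kappa> > 0" "\<kappa> \<notin> \<int>"
  shows "q = (\<lambda>_. 0)"
proof -
  obtain c d where q: "q = (\<lambda>\<theta>. c * cos (\<kappa> * \<theta>) + d * sin (\<kappa> * \<theta>))"
    using kernel_imp_cos_sin[OF assms(1,2)] by blast
  have s: "smooth_circle q" using assms by (auto simp: kernel_def solves_def)
  have dq: "deriv q = (\<lambda>\<theta>. d * \<kappa> * cos (\<kappa> * \<theta>) - c * \<kappa> * sin (\<kappa> * \<theta>))"
    unfolding q by (intro ext DERIV_imp_deriv) (auto intro!: derivative_eq_intros)
  define C where "C = cos (\<kappa> * (2 * pi))"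
  define S where "S = sin (\<kappa> * (2 * pi))"
  have "q (0 + 2 * pi) = q 0" using s unfolding smooth_circle_def by blast
  then have 1: "c * C + d * S = c" by (simp add: q C_def S_def)
  have "deriv q (0 + 2 * pi) = deriv q 0" by (rule smooth_circle_deriv_periodic[OF s])
  then have "\<kappa> * (d * C - c * S) = \<kappa> * d" by (simp add: dq C_def S_def algebra_simps)
  then have 2: "d * C - c * S = d" using assms(2) by simp
  have CS: "C\<^sup>2 + S\<^sup>2 = 1" by (simp add: C_def S_def)
  have "C \<noteq> 1"
  proof
    assume "C = 1"
    then obtain n where "\<kappa> * (2 * pi) = of_int n * 2 * pi"
      using cos_one_2pi_int[of "\<kappa> * (2 * pi)"] by (auto simp: C_def)
    then have "\<kappa> = of_int n" by simp
    with assms(3) show False by simp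
  qed
  have "(c\<^sup>2 + d\<^sup>2) * C = c\<^sup>2 + d\<^sup>2"
  proof -
    have "c * (c * C + d * S) + d * (d * C - c * S) = c * c + d * d" using 1 2 by simp
    then show ?thesis by (simp add: algebra_simps power2_eq_square)
  qed
  with \<open>C \<noteq> 1\<close> have "c\<^sup>2 + d\<^sup>2 = 0" by simp
  then show ?thesis by (simp add: q sum_power2_eq_zero_iff)
qed

lemma harmonics_eq_kernel:
  assumes "n \<ge> 1"
  shows "harmonics n = kernel (real n)"
proof
  show "kernel (real n) \<subseteq> harmonics n"
    using kernel_imp_cos_sin[of _ "real n"] assms by (fastforce simp: harmonics_def)
next
  show "harmonics n \<subseteq> kernel (real n)"
  proof
    fix q assume "q \<in> harmonics n"
    then obtain c d where q: "q = (\<lambda>\<theta>. c * cos (real n * \<theta>) + d * sin (real n * \<theta>))"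
      by (auto simp: harmonics_def)
    have "trig n (\<bar>c\<bar> + \<bar>d\<bar>) q"
      unfolding q using trig_add[OF trig_cos[of "int n" n c 0] trig_cos[of "int n" n d "- pi / 2"]]
      by (simp add: cos_diff)
    then have "smooth_circle q" by (rule trig_smooth)
    moreover have "deriv q = (\<lambda>\<theta>. d * real n * cos (real n * \<theta>) - c * real n * sin (real n * \<theta>))"
      unfolding q by (intro ext DERIV_imp_deriv) (auto intro!: derivative_eq_intros)
    then have "(deriv q has_real_derivative - ((real n)\<^sup>2 * q \<theta>)) (at \<theta>)" for \<theta>
      by (auto intro!: derivative_eq_intros simp: q power2_eq_square algebra_simps)
    then have "deriv (deriv q) \<theta> = - ((real n)\<^sup>2 * q \<theta>)" for \<theta>
      by (rule DERIV_imp_deriv)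
    ultimately show "q \<in> kernel (real n)" by (simp add: kernel_def solves_def)
  qed
qed

lemma orthogonal_solution_unique:
  assumes "solves \<kappa> g p" "orthogonal_to p (kernel \<kappa>)"
    and "solves \<kappa> g q" "orthogonal_to q (kernel \<kappa>)" and "\<kappa> > 0"
  shows "p = q"
proof -
  define d where "d = (\<lambda>\<theta>. p \<theta> - q \<theta>)"
  have sp: "smooth_circle p" and sq: "smooth_circle q" using assms by (auto simp: solves_def)
  have hd: "(deriv ^^ n) d = (\<lambda>\<theta>. (deriv ^^ n) p \<theta> - (deriv ^^ n) q \<theta>)" for n
  proof (induction n)
    case (Suc n)
    have "(deriv ^^ n) p differentiable at \<theta>" "(deriv ^^ n) q differentiable at \<theta>" for \<theta>
      using sp sq by (auto simp: smooth_circle_def)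
    then have "((\<lambda>\<theta>. (deriv ^^ n) p \<theta> - (deriv ^^ n) q \<theta>) has_real_derivative
       deriv ((deriv ^^ n) p) \<theta> - deriv ((deriv ^^ n) q) \<theta>) (at \<theta>)" for \<theta>
      by (intro DERIV_diff) (auto simp: DERIV_deriv_iff_real_differentiable)
    then show ?case using Suc by (auto intro!: ext DERIV_imp_deriv)
  qed (simp add: d_def)
  have "smooth_circle d"
    unfolding smooth_circle_def hd using sp sq
    by (auto simp: smooth_circle_def d_def intro!: differentiable_diff)
  moreover have "deriv (deriv d) \<theta> + \<kappa>\<^sup>2 * d \<theta> = 0" for \<theta>
  proof -
    have "deriv (deriv d) \<theta> = deriv (deriv p) \<theta> - deriv (deriv q) \<theta>" using fun_cong[OF hd[of 2], of \<theta>]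
      by (simp add: numeral_2_eq_2)
    moreover have "deriv (deriv p) \<theta> + \<kappa>\<^sup>2 * p \<theta> = g \<theta>" "deriv (deriv q) \<theta> + \<kappa>\<^sup>2 * q \<theta> = g \<theta>"
      using assms by (auto simp: solves_def)
    ultimately show ?thesis by (simp add: d_def algebra_simps)
  qed
  ultimately have ker: "d \<in> kernel \<kappa>" and sd: "smooth_circle d" by (simp_all add: kernel_def solves_def)
  have int: "(\<lambda>\<theta>. r \<theta> * d \<theta>) integrable_on {0..2*pi}" if "smooth_circle r" for r
    using smooth_circle_continuous[OF sd] smooth_circle_continuous[OF that]
    by (intro integrable_continuous_interval continuous_intros)
  have "L2_inner d d = L2_inner p d - L2_inner q d"
    unfolding L2_inner_def using integral_diff[OF int[OF sp] int[OF sq]]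
    by (simp add: d_def left_diff_distrib)
  also have "\<dots> = 0" using assms ker by (simp add: orthogonal_to_def)
  finally have "integral {0..2*pi} (\<lambda>\<theta>. d \<theta> * d \<theta>) = 0" by (simp add: L2_inner_def)
  then have "((\<lambda>\<theta>. d \<theta> * d \<theta>) has_integral 0) (cbox 0 (2*pi))"
    using int[OF sd] by (simp add: has_integral_iff)
  then have zero: "d \<theta> * d \<theta> = 0" if "\<theta> \<in> {0..2*pi}" for \<theta>
    using that smooth_circle_continuous[OF sd]
    by (intro has_integral_0_cbox_imp_0[of 0 "2*pi" "\<lambda>\<theta>. d \<theta> * d \<theta>"]) (auto intro!: continuous_intros simp: not_le)
  obtain c e where d: "d = (\<lambda>\<theta>. c * cos (\<kappa> * \<theta>) + e * sin (\<kappa> * \<theta>))"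
    using kernel_imp_cos_sin[OF ker \<open>\<kappa> > 0\<close>] by blast
  have "c = 0" using zero[of 0] by (simp add: d)
  moreover have "e = 0"
  proof -
    define x where "x = min (2 * pi) (pi / (2 * \<kappa>))"
    have x: "0 < x" "x \<le> 2 * pi" "\<kappa> * x \<le> pi / 2" using \<open>\<kappa> > 0\<close>
      by (auto simp: x_def min_def field_simps)
    then have "sin (\<kappa> * x) > 0" using \<open>\<kappa> > 0\<close> by (intro sin_gt_zero) (auto intro: le_less_trans[OF x(3)])
    with zero[of x] x \<open>c = 0\<close> show ?thesis by (simp add: d)
  qed
  ultimately have "d \<theta> = 0" for \<theta> by (simp add: d)
  then show ?thesis by (auto simp: d_def)
qed

lemma trig_orthogonal_kernel:
  assumes "trig d B p" "real d < \<kappa>"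
  shows "orthogonal_to p (kernel \<kappa>)"
  unfolding orthogonal_to_def
proof
  fix q assume q: "q \<in> kernel \<kappa>"
  have s: "smooth_circle q" and eq: "deriv (deriv q) \<theta> = - \<kappa>\<^sup>2 * q \<theta>" for \<theta>
    using q by (auto simp: kernel_def solves_def eq_neg_iff_add_eq_0)
  note D = smooth_circle_deriv[OF s]
  have "((\<lambda>\<theta>. p \<theta> * q \<theta>) has_integral 0) {0..2*pi}"
    using assms(1)
  proof induction
    case (trig_cos n c \<phi>)
    define F where "F = (\<lambda>\<theta>. cos (real_of_int n * \<theta> + \<phi>) * deriv q \<theta> + n * sin (real_of_int n * \<theta> + \<phi>) * q \<theta>)"
    define G where "G = (\<lambda>\<theta>. ((of_int n)\<^sup>2 - \<kappa>\<^sup>2) * (cos (real_of_int n * \<theta> + \<phi>) * q \<theta>))"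
    have "(F has_real_derivative G \<theta>) (at \<theta>)" for \<theta>
      unfolding F_def G_def
      by (auto intro!: derivative_eq_intros D(1)[THEN DERIV_cong] D(2)[THEN DERIV_cong]
          simp: eq power2_eq_square algebra_simps)
    then have "(G has_integral (F (2 * pi) - F 0)) {0..2*pi}"
      by (intro fundamental_theorem_of_calculus)
        (auto simp: has_real_derivative_iff_has_vector_derivative[symmetric] intro: has_field_derivative_at_within)
    moreover have "F (2 * pi) = F 0"
    proof -
      have "q (0 + 2 * pi) = q 0" "deriv q (0 + 2 * pi) = deriv q 0"
        using s smooth_circle_deriv_periodic[OF s] unfolding smooth_circle_def by blast+
      moreover have "cos (real_of_int n * (2 * pi) + \<phi>) = cos \<phi>" "sin (real_of_int n * (2 * pi) + \<phi>) = sin \<phi>"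
        using cos_int_2pin[of n] sin_int_2pin[of n]
        by (simp_all add: cos_add sin_add mult.commute[of _ "2 * pi"])
      ultimately show ?thesis by (simp add: F_def)
    qed
    ultimately have "(G has_integral 0) {0..2*pi}" by simp
    from has_integral_mult_right[OF this, of "c / ((of_int n)\<^sup>2 - \<kappa>\<^sup>2)"]
    have "((\<lambda>\<theta>. c / ((of_int n)\<^sup>2 - \<kappa>\<^sup>2) * G \<theta>) has_integral 0) {0..2*pi}" by simp
    moreover have "(of_int n)\<^sup>2 \<noteq> \<kappa>\<^sup>2"
    proof -
      have "\<bar>of_int n\<bar> < \<kappa>" using trig_cos assms(2) by linarith
      then show ?thesis by (auto simp: power2_eq_iff)
    qed
    ultimately show ?case by (simp add: G_def mult.assoc)
  next
    case (trig_add B p C r)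
    then show ?case using has_integral_add[OF trig_add.IH] by (simp add: distrib_right)
  qed simp
  then show "L2_inner p q = 0" by (auto simp: L2_inner_def)
qed

lemma harmonics_trig:
  assumes "X \<in> harmonics i" "i \<ge> 1"
  shows "trig i (L2_norm X) X"
proof -
  obtain c d where X: "X = (\<lambda>\<theta>. c * cos (real i * \<theta>) + d * sin (real i * \<theta>))"
    using assms by (auto simp: harmonics_def)
  define F where "F = (\<lambda>\<theta>. (c\<^sup>2 + d\<^sup>2) / 2 * \<theta> + ((c\<^sup>2 - d\<^sup>2) / 2 * (sin (real i * \<theta>) * cos (real i * \<theta>)) + c * d * (sin (real i * \<theta>))\<^sup>2) / real i)"
  have "(F has_real_derivative X \<theta> * X \<theta>) (at \<theta>)" for \<theta>
  proof -
    have "(F has_real_derivative (c\<^sup>2 + d\<^sup>2) / 2 + (c\<^sup>2 - d\<^sup>2) / 2 * ((cos (real i * \<theta>))\<^sup>2 - (sin (real i * \<theta>))\<^sup>2)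
        + c * d * (2 * sin (real i * \<theta>) * cos (real i * \<theta>))) (at \<theta>)"
      unfolding F_def using assms(2)
      by (auto intro!: derivative_eq_intros simp: field_simps power2_eq_square)
    also have "(c\<^sup>2 + d\<^sup>2) / 2 + (c\<^sup>2 - d\<^sup>2) / 2 * ((cos (real i * \<theta>))\<^sup>2 - (sin (real i * \<theta>))\<^sup>2)
        + c * d * (2 * sin (real i * \<theta>) * cos (real i * \<theta>)) = X \<theta> * X \<theta>"
    proof -
      have "(c\<^sup>2 + d\<^sup>2) / 2 * (C\<^sup>2 + S\<^sup>2) + (c\<^sup>2 - d\<^sup>2) / 2 * (C\<^sup>2 - S\<^sup>2)
          + c * d * (2 * S * C) = (c * C + d * S) * (c * C + d * S)" for C S :: real
        by (simp add: field_simps power2_eq_square)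
      from this[of "cos (real i * \<theta>)" "sin (real i * \<theta>)"] show ?thesis unfolding X by simp
    qed
    finally show ?thesis .
  qed
  then have "((\<lambda>\<theta>. X \<theta> * X \<theta>) has_integral (F (2 * pi) - F 0)) {0..2*pi}"
    by (intro fundamental_theorem_of_calculus)
      (auto simp: has_real_derivative_iff_has_vector_derivative[symmetric] intro: has_field_derivative_at_within)
  moreover have "F (2 * pi) - F 0 = pi * (c\<^sup>2 + d\<^sup>2)"
  proof -
    have "sin (real i * (2 * pi)) = 0" using sin_int_2pin[of "int i"] by (simp add: mult.commute[of _ "2 * pi"])
    then show ?thesis by (simp add: F_def)
  qed
  ultimately have L: "L2_inner X X = pi * (c\<^sup>2 + d\<^sup>2)"
    by (simp add: L2_inner_def integral_unique)
  have "(\<bar>c\<bar> + \<bar>d\<bar>)\<^sup>2 \<le> 2 * (c\<^sup>2 + d\<^sup>2)"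
    using zero_le_power2[of "\<bar>c\<bar> - \<bar>d\<bar>"] by (simp add: power2_sum power2_diff)
  also have "\<dots> \<le> pi * (c\<^sup>2 + d\<^sup>2)"
    using pi_ge_two by (intro mult_right_mono) auto
  finally have "\<bar>c\<bar> + \<bar>d\<bar> \<le> L2_norm X"
    unfolding L2_norm_def L by (rule real_le_rsqrt)
  moreover have "trig i (\<bar>c\<bar> + \<bar>d\<bar>) X"
    unfolding X using trig_add[OF trig_cos[of "int i" i c 0] trig_cos[of "int i" i d "- pi / 2"]]
    by (simp add: cos_diff)
  ultimately show ?thesis by (auto intro: trig_mono)
qed

subsection \<open>Termwise differentiation of unordered sums\<close>

lemma has_sum_diff:
  fixes f g :: "'i \<Rightarrow> real"
  assumes "(f has_sum a) A" "(g has_sum b) A"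
  shows "((\<lambda>x. f x - g x) has_sum (a - b)) A"
  using has_sum_add[OF assms(1) has_sum_cmult_right[OF assms(2), of "-1"]] by simp

lemma field_derivative_quadratic_remainder:
  fixes f :: "real \<Rightarrow> real"
  assumes "convex S" "x \<in> S" "y \<in> S"
    and f: "\<And>s. s \<in> S \<Longrightarrow> (f has_real_derivative f' s) (at s within S)"
    and f': "\<And>s. s \<in> S \<Longrightarrow> (f' has_real_derivative f'' s) (at s within S)"
    and C: "\<And>s. s \<in> S \<Longrightarrow> \<bar>f'' s\<bar> \<le> C"
  shows "\<bar>f y - f x - f' x * (y - x)\<bar> \<le> C * (y - x)\<^sup>2"
proof -
  define T where "T = closed_segment x y"
  have T: "T \<subseteq> S" "convex T" "x \<in> T" "y \<in> T"
    using assms by (auto simp: T_def closed_segment_subset)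
  have "C \<ge> 0" using C[OF assms(2)] by linarith
  have b: "norm (f' z - f' x) \<le> C * \<bar>y - x\<bar>" if "z \<in> T" for z
  proof -
    have "norm (f' z - f' x) \<le> C * norm (z - x)"
      using field_differentiable_bound[OF assms(1) f', of C z x] C that T assms by auto
    also have "norm (z - x) \<le> \<bar>y - x\<bar>"
      using that segment_bound1[of z x y] by (simp add: T_def abs_minus_commute)
    finally show ?thesis using \<open>C \<ge> 0\<close> by (auto simp: mult_left_mono)
  qed
  define g where "g = (\<lambda>z. f z - f' x * z)"
  have "(g has_real_derivative (f' z - f' x)) (at z within T)" if "z \<in> T" for z
    unfolding g_def using DERIV_subset[OF f T(1)] that T(1)
    by (auto intro!: derivative_eq_intros)
  from field_differentiable_bound[OF T(2) this b T(4,3)]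
  have "norm (g y - g x) \<le> C * \<bar>y - x\<bar> * norm (y - x)" by simp
  then show ?thesis by (simp add: g_def algebra_simps power2_eq_square abs_mult_self_eq)
qed

lemma has_real_derivative_infsum:
  fixes f :: "'i \<Rightarrow> real \<Rightarrow> real"
  assumes S: "convex S" "x \<in> S"
    and f: "\<And>i s. i \<in> I \<Longrightarrow> s \<in> S \<Longrightarrow> (f i has_real_derivative f' i s) (at s within S)"
    and f': "\<And>i s. i \<in> I \<Longrightarrow> s \<in> S \<Longrightarrow> (f' i has_real_derivative f'' i s) (at s within S)"
    and C: "\<And>i s. i \<in> I \<Longrightarrow> s \<in> S \<Longrightarrow> \<bar>f'' i s\<bar> \<le> C i" "C summable_on I"
    and sf: "\<And>s. s \<in> S \<Longrightarrow> (\<lambda>i. f i s) summable_on I"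
    and sf': "(\<lambda>i. f' i x) summable_on I"
  shows "((\<lambda>s. \<Sum>\<^sub>\<infinity>i\<in>I. f i s) has_real_derivative (\<Sum>\<^sub>\<infinity>i\<in>I. f' i x)) (at x within S)"
proof -
  define F where "F = (\<lambda>s. \<Sum>\<^sub>\<infinity>i\<in>I. f i s)"
  define D where "D = (\<Sum>\<^sub>\<infinity>i\<in>I. f' i x)"
  define K where "K = infsum C I"
  have quad: "\<bar>F y - F x - D * (y - x)\<bar> \<le> K * (y - x)\<^sup>2" if "y \<in> S" for y
  proof -
    have "((\<lambda>i. f i y - f i x - f' i x * (y - x)) has_sum (F y - F x - D * (y - x))) I"
      unfolding F_def D_def using that S
      by (intro has_sum_diff has_sum_cmult_left has_sum_infsum sf sf')
    moreover have "((\<lambda>i. C i * (y - x)\<^sup>2) has_sum (K * (y - x)\<^sup>2)) I"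
      unfolding K_def by (intro has_sum_cmult_left has_sum_infsum C)
    moreover have "norm (f i y - f i x - f' i x * (y - x)) \<le> C i * (y - x)\<^sup>2" if "i \<in> I" for i
      using field_derivative_quadratic_remainder[OF S \<open>y \<in> S\<close> f f' C(1), OF that _ that _ that] by simp
    ultimately have "norm (F y - F x - D * (y - x)) \<le> K * (y - x)\<^sup>2"
      by (rule norm_infsum_le)
    then show ?thesis by simp
  qed
  have "((\<lambda>y. (F y - F x) / (y - x) - D) \<longlongrightarrow> 0) (at x within S)"
  proof (rule Lim_null_comparison)
    show "\<forall>\<^sub>F y in at x within S. norm ((F y - F x) / (y - x) - D) \<le> K * \<bar>y - x\<bar>"
      unfolding eventually_at_filter
    proof (intro always_eventually allI impI)
      fix y assume y: "y \<noteq> x" "y \<in> S"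
      have "(F y - F x) / (y - x) - D = (F y - F x - D * (y - x)) / (y - x)"
        using y by (simp add: field_simps)
      then have "norm ((F y - F x) / (y - x) - D) = \<bar>F y - F x - D * (y - x)\<bar> / \<bar>y - x\<bar>"
        by simp
      also have "\<dots> \<le> K * (y - x)\<^sup>2 / \<bar>y - x\<bar>"
        using quad[OF y(2)] by (intro divide_right_mono) auto
      also have "\<dots> = K * \<bar>y - x\<bar>"
      proof -
        have "(y - x)\<^sup>2 = \<bar>y - x\<bar> * \<bar>y - x\<bar>" by (simp add: power2_eq_square)
        then show ?thesis using y by (simp del: abs_mult_self_eq)
      qed
      finally show "norm ((F y - F x) / (y - x) - D) \<le> K * \<bar>y - x\<bar>" .
    qed
    show "((\<lambda>y. K * \<bar>y - x\<bar>) \<longlongrightarrow> 0) (at x within S)"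
      by (auto intro!: tendsto_eq_intros)
  qed
  then show ?thesis unfolding has_field_derivative_iff F_def D_def by (rule LIM_zero_cancel)
qed

definition has_partial_deriv :: "real \<Rightarrow> coord \<Rightarrow> (real \<Rightarrow> real \<Rightarrow> real) \<Rightarrow> (real \<Rightarrow> real \<Rightarrow> real) \<Rightarrow> bool" where
  "has_partial_deriv t\<^sub>0 c u u' \<longleftrightarrow> (\<forall>t\<ge>t\<^sub>0. \<forall>\<theta>. case c of
     Time \<Rightarrow> ((\<lambda>s. u s \<theta>) has_real_derivative u' t \<theta>) (at t within {t\<^sub>0..})
   | Angle \<Rightarrow> (u t has_real_derivative u' t \<theta>) (at \<theta>))"

lemma at_within_atLeast_neq_bot: "t \<ge> t\<^sub>0 \<Longrightarrow> at t within {t\<^sub>0..} \<noteq> (bot :: real filter)"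
proof
  assume "t \<ge> t\<^sub>0" "at t within {t\<^sub>0..} = bot"
  moreover from this(1) have "at_right t \<le> at t within {t\<^sub>0..}" by (intro at_le) auto
  ultimately show False using trivial_limit_at_right_real[of t] by (simp add: bot_unique)
qed

lemma has_partial_deriv_partial:
  assumes "has_partial_deriv t\<^sub>0 c u u'" "\<And>t \<theta>. t \<ge> t\<^sub>0 \<Longrightarrow> v t \<theta> = u t \<theta>"
  shows "has_partial t\<^sub>0 c v" "t \<ge> t\<^sub>0 \<Longrightarrow> partial t\<^sub>0 c v t \<theta> = u' t \<theta>"
proof -
  have "has_partial t\<^sub>0 c v \<and> (t \<ge> t\<^sub>0 \<longrightarrow> partial t\<^sub>0 c v t \<theta> = u' t \<theta>)"
  proof (cases c)
    case Time
    have "((\<lambda>s. v s \<theta>) has_real_derivative u' t \<theta>) (at t within {t\<^sub>0..})" if "t \<ge> t\<^sub>0" for t \<theta>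
    proof (rule has_field_derivative_transform_within[OF _ zero_less_one])
      show "((\<lambda>s. u s \<theta>) has_real_derivative u' t \<theta>) (at t within {t\<^sub>0..})"
        using assms(1) that by (auto simp: has_partial_deriv_def Time)
    qed (use assms(2) that in auto)
    then show ?thesis
      by (auto simp: Time at_within_atLeast_neq_bot real_differentiable_def
          has_real_derivative_iff_has_vector_derivative intro!: vector_derivative_within
          intro: differentiableI_vector)
  next
    case Angle
    have "(v t has_real_derivative u' t \<theta>) (at \<theta>)" if "t \<ge> t\<^sub>0" for t \<theta>
    proof -
      have "v t = u t" using assms(2)[OF that] by auto
      then show ?thesis using assms(1) that by (auto simp: has_partial_deriv_def Angle)
    qed
    then show ?thesis
      by (auto simp: Angle real_differentiable_def has_real_derivative_iff_has_vector_derivative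
          intro!: vector_derivative_at intro: differentiableI_vector)
  qed
  then show "has_partial t\<^sub>0 c v" "t \<ge> t\<^sub>0 \<Longrightarrow> partial t\<^sub>0 c v t \<theta> = u' t \<theta>" by auto
qed

lemma partials_eq:
  assumes "\<And>w c. has_partial_deriv t\<^sub>0 c (V w) (V (c # w))" "t \<ge> t\<^sub>0"
  shows "partials t\<^sub>0 w (V []) t \<theta> = V w t \<theta>"
  using assms(2)
proof (induction w arbitrary: t \<theta>)
  case (Cons c w)
  have "partial t\<^sub>0 c (partials t\<^sub>0 w (V [])) t \<theta> = V (c # w) t \<theta>"
    using Cons by (intro has_partial_deriv_partial(2)[OF assms(1)]) auto
  then show ?case by (simp add: partials_def)
qed (simp add: partials_def)

lemma Cm_series:
  fixes U :: "coord list \<Rightarrow> 'i \<Rightarrow> real \<Rightarrow> real \<Rightarrow> real"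
  assumes U: "\<And>w c i. i \<in> I \<Longrightarrow> has_partial_deriv t\<^sub>0 c (U w i) (U (c # w) i)"
    and B: "\<And>w i t \<theta>. i \<in> I \<Longrightarrow> t \<ge> t\<^sub>0 \<Longrightarrow> \<bar>U w i t \<theta>\<bar> \<le> B w i" "\<And>w. B w summable_on I"
    and cont: "\<And>w i. i \<in> I \<Longrightarrow> continuous_on ({t\<^sub>0..} \<times> UNIV) (\<lambda>(t, \<theta>). U w i t \<theta>)"
    and per: "\<And>i t \<theta>. i \<in> I \<Longrightarrow> U [] i t (\<theta> + 2 * pi) = U [] i t \<theta>"
  defines "V \<equiv> \<lambda>w t \<theta>. \<Sum>\<^sub>\<infinity>i\<in>I. U w i t \<theta>"
  shows "smooth_cylinder t\<^sub>0 (V [])" "Cm_has_sum t\<^sub>0 m (U []) I (V [])"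
    "t \<ge> t\<^sub>0 \<Longrightarrow> partials t\<^sub>0 w (V []) t \<theta> = V w t \<theta>"
proof -
  have sU: "(\<lambda>i. U w i t \<theta>) summable_on I" if "t \<ge> t\<^sub>0" for w t \<theta>
    by (subst summable_on_iff_abs_summable_on_real, rule Infinite_Sum.abs_summable_on_comparison_test'[OF B(2)[of w]])
      (use B(1) that in auto)
  have V: "has_partial_deriv t\<^sub>0 c (V w) (V (c # w))" for w c
  proof (cases c)
    case Time
    have "((\<lambda>s. \<Sum>\<^sub>\<infinity>i\<in>I. U w i s \<theta>) has_real_derivative (\<Sum>\<^sub>\<infinity>i\<in>I. U (c # w) i t \<theta>)) (at t within {t\<^sub>0..})"
      if "t \<ge> t\<^sub>0" for t \<theta>
    proof (rule has_real_derivative_infsum[where f'' = "\<lambda>i s. U (c # c # w) i s \<theta>" and C = "B (c # c # w)"])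
      show "((\<lambda>s. U w i s \<theta>) has_real_derivative U (c # w) i s \<theta>) (at s within {t\<^sub>0..})"
        "((\<lambda>s. U (c # w) i s \<theta>) has_real_derivative U (c # c # w) i s \<theta>) (at s within {t\<^sub>0..})"
        if "i \<in> I" "s \<in> {t\<^sub>0..}" for i s
        using U[OF that(1), of c w] U[OF that(1), of c "c # w"] that(2) by (auto simp: has_partial_deriv_def Time)
    qed (use B sU that in auto)
    then show ?thesis by (simp add: has_partial_deriv_def Time V_def)
  next
    case Angle
    have "((\<lambda>x. \<Sum>\<^sub>\<infinity>i\<in>I. U w i t x) has_real_derivative (\<Sum>\<^sub>\<infinity>i\<in>I. U (c # w) i t \<theta>)) (at \<theta> within UNIV)"
      if "t \<ge> t\<^sub>0" for t \<theta>
    proof (rule has_real_derivative_infsum[where f'' = "\<lambda>i x. U (c # c # w) i t x" and C = "B (c # c # w)"])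
      show "(U w i t has_real_derivative U (c # w) i t x) (at x within UNIV)"
        "(U (c # w) i t has_real_derivative U (c # c # w) i t x) (at x within UNIV)"
        if "i \<in> I" for i x
        using U[OF that(1), of c w] U[OF that(1), of c "c # w"] \<open>t \<ge> t\<^sub>0\<close> by (auto simp: has_partial_deriv_def Angle)
    qed (use B sU that in auto)
    then show ?thesis by (simp add: has_partial_deriv_def Angle V_def)
  qed
  show part: "partials t\<^sub>0 w (V []) t \<theta> = V w t \<theta>" if "t \<ge> t\<^sub>0" for w t \<theta>
    using partials_eq[OF V that] .
  have partU: "partials t\<^sub>0 w (U [] i) t \<theta> = U w i t \<theta>" if "i \<in> I" "t \<ge> t\<^sub>0" for w t \<theta> i
    using partials_eq[of t\<^sub>0 "\<lambda>w. U w i", OF U[OF that(1)] that(2)] .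
  have ul: "uniform_limit ({t\<^sub>0..} \<times> UNIV) (\<lambda>F (t, \<theta>). \<Sum>i\<in>F. U w i t \<theta>) (\<lambda>(t, \<theta>). V w t \<theta>)
      (finite_subsets_at_top I)" for w
  proof -
    have "uniform_limit ({t\<^sub>0..} \<times> UNIV) (\<lambda>F y. \<Sum>i\<in>F. (\<lambda>(t, \<theta>). U w i t \<theta>) y)
      (\<lambda>y. \<Sum>\<^sub>\<infinity>i\<in>I. (\<lambda>(t, \<theta>). U w i t \<theta>) y) (finite_subsets_at_top I)"
      using B by (intro Weierstrass_m_test_general[where M = "B w"]) auto
    then show ?thesis by (simp add: V_def case_prod_unfold)
  qed
  show "Cm_has_sum t\<^sub>0 m (U []) I (V [])"
    unfolding Cm_has_sum_def
  proof (intro allI impI)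
    fix w :: "coord list"
    have "\<forall>\<^sub>F F in finite_subsets_at_top I. F \<subseteq> I"
      by (auto simp: eventually_finite_subsets_at_top intro: exI[of _ "{}"])
    then have "\<forall>\<^sub>F F in finite_subsets_at_top I. \<forall>x\<in>{t\<^sub>0..} \<times> UNIV.
        (case x of (t, \<theta>) \<Rightarrow> \<Sum>i\<in>F. U w i t \<theta>) = (case x of (t, \<theta>) \<Rightarrow> \<Sum>i\<in>F. partials t\<^sub>0 w (U [] i) t \<theta>)"
      by eventually_elim (auto intro!: sum.cong simp: partU subset_iff)
    then show "uniform_limit ({t\<^sub>0..} \<times> UNIV) (\<lambda>F (t, \<theta>). \<Sum>i\<in>F. partials t\<^sub>0 w (U [] i) t \<theta>)
         (\<lambda>(t, \<theta>). partials t\<^sub>0 w (V []) t \<theta>) (finite_subsets_at_top I)"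
      by (rule uniform_limit_cong[THEN iffD1, OF _ _ ul[of w]]) (auto simp: part)
  qed
  have contV: "continuous_on ({t\<^sub>0..} \<times> UNIV) (\<lambda>(t, \<theta>). V w t \<theta>)" for w
  proof (rule uniform_limit_theorem[OF _ ul])
    show "\<forall>\<^sub>F F in finite_subsets_at_top I. continuous_on ({t\<^sub>0..} \<times> UNIV) (\<lambda>(t, \<theta>). \<Sum>i\<in>F. U w i t \<theta>)"
      using cont by (auto simp: eventually_finite_subsets_at_top case_prod_unfold subset_iff
          intro!: exI[of _ "{}"] continuous_on_sum)
  qed auto
  have "continuous_on ({t\<^sub>0..} \<times> UNIV) (\<lambda>(t, \<theta>). partials t\<^sub>0 w (V []) t \<theta>)" for w
    using contV[of w] by (rule continuous_on_eq) (auto simp: part)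
  moreover have "has_partial t\<^sub>0 c (partials t\<^sub>0 w (V []))" for w c
    by (rule has_partial_deriv_partial(1)[OF V[of c w]]) (simp add: part)
  moreover have "V [] t (\<theta> + 2 * pi) = V [] t \<theta>" for t \<theta>
    unfolding V_def by (intro infsum_cong per)
  ultimately show "smooth_cylinder t\<^sub>0 (V [])" by (simp add: smooth_cylinder_def)
qed

subsection \<open>Sums over lists\<close>

lemma lists_of_length_Suc:
  "{xs. set xs \<subseteq> A \<and> length xs = Suc n} = (\<lambda>(x, xs). x # xs) ` (A \<times> {xs. set xs \<subseteq> A \<and> length xs = n})"
proof -
  have "xs \<in> (\<lambda>(x, xs). x # xs) ` (A \<times> {xs. set xs \<subseteq> A \<and> length xs = n})"
    if "set xs \<subseteq> A" "length xs = Suc n" for xs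
    using that by (cases xs) auto
  then show ?thesis by auto
qed

lemma has_sum_lists_nonneg:
  fixes f :: "'i \<Rightarrow> real"
  assumes "(f has_sum S) A" "\<And>x. x \<in> A \<Longrightarrow> f x \<ge> 0"
  shows "((\<lambda>xs. \<Prod>x\<leftarrow>xs. f x) has_sum S ^ n) {xs. set xs \<subseteq> A \<and> length xs = n}"
proof (induction n)
  case 0
  have "{xs. set xs \<subseteq> A \<and> length xs = 0} = {[]}" by auto
  then show ?case using has_sum_finite[of "{[]}" "\<lambda>xs. \<Prod>x\<leftarrow>xs. f x"] by simp
next
  case (Suc n)
  let ?L = "{xs. set xs \<subseteq> A \<and> length xs = n}"
  let ?g = "\<lambda>(x, xs). f x * (\<Prod>x\<leftarrow>xs. f x)"
  have inner: "((\<lambda>xs. ?g (x, xs)) has_sum f x * S ^ n) ?L" for x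
    using has_sum_cmult_right[OF Suc, of "f x"] by simp
  have outer: "((\<lambda>x. f x * S ^ n) has_sum S * S ^ n) A"
    using has_sum_cmult_left[OF assms(1)] .
  have inj: "inj_on (\<lambda>(x, xs). x # xs) (A \<times> ?L)" by (auto simp: inj_on_def)
  have "?g summable_on Sigma A (\<lambda>_. ?L)"
  proof (rule summable_on_SigmaI[OF inner has_sum_imp_summable[OF outer]])
    show "0 \<le> ?g (x, xs)" if "x \<in> A" "xs \<in> ?L" for x xs
      using assms(2) that by (auto intro!: mult_nonneg_nonneg prod_list_nonneg simp: subset_iff)
  qed
  from has_sum_SigmaI[OF inner outer this] have "(?g has_sum S ^ Suc n) (A \<times> ?L)" by simp
  then show ?case
    unfolding lists_of_length_Suc
    using has_sum_reindex[OF inj, of "\<lambda>xs. \<Prod>x\<leftarrow>xs. f x"] by (simp add: o_def case_prod_unfold)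
qed

lemma abs_prod_list: "\<bar>\<Prod>x\<leftarrow>xs. f x\<bar> = (\<Prod>x\<leftarrow>xs. \<bar>f x :: real\<bar>)"
  by (induction xs) (auto simp: abs_mult)

lemma has_sum_lists:
  fixes f :: "'i \<Rightarrow> real"
  assumes "(f has_sum S) A"
  shows "((\<lambda>xs. \<Prod>x\<leftarrow>xs. f x) has_sum S ^ n) {xs. set xs \<subseteq> A \<and> length xs = n}"
proof (induction n)
  case 0
  have "{xs. set xs \<subseteq> A \<and> length xs = 0} = {[]}" by auto
  then show ?case using has_sum_finite[of "{[]}" "\<lambda>xs. \<Prod>x\<leftarrow>xs. f x"] by simp
next
  case (Suc n)
  let ?L = "\<lambda>n. {xs. set xs \<subseteq> A \<and> length xs = n}"
  let ?g = "\<lambda>(x, xs). f x * (\<Prod>x\<leftarrow>xs. f x)"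
  have inner: "((\<lambda>xs. ?g (x, xs)) has_sum f x * S ^ n) (?L n)" for x
    using has_sum_cmult_right[OF Suc, of "f x"] by simp
  have outer: "((\<lambda>x. f x * S ^ n) has_sum S * S ^ n) A"
    using has_sum_cmult_left[OF assms(1)] .
  have inj: "inj_on (\<lambda>(x, xs). x # xs) (A \<times> ?L n)" by (auto simp: inj_on_def)
  have "((\<lambda>x. \<bar>f x\<bar>) has_sum (\<Sum>\<^sub>\<infinity>x\<in>A. \<bar>f x\<bar>)) A"
    using has_sum_imp_summable[OF assms] unfolding summable_on_iff_abs_summable_on_real[of f]
    by (auto intro: has_sum_infsum)
  from has_sum_imp_summable[OF has_sum_lists_nonneg[OF this]]
  have "(\<lambda>xs. \<Prod>x\<leftarrow>xs. \<bar>f x\<bar>) summable_on ?L (Suc n)" by simp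
  then have "(\<lambda>xs. \<Prod>x\<leftarrow>xs. f x) summable_on ?L (Suc n)"
    by (subst summable_on_iff_abs_summable_on_real) (simp add: abs_prod_list)
  then have "?g summable_on Sigma A (\<lambda>_. ?L n)"
    unfolding lists_of_length_Suc
    by (subst (asm) summable_on_reindex[OF inj]) (simp add: o_def case_prod_unfold)
  from has_sum_SigmaI[OF inner outer this] have "(?g has_sum S ^ Suc n) (A \<times> ?L n)" by simp
  then show ?case
    unfolding lists_of_length_Suc
    using has_sum_reindex[OF inj, of "\<lambda>xs. \<Prod>x\<leftarrow>xs. f x"] by (simp add: o_def case_prod_unfold)
qed

lemma sum_prod_lists:
  fixes f :: "'i \<Rightarrow> real"
  assumes "finite A"
  shows "(\<Sum>xs | set xs \<subseteq> A \<and> length xs = n. \<Prod>x\<leftarrow>xs. f x) = (\<Sum>x\<in>A. f x) ^ n"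
proof -
  have "((\<lambda>xs. \<Prod>x\<leftarrow>xs. f x) has_sum (\<Sum>x\<in>A. f x) ^ n) {xs. set xs \<subseteq> A \<and> length xs = n}"
    by (intro has_sum_lists) (use assms in simp)
  moreover have "finite {xs. set xs \<subseteq> A \<and> length xs = n}"
    using finite_lists_length_eq[OF assms] .
  ultimately show ?thesis by (metis has_sum_finite has_sum_unique)
qed

lemma has_sum_power_series_lists:
  fixes f :: "'i \<Rightarrow> real" and c :: "nat \<Rightarrow> real"
  assumes f: "(f has_sum S) A" "((\<lambda>x. \<bar>f x\<bar>) has_sum T) A"
    and c: "summable (\<lambda>j. \<bar>c j\<bar> * T ^ j)" "(\<lambda>j. c j * S ^ j) sums y"
  shows "((\<lambda>xs. c (length xs) * (\<Prod>x\<leftarrow>xs. f x)) has_sum y) {xs. set xs \<subseteq> A}"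
proof -
  let ?L = "\<lambda>n. {xs. set xs \<subseteq> A \<and> length xs = n}"
  let ?g = "\<lambda>(n, xs). c n * (\<Prod>x\<leftarrow>xs. f x)"
  have "((\<lambda>(n, xs). \<bar>c n\<bar> * (\<Prod>x\<leftarrow>xs. \<bar>f x\<bar>))) summable_on Sigma UNIV ?L"
  proof (rule summable_on_SigmaI)
    show "((\<lambda>xs. (\<lambda>(n, xs). \<bar>c n\<bar> * (\<Prod>x\<leftarrow>xs. \<bar>f x\<bar>)) (n, xs)) has_sum \<bar>c n\<bar> * T ^ n) (?L n)" for n
      using has_sum_cmult_right[OF has_sum_lists[OF f(2)]] by simp
    have "T \<ge> 0" using has_sum_nonneg[OF f(2)] by simp
    then show "(\<lambda>n. \<bar>c n\<bar> * T ^ n) summable_on UNIV"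
      using c(1) by (intro norm_summable_imp_summable_on) (simp add: abs_mult)
  qed (auto intro!: mult_nonneg_nonneg prod_list_nonneg)
  then have summ: "?g summable_on Sigma UNIV ?L"
    by (subst summable_on_iff_abs_summable_on_real) (simp add: abs_prod_list abs_mult case_prod_unfold)
  have ST: "\<bar>S\<bar> \<le> T" using norm_infsum_le[OF f] by simp
  have "summable (\<lambda>j. norm (c j * S ^ j))"
  proof (rule summable_comparison_test'[OF c(1), of 0])
    show "norm (norm (c j * S ^ j)) \<le> \<bar>c j\<bar> * T ^ j" for j
      using ST by (simp add: abs_mult power_abs mult_left_mono power_mono)
  qed
  then have outer: "((\<lambda>j. c j * S ^ j) has_sum y) UNIV"
    using c(2) by (rule norm_summable_imp_has_sum)
  have "(?g has_sum y) (Sigma UNIV ?L)"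
    by (rule has_sum_SigmaI[OF _ outer summ]) (use has_sum_cmult_right[OF has_sum_lists[OF f(1)]] in simp)
  moreover have "{xs. set xs \<subseteq> A} = snd ` Sigma UNIV ?L" by (force simp: image_def)
  moreover have "inj_on snd (Sigma UNIV ?L)" by (auto simp: inj_on_def)
  ultimately show ?thesis
    using has_sum_cong[of "Sigma UNIV ?L" ?g "(\<lambda>xs. c (length xs) * (\<Prod>x\<leftarrow>xs. f x)) \<circ> snd" y]
    by (auto simp: has_sum_reindex)
qed

lemma finite_listset: "(\<And>A. A \<in> set As \<Longrightarrow> finite A) \<Longrightarrow> finite (listset As)"
proof (induction As)
  case (Cons A As)
  have "set_Cons A (listset As) = (\<lambda>(x, xs). x # xs) ` (A \<times> listset As)"
    by (auto simp: set_Cons_def)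
  with Cons show ?case by simp
qed simp

lemma prod_list_sum_eq_sum_listset:
  fixes f :: "'i \<Rightarrow> 'a :: comm_semiring_1"
  shows "(\<Prod>k\<leftarrow>ks. \<Sum>x\<in>S k. f x) = (\<Sum>xs\<in>listset (map S ks). \<Prod>x\<leftarrow>xs. f x)"
proof (induction ks)
  case (Cons k ks)
  have "set_Cons (S k) (listset (map S ks)) = (\<lambda>(x, xs). x # xs) ` (S k \<times> listset (map S ks))"
    by (auto simp: set_Cons_def)
  then have "(\<Sum>xs\<in>listset (map S (k # ks)). \<Prod>x\<leftarrow>xs. f x) =
     (\<Sum>(x, xs)\<in>S k \<times> listset (map S ks). f x * (\<Prod>x\<leftarrow>xs. f x))"
    by (simp add: sum.reindex inj_on_def case_prod_unfold)
  also have "\<dots> = (\<Sum>x\<in>S k. f x) * (\<Prod>k\<leftarrow>ks. \<Sum>x\<in>S k. f x)"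
    by (simp add: Cons.IH sum_product sum.cartesian_product)
  finally show ?case by simp
qed simp

subsection \<open>Multi-indices\<close>

definition deg_index :: "(nat \<Rightarrow>\<^sub>0 nat) \<Rightarrow> nat" where
  "deg_index \<alpha> = (\<Sum>i\<in>Poly_Mapping.keys \<alpha>. Poly_Mapping.lookup \<alpha> i * i)"

lemma deg_index_superset:
  assumes "finite K" "Poly_Mapping.keys \<alpha> \<subseteq> K"
  shows "deg_index \<alpha> = (\<Sum>i\<in>K. Poly_Mapping.lookup \<alpha> i * i)"
  unfolding deg_index_def
  by (rule sum.mono_neutral_left) (use assms in \<open>auto simp: in_keys_iff\<close>)

lemma deg_index_add: "deg_index (\<alpha> + \<beta>) = deg_index \<alpha> + deg_index \<beta>"
proof -
  let ?K = "Poly_Mapping.keys \<alpha> \<union> Poly_Mapping.keys \<beta>"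
  have "Poly_Mapping.keys (\<alpha> + \<beta>) \<subseteq> ?K"
    by (rule Poly_Mapping.keys_add)
  then show ?thesis
    by (simp add: deg_index_superset[of ?K] lookup_add sum.distrib distrib_right)
qed

lemma deg_index_unit [simp]: "deg_index (unit_index i) = i"
  by (simp add: deg_index_def unit_index_def)

lemma pairing_eq: "pairing \<tau> \<alpha> = real (Poly_Mapping.lookup \<alpha> 0) * \<tau> + real (deg_index \<alpha>)"
proof -
  let ?K = "insert 0 (Poly_Mapping.keys \<alpha>)"
  have "pairing \<tau> \<alpha> = (\<Sum>i\<in>?K. real (Poly_Mapping.lookup \<alpha> i) * rho \<tau> i)"
    unfolding pairing_def by (rule sum.mono_neutral_left) (auto simp: in_keys_iff)
  also have "\<dots> = real (Poly_Mapping.lookup \<alpha> 0) * \<tau> + (\<Sum>i\<in>?K - {0}. real (Poly_Mapping.lookup \<alpha> i * i))"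
    by (subst sum.remove[of _ 0]) (auto simp: rho_def intro!: sum.cong)
  also have "(\<Sum>i\<in>?K - {0}. real (Poly_Mapping.lookup \<alpha> i * i)) = real (deg_index \<alpha>)"
    by (subst deg_index_superset[of ?K]) (auto simp: sum.remove[of _ 0])
  finally show ?thesis .
qed

lemma pairing_zero [simp]: "pairing \<tau> 0 = 0"
  by (simp add: pairing_def)

lemma pairing_add: "pairing \<tau> (\<alpha> + \<beta>) = pairing \<tau> \<alpha> + pairing \<tau> \<beta>"
  by (simp add: pairing_eq deg_index_add lookup_add algebra_simps)

lemma pairing_unit [simp]: "pairing \<tau> (unit_index i) = rho \<tau> i"
  by (simp add: pairing_def unit_index_def)

lemma pairing_sum_list: "pairing \<tau> (sum_list \<beta>s) = (\<Sum>\<beta>\<leftarrow>\<beta>s. pairing \<tau> \<beta>)"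
  by (induction \<beta>s) (auto simp: pairing_add)

lemma deg_index_sum_list: "deg_index (sum_list \<beta>s) = (\<Sum>\<beta>\<leftarrow>\<beta>s. deg_index \<beta>)"
  by (induction \<beta>s) (auto simp: deg_index_add, simp add: deg_index_def)

lemma pairing_nonneg: "\<tau> > 0 \<Longrightarrow> 0 \<le> pairing \<tau> \<alpha>"
  by (simp add: pairing_eq)

lemma lookup_le_pairing:
  assumes "\<tau> > 0"
  shows "real (Poly_Mapping.lookup \<alpha> i) * rho \<tau> i \<le> pairing \<tau> \<alpha>"
proof (cases "i \<in> Poly_Mapping.keys \<alpha>")
  case True
  then show ?thesis
    unfolding pairing_def using assms
    by (intro member_le_sum[of i _ "\<lambda>i. real (Poly_Mapping.lookup \<alpha> i) * rho \<tau> i"]) (auto simp: rho_def)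
next
  case False
  then show ?thesis using pairing_nonneg[OF assms] by (simp add: in_keys_iff)
qed

lemma rho_pos: "\<tau> > 0 \<Longrightarrow> rho \<tau> i > 0"
  by (simp add: rho_def)

lemma lookup_nonzero_of_multi_index: "\<alpha> \<in> multi_indices \<Longrightarrow> \<exists>i. Poly_Mapping.lookup \<alpha> i \<noteq> 0"
  by (metis DiffE insertI1 lookup_zero multi_indices_def poly_mapping_eqI)

lemma pairing_pos:
  assumes "\<tau> > 0" "\<alpha> \<in> multi_indices"
  shows "pairing \<tau> \<alpha> > 0"
proof -
  obtain i where "Poly_Mapping.lookup \<alpha> i \<noteq> 0"
    using lookup_nonzero_of_multi_index[OF assms(2)] by blast
  then have "0 < real (Poly_Mapping.lookup \<alpha> i) * rho \<tau> i"
    using rho_pos[OF assms(1)] by simp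
  then show ?thesis using lookup_le_pairing[OF assms(1), of \<alpha> i] by linarith
qed

lemma size_index_pos:
  assumes "\<alpha> \<in> multi_indices"
  shows "size_index \<alpha> \<ge> 1"
proof -
  obtain i where i: "Poly_Mapping.lookup \<alpha> i \<noteq> 0"
    using lookup_nonzero_of_multi_index[OF assms] by blast
  then have "Poly_Mapping.lookup \<alpha> i \<le> size_index \<alpha>"
    unfolding size_index_def by (intro member_le_sum) (auto simp: in_keys_iff)
  with i show ?thesis by linarith
qed

lemma finite_pairing_le:
  assumes "\<tau> > 0"
  shows "finite {\<alpha>. pairing \<tau> \<alpha> \<le> c}"
proof -
  let ?A = "{..nat \<lceil>c\<rceil>}" and ?B = "{..nat \<lceil>c / min \<tau> 1\<rceil>}"
  let ?F = "{f. \<forall>x. (x \<in> ?A \<longrightarrow> f x \<in> ?B) \<and> (x \<notin> ?A \<longrightarrow> f x = (0::nat))}"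
  have "Poly_Mapping.lookup \<alpha> \<in> ?F" if "pairing \<tau> \<alpha> \<le> c" for \<alpha>
  proof -
    have le: "real (Poly_Mapping.lookup \<alpha> i) * rho \<tau> i \<le> c" for i
      using lookup_le_pairing[OF assms, of \<alpha> i] that by linarith
    have "Poly_Mapping.lookup \<alpha> i \<in> ?B" for i
    proof -
      have "min \<tau> 1 \<le> rho \<tau> i" by (auto simp: rho_def)
      then have "real (Poly_Mapping.lookup \<alpha> i) * min \<tau> 1 \<le> c"
        by (intro order_trans[OF mult_left_mono le]) auto
      then have "real (Poly_Mapping.lookup \<alpha> i) \<le> c / min \<tau> 1"
        using assms by (subst pos_le_divide_eq) auto
      then show ?thesis by simp linarith
    qed
    moreover have "Poly_Mapping.lookup \<alpha> i = 0" if "i \<notin> ?A" for i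
    proof (rule ccontr)
      assume "Poly_Mapping.lookup \<alpha> i \<noteq> 0"
      then have "1 * real i \<le> real (Poly_Mapping.lookup \<alpha> i) * real i"
        by (intro mult_right_mono) auto
      also have "\<dots> \<le> c" using le[of i] that by (auto simp: rho_def split: if_splits)
      finally show False using that by simp linarith
    qed
    ultimately show ?thesis by blast
  qed
  then have "Poly_Mapping.lookup ` {\<alpha>. pairing \<tau> \<alpha> \<le> c} \<subseteq> ?F"
    by (intro image_subsetI) (simp only: mem_Collect_eq)
  moreover have "finite ?F" by (rule finite_set_of_finite_funs) simp_all
  ultimately have "finite (Poly_Mapping.lookup ` {\<alpha>. pairing \<tau> \<alpha> \<le> c})"
    by (rule finite_subset)
  moreover have "inj_on Poly_Mapping.lookup {\<alpha>. pairing \<tau> \<alpha> \<le> c}"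
    by (rule inj_onI, rule poly_mapping_eqI) simp
  ultimately show ?thesis by (rule finite_imageD)
qed

lemma lookup_zero_ge:
  assumes "\<tau> > 0" "Poly_Mapping.lookup \<alpha> 0 \<noteq> 0"
  shows "pairing \<tau> \<alpha> \<ge> real (deg_index \<alpha>) + \<tau>"
proof -
  have "1 * \<tau> \<le> real (Poly_Mapping.lookup \<alpha> 0) * \<tau>"
    using assms by (intro mult_right_mono) auto
  then show ?thesis by (simp add: pairing_eq)
qed

lemma minus_unit_add:
  assumes "Poly_Mapping.lookup \<alpha> 0 \<noteq> 0"
  shows "(\<alpha> - unit_index 0) + unit_index 0 = \<alpha>"
  using assms
  by (intro poly_mapping_eqI) (auto simp: unit_index_def lookup_add lookup_minus lookup_single when_def)

lemma add_unit_minus: "(\<gamma> + unit_index 0) - unit_index 0 = \<gamma>"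
  by (intro poly_mapping_eqI) (auto simp: unit_index_def lookup_add lookup_minus lookup_single when_def)

lemma unit_index_inject [simp]: "unit_index i = unit_index j \<longleftrightarrow> i = j"
  by (metis deg_index_unit)

lemma lookup_unit_zero: "i \<ge> 1 \<Longrightarrow> Poly_Mapping.lookup (unit_index i) 0 = 0"
  by (simp add: unit_index_def lookup_single)

lemma unit_index_multi [simp]: "unit_index i \<in> multi_indices"
  by (simp add: multi_indices_def unit_index_def poly_mapping_eq_iff fun_eq_iff lookup_single when_def)

text \<open>The decompositions of \<open>\<gamma>\<close> into tuples of nonzero multi-indices; the empty tuple decomposes \<open>0\<close>,
  so that the constant term of the nonlinearity is treated like all others.\<close>

definition decomps :: "(nat \<Rightarrow>\<^sub>0 nat) \<Rightarrow> (nat \<Rightarrow>\<^sub>0 nat) list set" where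
  "decomps \<gamma> = {\<beta>s. set \<beta>s \<subseteq> multi_indices \<and> sum_list \<beta>s = \<gamma>}"

lemma length_le_size_index:
  "set \<beta>s \<subseteq> multi_indices \<Longrightarrow> length \<beta>s \<le> size_index (sum_list \<beta>s)"
proof (induction \<beta>s)
  case (Cons \<beta> \<beta>s)
  then show ?case using size_index_pos[of \<beta>] by (simp add: size_index_add)
qed simp

lemma pairing_le_sum_list:
  assumes "\<tau> > 0" "\<beta> \<in> set \<beta>s"
  shows "pairing \<tau> \<beta> \<le> pairing \<tau> (sum_list \<beta>s)"
  unfolding pairing_sum_list using assms pairing_nonneg[OF assms(1)]
  by (intro member_le_sum_list) auto

lemma finite_decomps: "finite (decomps \<gamma>)"
proof (rule finite_subset)
  show "decomps \<gamma> \<subseteq> {\<beta>s. set \<beta>s \<subseteq> {\<beta>. pairing 1 \<beta> \<le> pairing 1 \<gamma>} \<and> length \<beta>s \<le> size_index \<gamma>}"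
    using length_le_size_index pairing_le_sum_list[of 1] by (fastforce simp: decomps_def)
  show "finite {\<beta>s. set \<beta>s \<subseteq> {\<beta>. pairing 1 \<beta> \<le> pairing 1 \<gamma>} \<and> length \<beta>s \<le> size_index \<gamma>}"
    by (intro finite_lists_length_le finite_pairing_le) simp
qed

lemma decomps_zero: "decomps 0 = {[]}"
proof -
  have "\<beta>s = []" if "\<beta>s \<in> decomps 0" for \<beta>s
    using that length_le_size_index[of \<beta>s] by (simp add: decomps_def size_index_def)
  then show ?thesis by (auto simp: decomps_def)
qed

lemma sum_index_tuples:
  assumes "\<gamma> \<noteq> 0"
  shows "(\<Sum>j = 1..size_index \<gamma>. \<Sum>\<beta>s\<in>index_tuples \<gamma> j. F \<beta>s) = (\<Sum>\<beta>s\<in>decomps \<gamma>. F \<beta>s)"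
proof -
  have "decomps \<gamma> = (\<Union>j\<in>{1..size_index \<gamma>}. index_tuples \<gamma> j)"
  proof (intro equalityI subsetI)
    fix \<beta>s assume *: "\<beta>s \<in> decomps \<gamma>"
    then have "length \<beta>s \<le> size_index \<gamma>" using length_le_size_index by (auto simp: decomps_def)
    moreover have "\<beta>s \<noteq> []" using * assms by (auto simp: decomps_def)
    then have "1 \<le> length \<beta>s" by (cases \<beta>s) auto
    ultimately show "\<beta>s \<in> (\<Union>j\<in>{1..size_index \<gamma>}. index_tuples \<gamma> j)"
      using * by (auto simp: decomps_def index_tuples_def)
  qed (auto simp: decomps_def index_tuples_def)
  moreover have "finite (index_tuples \<gamma> j)" for j
    by (rule finite_subset[OF _ finite_decomps[of \<gamma>]]) (auto simp: decomps_def index_tuples_def)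
  ultimately show ?thesis
    by (simp only:, subst sum.UNION_disjoint) (auto simp: index_tuples_def)
qed

subsection \<open>A majorant for the family\<close>

text \<open>The weight of \<open>\<alpha>\<close> will bound the Wiener norm of the function with index \<open>\<alpha>\<close>, multiplied by
  the value of \<open>exp (- pairing \<tau> \<alpha> * t)\<close> at a fixed time.\<close>

function weight :: "real \<Rightarrow> (nat \<Rightarrow> real) \<Rightarrow> (nat \<Rightarrow> real) \<Rightarrow> (nat \<Rightarrow>\<^sub>0 nat) \<Rightarrow> real" where
  "weight \<epsilon> c b \<alpha> =
    (if \<exists>i\<ge>1. \<alpha> = unit_index i then b (THE i. \<alpha> = unit_index i)
     else if Poly_Mapping.lookup \<alpha> 0 = 0 then 0
     else \<epsilon> * (\<Sum>\<beta>s\<in>decomps (\<alpha> - unit_index 0). c (length \<beta>s) * (\<Prod>\<beta>\<leftarrow>\<beta>s. weight \<epsilon> c b \<beta>)))"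
  by auto
termination
proof (relation "Wellfounded.measure (\<lambda>(\<epsilon>, c, b, \<alpha>). size_index \<alpha>)")
  fix \<epsilon> :: real and c b :: "nat \<Rightarrow> real" and \<alpha> :: "nat \<Rightarrow>\<^sub>0 nat" and \<beta>s \<beta>
  assume "Poly_Mapping.lookup \<alpha> 0 \<noteq> 0" "\<beta>s \<in> decomps (\<alpha> - unit_index 0)" "\<beta> \<in> set \<beta>s"
  then show "((\<epsilon>, c, b, \<beta>), (\<epsilon>, c, b, \<alpha>)) \<in> Wellfounded.measure (\<lambda>(\<epsilon>, c, b, \<alpha>). size_index \<alpha>)"
    using size_index_sum_list[of \<beta> \<beta>s] size_index_minus_unit[of \<alpha>]
    by (auto simp: decomps_def)
qed auto

declare weight.simps [simp del]

lemma weight_unit: "i \<ge> 1 \<Longrightarrow> weight \<epsilon> c b (unit_index i) = b i"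
  by (subst weight.simps) auto

lemma weight_zero:
  assumes "Poly_Mapping.lookup \<alpha> 0 = 0" "\<And>i. i \<ge> 1 \<Longrightarrow> \<alpha> \<noteq> unit_index i"
  shows "weight \<epsilon> c b \<alpha> = 0"
proof -
  have "\<not> (\<exists>i\<ge>1. \<alpha> = unit_index i)" using assms by blast
  then show ?thesis using assms(1) by (subst weight.simps) (simp only: if_False if_True simp_thms)
qed

lemma weight_rec:
  assumes "Poly_Mapping.lookup \<alpha> 0 \<noteq> 0"
  shows "weight \<epsilon> c b \<alpha> =
    \<epsilon> * (\<Sum>\<beta>s\<in>decomps (\<alpha> - unit_index 0). c (length \<beta>s) * (\<Prod>\<beta>\<leftarrow>\<beta>s. weight \<epsilon> c b \<beta>))"
proof -
  have "\<not> (\<exists>i\<ge>1. \<alpha> = unit_index i)" using assms by (auto simp: lookup_unit_zero)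
  then show ?thesis using assms by (subst weight.simps) (simp only: if_False simp_thms)
qed

lemma decomps_size_less:
  assumes "Poly_Mapping.lookup \<alpha> 0 \<noteq> 0" "\<beta>s \<in> decomps (\<alpha> - unit_index 0)" "\<beta> \<in> set \<beta>s"
  shows "size_index \<beta> < size_index \<alpha>" "\<beta> \<in> multi_indices"
  using size_index_sum_list[of \<beta> \<beta>s] size_index_minus_unit[of \<alpha>] assms
  by (auto simp: decomps_def)

lemma weight_nonneg:
  assumes "\<epsilon> \<ge> 0" "\<And>j. c j \<ge> 0" "\<And>i. b i \<ge> 0"
  shows "weight \<epsilon> c b \<alpha> \<ge> 0"
proof (induction "size_index \<alpha>" arbitrary: \<alpha> rule: less_induct)
  case less
  consider i where "i \<ge> 1" "\<alpha> = unit_index i" | "Poly_Mapping.lookup \<alpha> 0 = 0" "\<And>i. i \<ge> 1 \<Longrightarrow> \<alpha> \<noteq> unit_index i"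
    | "Poly_Mapping.lookup \<alpha> 0 \<noteq> 0" by blast
  then show ?case
  proof cases
    case 3
    have "(\<Prod>\<beta>\<leftarrow>\<beta>s. weight \<epsilon> c b \<beta>) \<ge> 0" if "\<beta>s \<in> decomps (\<alpha> - unit_index 0)" for \<beta>s
      using less decomps_size_less[OF 3 that] by (intro prod_list_nonneg) auto
    then show ?thesis unfolding weight_rec[OF 3] using assms
      by (intro mult_nonneg_nonneg sum_nonneg) auto
  qed (auto simp: weight_unit weight_zero assms)
qed

lemma sum_weight_decomps_le:
  assumes nonneg: "\<epsilon> \<ge> 0" "\<And>j. c j \<ge> 0" "\<And>i. b i \<ge> 0" and "finite G" "finite H"
    and H: "\<And>\<gamma> \<beta>s. \<gamma> \<in> H \<Longrightarrow> \<beta>s \<in> decomps \<gamma> \<Longrightarrow> set \<beta>s \<subseteq> G \<and> length \<beta>s \<le> k"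
  shows "(\<Sum>\<gamma>\<in>H. \<Sum>\<beta>s\<in>decomps \<gamma>. c (length \<beta>s) * (\<Prod>\<beta>\<leftarrow>\<beta>s. weight \<epsilon> c b \<beta>))
    \<le> (\<Sum>j\<le>k. c j * (\<Sum>\<beta>\<in>G. weight \<epsilon> c b \<beta>) ^ j)"
proof -
  let ?g = "\<lambda>\<beta>s. c (length \<beta>s) * (\<Prod>\<beta>\<leftarrow>\<beta>s. weight \<epsilon> c b \<beta>)"
  let ?L = "\<lambda>j. {\<beta>s. set \<beta>s \<subseteq> G \<and> length \<beta>s = j}"
  have finL: "finite (?L j)" for j using finite_lists_length_eq[OF \<open>finite G\<close>] .
  have "(\<Sum>\<gamma>\<in>H. \<Sum>\<beta>s\<in>decomps \<gamma>. ?g \<beta>s) = (\<Sum>\<beta>s\<in>(\<Union>\<gamma>\<in>H. decomps \<gamma>). ?g \<beta>s)"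
    using \<open>finite H\<close> by (subst sum.UNION_disjoint) (auto simp: finite_decomps, auto simp: decomps_def)
  also have "\<dots> \<le> (\<Sum>\<beta>s\<in>(\<Union>j\<in>{..k}. ?L j). ?g \<beta>s)"
  proof (rule sum_mono2)
    show "(\<Union>\<gamma>\<in>H. decomps \<gamma>) \<subseteq> (\<Union>j\<in>{..k}. ?L j)" using H by auto
    show "0 \<le> ?g \<beta>s" for \<beta>s
      by (intro mult_nonneg_nonneg prod_list_nonneg nonneg) (auto simp: weight_nonneg[OF nonneg])
  qed (use finL in auto)
  also have "\<dots> = (\<Sum>j\<le>k. \<Sum>\<beta>s\<in>?L j. ?g \<beta>s)"
    using finL by (subst sum.UNION_disjoint) auto
  also have "\<dots> = (\<Sum>j\<le>k. c j * (\<Sum>\<beta>s\<in>?L j. \<Prod>\<beta>\<leftarrow>\<beta>s. weight \<epsilon> c b \<beta>))"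
    by (auto simp: sum_distrib_left intro!: sum.cong)
  finally show ?thesis by (simp add: sum_prod_lists[OF \<open>finite G\<close>])
qed

text \<open>Truncating by the size \<open>k\<close> turns the functional inequality for the sum of the weights
  into an induction, with \<open>[0, R]\<close> as invariant interval.\<close>

lemma sum_weight_truncated:
  assumes nonneg: "\<epsilon> \<ge> 0" "\<And>j. c j \<ge> 0" "\<And>i. b i \<ge> 0" "R \<ge> 0"
    and b: "\<And>N. (\<Sum>i=1..N. b i) \<le> S" and c: "\<And>k. (\<Sum>j\<le>k. c j * R ^ j) \<le> Y"
    and R: "S + \<epsilon> * Y \<le> R"
  shows "(\<Sum>\<alpha> | \<alpha> \<in> multi_indices \<and> size_index \<alpha> \<le> k \<and> pairing 1 \<alpha> \<le> K. weight \<epsilon> c b \<alpha>) \<le> R"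
proof (induction k)
  case 0
  have "{\<alpha>. \<alpha> \<in> multi_indices \<and> size_index \<alpha> \<le> 0 \<and> pairing 1 \<alpha> \<le> K} = {}"
    using size_index_pos by fastforce
  then show ?case using nonneg by (simp only: sum.empty)
next
  case (Suc k)
  define G where "G = (\<lambda>k. {\<alpha>. \<alpha> \<in> multi_indices \<and> size_index \<alpha> \<le> k \<and> pairing 1 \<alpha> \<le> K})"
  have finG: "finite (G k)" for k
    by (rule finite_subset[OF _ finite_pairing_le[of 1 K]]) (auto simp: G_def)
  define w where "w = weight \<epsilon> c b"
  have w: "w \<alpha> \<ge> 0" for \<alpha> using weight_nonneg[OF nonneg(1-3)] by (simp add: w_def)
  define E where "E = {\<alpha>\<in>G (Suc k). \<exists>i\<ge>1. \<alpha> = unit_index i}"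
  define Z where "Z = {\<alpha>\<in>G (Suc k). Poly_Mapping.lookup \<alpha> 0 \<noteq> 0}"
  have "(\<Sum>\<alpha>\<in>G (Suc k). w \<alpha>) = (\<Sum>\<alpha>\<in>E \<union> Z. w \<alpha>)"
    by (rule sum.mono_neutral_right) (auto simp: finG E_def Z_def w_def intro!: weight_zero)
  also have "\<dots> = (\<Sum>\<alpha>\<in>E. w \<alpha>) + (\<Sum>\<alpha>\<in>Z. w \<alpha>)"
    by (rule sum.union_disjoint) (auto simp: E_def Z_def finG lookup_unit_zero)
  also have "(\<Sum>\<alpha>\<in>E. w \<alpha>) \<le> S"
  proof -
    have "E \<subseteq> unit_index ` {1..nat \<lceil>K\<rceil>}"
    proof
      fix \<alpha> assume "\<alpha> \<in> E"
      then obtain i where i: "i \<ge> 1" "\<alpha> = unit_index i" "real i \<le> K"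
        by (auto simp: E_def G_def rho_def)
      then have "i \<le> nat \<lceil>K\<rceil>" by linarith
      with i show "\<alpha> \<in> unit_index ` {1..nat \<lceil>K\<rceil>}" by simp
    qed
    then have "(\<Sum>\<alpha>\<in>E. w \<alpha>) \<le> (\<Sum>\<alpha>\<in>unit_index ` {1..nat \<lceil>K\<rceil>}. w \<alpha>)"
      by (intro sum_mono2) (auto simp: w)
    also have "\<dots> = (\<Sum>i=1..nat \<lceil>K\<rceil>. b i)"
      by (subst sum.reindex) (auto simp: inj_on_def w_def weight_unit)
    finally show ?thesis using b[of "nat \<lceil>K\<rceil>"] by linarith
  qed
  also have "(\<Sum>\<alpha>\<in>Z. w \<alpha>) \<le> \<epsilon> * Y"
  proof -
    define H where "H = (\<lambda>\<alpha>. \<alpha> - unit_index 0) ` Z"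
    have inj: "inj_on (\<lambda>\<alpha>. \<alpha> - unit_index 0) Z"
      by (rule inj_on_inverseI[where g = "\<lambda>\<gamma>. \<gamma> + unit_index 0"]) (auto simp: Z_def minus_unit_add)
    have "(\<Sum>\<alpha>\<in>Z. w \<alpha>) = (\<Sum>\<alpha>\<in>Z. \<epsilon> * (\<Sum>\<beta>s\<in>decomps (\<alpha> - unit_index 0). c (length \<beta>s) * (\<Prod>\<beta>\<leftarrow>\<beta>s. w \<beta>)))"
      unfolding w_def by (intro sum.cong refl weight_rec) (simp add: Z_def)
    also have "\<dots> = \<epsilon> * (\<Sum>\<gamma>\<in>H. \<Sum>\<beta>s\<in>decomps \<gamma>. c (length \<beta>s) * (\<Prod>\<beta>\<leftarrow>\<beta>s. w \<beta>))"
      unfolding H_def by (simp add: sum.reindex[OF inj] sum_distrib_left)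
    also have "\<dots> \<le> \<epsilon> * (\<Sum>j\<le>k. c j * (\<Sum>\<beta>\<in>G k. w \<beta>) ^ j)"
    proof (rule mult_left_mono[OF _ nonneg(1)], unfold w_def, rule sum_weight_decomps_le[OF nonneg(1-3) finG])
      show "finite H" by (auto simp: H_def Z_def finG)
      fix \<gamma> \<beta>s assume "\<gamma> \<in> H" and bs: "\<beta>s \<in> decomps \<gamma>"
      then obtain \<alpha> where \<alpha>: "\<alpha> \<in> G (Suc k)" "Poly_Mapping.lookup \<alpha> 0 \<noteq> 0" "\<gamma> = \<alpha> - unit_index 0"
        by (auto simp: H_def Z_def)
      have \<gamma>: "pairing 1 \<gamma> \<le> pairing 1 \<alpha>" "size_index \<gamma> \<le> k"
        using minus_unit_add[OF \<alpha>(2)] pairing_add[of 1 \<gamma> "unit_index 0"] size_index_minus_unit[OF \<alpha>(2)] \<alpha>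
        by (auto simp: G_def rho_def)
      have "length \<beta>s \<le> k" using length_le_size_index[of \<beta>s] bs \<gamma> by (auto simp: decomps_def)
      moreover have "\<beta> \<in> G k" if "\<beta> \<in> set \<beta>s" for \<beta>
        using decomps_size_less[OF \<alpha>(2) bs[unfolded \<alpha>(3)] that] pairing_le_sum_list[of 1 \<beta> \<beta>s] that bs \<gamma> \<alpha>(1)
        by (auto simp: G_def decomps_def)
      ultimately show "set \<beta>s \<subseteq> G k \<and> length \<beta>s \<le> k" by blast
    qed
    also have "\<dots> \<le> \<epsilon> * (\<Sum>j\<le>k. c j * R ^ j)"
      using Suc by (intro mult_left_mono sum_mono power_mono nonneg sum_nonneg w) (simp add: G_def w_def)
    also have "\<dots> \<le> \<epsilon> * Y" by (intro mult_left_mono c nonneg)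
    finally show ?thesis .
  qed
  finally show ?case using R by (simp add: G_def w_def)
qed

lemma has_sum_weight:
  assumes nonneg: "\<epsilon> \<ge> 0" "\<And>j. c j \<ge> 0" "\<And>i. b i \<ge> 0" "R \<ge> 0"
    and b: "\<And>N. (\<Sum>i=1..N. b i) \<le> S" and c: "\<And>k. (\<Sum>j\<le>k. c j * R ^ j) \<le> Y"
    and R: "S + \<epsilon> * Y \<le> R"
  shows "weight \<epsilon> c b summable_on multi_indices" "infsum (weight \<epsilon> c b) multi_indices \<le> R"
proof -
  have w: "weight \<epsilon> c b \<alpha> \<ge> 0" for \<alpha> by (rule weight_nonneg[OF nonneg(1-3)])
  have le: "sum (weight \<epsilon> c b) F \<le> R" if F: "finite F" "F \<subseteq> multi_indices" for F
  proof -
    define k where "k = (\<Sum>\<alpha>\<in>F. size_index \<alpha>)"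
    define K where "K = (\<Sum>\<alpha>\<in>F. pairing 1 \<alpha>)"
    have "size_index \<alpha> \<le> k" "pairing 1 \<alpha> \<le> K" if "\<alpha> \<in> F" for \<alpha>
      unfolding k_def K_def using F that pairing_nonneg[of 1]
      by (auto intro: member_le_sum)
    then have "F \<subseteq> {\<alpha>. \<alpha> \<in> multi_indices \<and> size_index \<alpha> \<le> k \<and> pairing 1 \<alpha> \<le> K}"
      using F by blast
    moreover have "finite {\<alpha>. \<alpha> \<in> multi_indices \<and> size_index \<alpha> \<le> k \<and> pairing 1 \<alpha> \<le> K}"
      by (rule finite_subset[OF _ finite_pairing_le[of 1 K]]) auto
    ultimately have "sum (weight \<epsilon> c b) F \<le>
       sum (weight \<epsilon> c b) {\<alpha>. \<alpha> \<in> multi_indices \<and> size_index \<alpha> \<le> k \<and> pairing 1 \<alpha> \<le> K}"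
      by (intro sum_mono2) (auto simp: w)
    also have "\<dots> \<le> R" by (rule sum_weight_truncated[OF assms])
    finally show ?thesis .
  qed
  show s: "weight \<epsilon> c b summable_on multi_indices"
    by (rule nonneg_bdd_above_summable_on) (auto simp: w intro!: bdd_aboveI2[of _ _ R] le)
  show "infsum (weight \<epsilon> c b) multi_indices \<le> R"
    by (rule infsum_le_finite_sums[OF s le])
qed

subsection \<open>The family indexed by multi-indices\<close>

context harmonic_data
begin

declare P_multi.simps [simp del] P_seq.simps [simp del]

lemma P_multi_unit_zero: "P_multi (unit_index 0) = (\<lambda>\<theta>. a 0 / \<tau>\<^sup>2)"
  by (subst P_multi.simps) (simp add: rho_def)

lemma P_multi_unit: "i \<ge> 1 \<Longrightarrow> P_multi (unit_index i) = X i"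
  by (subst P_multi.simps) auto

lemma P_multi_zero:
  assumes "Poly_Mapping.lookup \<alpha> 0 = 0" "\<And>i. i \<ge> 1 \<Longrightarrow> \<alpha> \<noteq> unit_index i"
  shows "P_multi \<alpha> = (\<lambda>_. 0)"
proof -
  have "\<alpha> \<noteq> unit_index 0" using assms by (auto simp: unit_index_def)
  moreover have "\<not> (\<exists>i\<ge>1. \<alpha> = unit_index i)" using assms by blast
  ultimately show ?thesis using assms(1) by (subst P_multi.simps) (simp only: if_False if_True simp_thms)
qed

definition forcing :: "(nat \<Rightarrow>\<^sub>0 nat) \<Rightarrow> real \<Rightarrow> real" where
  "forcing \<gamma> \<theta> = (\<Sum>\<beta>s\<in>decomps \<gamma>. a (length \<beta>s) * (\<Prod>\<beta>\<leftarrow>\<beta>s. P_multi \<beta> \<theta>))"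

lemma P_multi_THE:
  assumes "Poly_Mapping.lookup \<alpha> 0 \<noteq> 0" "\<alpha> \<noteq> unit_index 0"
  shows "P_multi \<alpha> = (THE p. solves (pairing \<tau> \<alpha>) (forcing (\<alpha> - unit_index 0)) p
       \<and> orthogonal_to p (kernel (pairing \<tau> \<alpha>)))"
proof -
  have ne: "\<not> (\<exists>i\<ge>1. \<alpha> = unit_index i)" using assms by (auto simp: lookup_unit_zero)
  have nz: "\<alpha> - unit_index 0 \<noteq> 0" using minus_unit_add[OF assms(1)] assms(2) by auto
  moreover have "size_index \<alpha> - 1 = size_index (\<alpha> - unit_index 0)"
  proof -
    have "size_index (unit_index 0) = 1" by (simp add: size_index_def unit_index_def)
    then show ?thesis
      using size_index_add[of "\<alpha> - unit_index 0" "unit_index 0"] by (simp add: minus_unit_add[OF assms(1)])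
  qed
  moreover have "(\<Sum>\<beta>s\<in>index_tuples \<gamma> j. a j * (\<Prod>\<beta>\<leftarrow>\<beta>s. P_multi \<beta> \<theta>)) =
     (\<Sum>\<beta>s\<in>index_tuples \<gamma> j. a (length \<beta>s) * (\<Prod>\<beta>\<leftarrow>\<beta>s. P_multi \<beta> \<theta>))" for \<gamma> j \<theta>
    by (intro sum.cong) (auto simp: index_tuples_def)
  ultimately have "(\<lambda>\<theta>. \<Sum>j = 1..size_index \<alpha> - 1. \<Sum>\<beta>s\<in>index_tuples (\<alpha> - unit_index 0) j.
            a j * (\<Prod>\<beta>\<leftarrow>\<beta>s. P_multi \<beta> \<theta>)) = forcing (\<alpha> - unit_index 0)"
    unfolding forcing_def[abs_def] by (intro ext) (simp only: sum_index_tuples[OF nz])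
  then show ?thesis using assms ne by (subst P_multi.simps) (simp only: if_False simp_thms)
qed

lemma P_multi_equation:
  assumes z: "Poly_Mapping.lookup \<alpha> 0 \<noteq> 0" and g: "trig (deg_index \<alpha>) B (forcing (\<alpha> - unit_index 0))"
  shows "trig (deg_index \<alpha>) (B / \<tau>\<^sup>2) (P_multi \<alpha>)"
    "deriv (deriv (P_multi \<alpha>)) \<theta> + (pairing \<tau> \<alpha>)\<^sup>2 * P_multi \<alpha> \<theta> = forcing (\<alpha> - unit_index 0) \<theta>"
proof -
  let ?\<kappa> = "pairing \<tau> \<alpha>"
  have \<kappa>: "?\<kappa> \<ge> real (deg_index \<alpha>) + \<tau>" by (rule lookup_zero_ge[OF tau_pos z])
  from trig_solve[OF g tau_pos this] obtain p where p: "trig (deg_index \<alpha>) (B / \<tau>\<^sup>2) p"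
    "\<And>\<theta>. deriv (deriv p) \<theta> + ?\<kappa>\<^sup>2 * p \<theta> = forcing (\<alpha> - unit_index 0) \<theta>" by blast
  have sp: "solves ?\<kappa> (forcing (\<alpha> - unit_index 0)) p"
    using p trig_smooth by (auto simp: solves_def)
  have op: "orthogonal_to p (kernel ?\<kappa>)"
    using trig_orthogonal_kernel[OF p(1)] \<kappa> tau_pos by simp
  have \<kappa>pos: "?\<kappa> > 0" using \<kappa> tau_pos by linarith
  have "P_multi \<alpha> = p"
  proof (cases "\<alpha> = unit_index 0")
    case True
    have t: "trig 0 \<bar>a 0 / \<tau>\<^sup>2\<bar> (P_multi \<alpha>)" unfolding True P_multi_unit_zero by (rule trig_const)
    have "solves ?\<kappa> (forcing (\<alpha> - unit_index 0)) (P_multi \<alpha>)"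
      unfolding solves_def using trig_smooth[OF t] tau_pos
      by (simp add: True P_multi_unit_zero forcing_def decomps_zero rho_def)
    moreover have "orthogonal_to (P_multi \<alpha>) (kernel ?\<kappa>)"
      using trig_orthogonal_kernel[OF t] \<kappa>pos by simp
    ultimately show ?thesis using orthogonal_solution_unique[OF _ _ sp op \<kappa>pos] by blast
  next
    case False
    show ?thesis unfolding P_multi_THE[OF z False]
    proof (rule the_equality)
      show "q = p" if "solves ?\<kappa> (forcing (\<alpha> - unit_index 0)) q \<and> orthogonal_to q (kernel ?\<kappa>)" for q
        using orthogonal_solution_unique[OF _ _ sp op \<kappa>pos] that by blast
    qed (use sp op in blast)
  qed
  with p show "trig (deg_index \<alpha>) (B / \<tau>\<^sup>2) (P_multi \<alpha>)"
    "deriv (deriv (P_multi \<alpha>)) \<theta> + (pairing \<tau> \<alpha>)\<^sup>2 * P_multi \<alpha> \<theta> = forcing (\<alpha> - unit_index 0) \<theta>"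
    by auto
qed

lemma deg_index_minus_unit:
  assumes "Poly_Mapping.lookup \<alpha> 0 \<noteq> 0"
  shows "deg_index (\<alpha> - unit_index 0) = deg_index \<alpha>"
  using deg_index_add[of "\<alpha> - unit_index 0" "unit_index 0"] by (simp add: minus_unit_add[OF assms])

lemma pairing_minus_unit:
  assumes "Poly_Mapping.lookup \<alpha> 0 \<noteq> 0"
  shows "pairing \<tau> (\<alpha> - unit_index 0) = pairing \<tau> \<alpha> - \<tau>"
  using pairing_add[of \<tau> "\<alpha> - unit_index 0" "unit_index 0"] by (simp add: minus_unit_add[OF assms] rho_def)

lemma trig_forcing:
  assumes "\<And>\<beta>s \<beta>. \<beta>s \<in> decomps \<gamma> \<Longrightarrow> \<beta> \<in> set \<beta>s \<Longrightarrow>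
      trig (deg_index \<beta>) (w \<beta> * exp (pairing \<tau> \<beta> * t)) (P_multi \<beta>)"
    and c: "\<And>j. \<bar>a j\<bar> \<le> c j" 
  shows "trig (deg_index \<gamma>) ((\<Sum>\<beta>s\<in>decomps \<gamma>. c (length \<beta>s) * (\<Prod>\<beta>\<leftarrow>\<beta>s. w \<beta>)) * exp (pairing \<tau> \<gamma> * t))
     (forcing \<gamma>)"
proof -
  have "trig (deg_index \<gamma>) (c (length \<beta>s) * (\<Prod>\<beta>\<leftarrow>\<beta>s. w \<beta>) * exp (pairing \<tau> \<gamma> * t))
      (\<lambda>\<theta>. a (length \<beta>s) * (\<Prod>\<beta>\<leftarrow>\<beta>s. P_multi \<beta> \<theta>))" if bs: "\<beta>s \<in> decomps \<gamma>" for \<beta>s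
  proof -
    have "(\<Prod>\<beta>\<leftarrow>\<beta>s. w \<beta> * exp (pairing \<tau> \<beta> * t)) = (\<Prod>\<beta>\<leftarrow>\<beta>s. w \<beta>) * exp (pairing \<tau> (sum_list \<beta>s) * t)" for \<beta>s
      by (induction \<beta>s) (auto simp: pairing_add distrib_right exp_add)
    with bs have t: "trig (deg_index \<gamma>) ((\<Prod>\<beta>\<leftarrow>\<beta>s. w \<beta>) * exp (pairing \<tau> \<gamma> * t)) (\<lambda>\<theta>. \<Prod>\<beta>\<leftarrow>\<beta>s. P_multi \<beta> \<theta>)"
      using trig_prod_list[of \<beta>s deg_index "\<lambda>\<beta>. w \<beta> * exp (pairing \<tau> \<beta> * t)" P_multi, OF assms(1)[OF bs]]
      by (simp add: decomps_def flip: deg_index_sum_list)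
    show ?thesis
      using trig_mono[OF trig_scale[OF t, of "a (length \<beta>s)"] order_refl] 
        mult_right_mono[OF c[of "length \<beta>s"] trig_nonneg[OF t]] by (simp add: mult.assoc)
  qed
  from trig_sum[of "decomps \<gamma>", OF this] show ?thesis
    by (simp add: forcing_def[abs_def] sum_distrib_right)
qed

lemma trig_P_multi:
  assumes X: "\<And>i. i \<ge> 1 \<Longrightarrow> trig i (b i * exp (real i * t)) (X i)"
    and c: "\<And>j. \<bar>a j\<bar> \<le> c j" and \<epsilon>: "\<epsilon> = exp (- \<tau> * t) / \<tau>\<^sup>2" and "\<alpha> \<in> multi_indices"
  shows "trig (deg_index \<alpha>) (weight \<epsilon> c b \<alpha> * exp (pairing \<tau> \<alpha> * t)) (P_multi \<alpha>)"
  using assms(4)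
proof (induction "size_index \<alpha>" arbitrary: \<alpha> rule: less_induct)
  case less
  consider i where "i \<ge> 1" "\<alpha> = unit_index i" | "Poly_Mapping.lookup \<alpha> 0 = 0" "\<And>i. i \<ge> 1 \<Longrightarrow> \<alpha> \<noteq> unit_index i"
    | "Poly_Mapping.lookup \<alpha> 0 \<noteq> 0" by blast
  then show ?case
  proof cases
    case 1
    then show ?thesis using X[of i] by (simp add: weight_unit P_multi_unit rho_def)
  next
    case 2
    then show ?thesis by (simp add: weight_zero P_multi_zero trig_zero)
  next
    case 3
    have "trig (deg_index (\<alpha> - unit_index 0)) ((\<Sum>\<beta>s\<in>decomps (\<alpha> - unit_index 0). c (length \<beta>s) *
       (\<Prod>\<beta>\<leftarrow>\<beta>s. weight \<epsilon> c b \<beta>)) * exp (pairing \<tau> (\<alpha> - unit_index 0) * t)) (forcing (\<alpha> - unit_index 0))"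
      using less.hyps decomps_size_less[OF 3] c by (intro trig_forcing) auto
    note P_multi_equation(1)[OF 3 this[unfolded deg_index_minus_unit[OF 3]]]
    moreover have "exp (pairing \<tau> (\<alpha> - unit_index 0) * t) = exp (- \<tau> * t) * exp (pairing \<tau> \<alpha> * t)"
      by (simp add: pairing_minus_unit[OF 3] left_diff_distrib flip: exp_add)
    ultimately show ?thesis by (simp only: weight_rec[OF 3] \<epsilon>) (simp add: mult_ac)
  qed
qed

end

subsection \<open>The index set\<close>

lemma mu_surj:
  assumes "\<tau> > 0" "x \<in> range (pairing \<tau>)"
  shows "\<exists>m. x = mu \<tau> m"
proof (cases "x = 0")
  case True
  then show ?thesis by (intro exI[of _ 0]) simp
next
  case False
  with assms(2) have x: "x \<in> index_set \<tau>" by (simp add: index_set_def)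
  have "\<exists>l. x \<le> mu \<tau> l"
  proof (rule ccontr)
    assume "\<not> (\<exists>l. x \<le> mu \<tau> l)"
    then have "range (\<lambda>l. mu \<tau> (Suc l)) \<subseteq> {y \<in> index_set \<tau>. y \<le> x}"
      using mu_Suc(1)[OF assms(1)] by (auto simp: not_le less_imp_le simp del: mu.simps)
    then have "finite (range (\<lambda>l. mu \<tau> (Suc l)))"
      using finite_index_set_le[OF assms(1)] finite_subset by blast
    moreover have "inj (\<lambda>l. mu \<tau> (Suc l))"
      using strict_mono_eq[OF strict_mono_mu[OF assms(1)]] by (auto simp: inj_def simp del: mu.simps)
    ultimately show False using finite_imageD infinite_UNIV_nat by blast
  qed
  define l where "l = (LEAST l. x \<le> mu \<tau> l)"
  have l: "x \<le> mu \<tau> l" "\<And>k. k < l \<Longrightarrow> mu \<tau> k < x"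
    using LeastI_ex[OF \<open>\<exists>l. x \<le> mu \<tau> l\<close>] not_less_Least[of _ "\<lambda>l. x \<le> mu \<tau> l"]
    by (auto simp: l_def not_le)
  have "x > 0" using False assms(2) pairing_nonneg[OF assms(1)] by (auto simp: less_le)
  then obtain k where k: "l = Suc k" using l(1) by (cases l) auto
  have "mu \<tau> l \<le> x" unfolding k using mu_Suc(3)[OF assms(1) x l(2)] k by blast
  with l(1) show ?thesis by (intro exI[of _ l]) simp
qed

lemma mu_in_range: "\<tau> > 0 \<Longrightarrow> mu \<tau> m \<in> range (pairing \<tau>)"
proof (cases m)
  case 0
  then show ?thesis using pairing_zero[of \<tau>] by (metis mu.simps(1) rangeI)
qed (use mu_Suc(1) in \<open>auto simp: index_set_def simp del: mu.simps\<close>)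

lemma mu_pos: "\<tau> > 0 \<Longrightarrow> l \<ge> 1 \<Longrightarrow> mu \<tau> l > 0"
  using strict_mono_less[OF strict_mono_mu, of \<tau> 0 l] by simp

lemma mu_le_of_gt:
  assumes "\<tau> > 0" "x \<in> range (pairing \<tau>)" "mu \<tau> l < x"
  shows "mu \<tau> (Suc l) \<le> x"
proof (rule mu_Suc(3)[OF assms(1) _ assms(3)])
  show "x \<in> index_set \<tau>" using assms mu_nonneg[OF assms(1), of l] by (auto simp: index_set_def)
qed

lemma mu_tuples_length:
  assumes "\<tau> > 0" "(\<Sum>k\<leftarrow>ks. mu \<tau> k) = mu \<tau> m" "set ks \<subseteq> {1..}"
  shows "length ks \<le> m"
  using assms(2,3)
proof (induction ks arbitrary: m)
  case (Cons k ks)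
  have "(\<Sum>k\<leftarrow>ks. mu \<tau> k) \<in> range (pairing \<tau>)"
  proof (induction ks)
    case Nil
    then show ?case using pairing_zero[of \<tau>] by (metis list.simps(8) rangeI sum_list.Nil)
  next
    case (Cons k ks)
    then obtain \<alpha> \<beta> where "(\<Sum>k\<leftarrow>ks. mu \<tau> k) = pairing \<tau> \<alpha>" "mu \<tau> k = pairing \<tau> \<beta>"
      using mu_in_range[OF assms(1)] by blast
    then have "(\<Sum>k\<leftarrow>k # ks. mu \<tau> k) = pairing \<tau> (\<beta> + \<alpha>)" by (simp add: pairing_add)
    then show ?case by blast
  qed
  then obtain n where n: "(\<Sum>k\<leftarrow>ks. mu \<tau> k) = mu \<tau> n" using mu_surj[OF assms(1)] by blast
  have "mu \<tau> k > 0" using Cons.prems(2) mu_pos[OF assms(1)] by simp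
  then have "mu \<tau> n < mu \<tau> m" using Cons.prems n by simp
  then have "n < m" using strict_mono_less[OF strict_mono_mu[OF assms(1)]] by simp
  moreover have "length ks \<le> n" using Cons.IH[OF n] Cons.prems by simp
  ultimately show ?case by simp
qed simp

definition level :: "real \<Rightarrow> real \<Rightarrow> (nat \<Rightarrow>\<^sub>0 nat) set" where
  "level \<tau> x = {\<alpha>\<in>multi_indices. pairing \<tau> \<alpha> = x}"

lemma finite_level: "\<tau> > 0 \<Longrightarrow> finite (level \<tau> x)"
  by (rule finite_subset[OF _ finite_pairing_le[of \<tau> x]]) (auto simp: level_def)

lemma index_set_integer:
  assumes "x \<in> range (pairing \<tau>)" "x > 0" "\<And>\<alpha>. \<alpha> \<in> level \<tau> x \<Longrightarrow> Poly_Mapping.lookup \<alpha> 0 = 0"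
  shows "x \<in> \<int>"
proof -
  obtain \<alpha> where \<alpha>: "x = pairing \<tau> \<alpha>" using assms(1) by blast
  then have "\<alpha> \<noteq> 0" using assms(2) by auto
  then have "\<alpha> \<in> level \<tau> x" using \<alpha> by (simp add: level_def multi_indices_def)
  then show ?thesis using assms(3) \<alpha> by (simp add: pairing_eq)
qed

lemma mu_below:
  assumes "\<tau> > 0" "mu \<tau> l < \<tau>"
  shows "mu \<tau> l = real l"
  using assms(2)
proof (induction l)
  case (Suc l)
  let ?x = "mu \<tau> (Suc l)"
  have lt: "mu \<tau> l < ?x" by (rule mu_Suc(2)[OF assms(1)])
  with Suc have l: "mu \<tau> l = real l" by simp
  have r: "?x \<in> range (pairing \<tau>)" by (rule mu_in_range[OF assms(1)])
  have "?x \<in> \<int>"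
  proof (rule index_set_integer[OF r])
    show "?x > 0" using lt mu_nonneg[OF assms(1), of l] by linarith
    show "Poly_Mapping.lookup \<alpha> 0 = 0" if "\<alpha> \<in> level \<tau> ?x" for \<alpha>
      using that Suc.prems lookup_zero_ge[OF assms(1), of \<alpha>] by (force simp: level_def)
  qed
  then obtain n where "?x = of_int n" by (auto simp: Ints_def)
  moreover from this lt l have "int l < n" by linarith
  ultimately have "?x \<ge> real (Suc l)" by linarith
  moreover have "?x \<le> real (Suc l)"
  proof (rule mu_le_of_gt[OF assms(1)])
    have "real (Suc l) = pairing \<tau> (unit_index (Suc l))" by (simp add: rho_def)
    then show "real (Suc l) \<in> range (pairing \<tau>)" by blast
  qed (simp add: l)
  ultimately show ?case by linarith
qed simp

lemma in_listset: "xs \<in> listset As \<longleftrightarrow> list_all2 (\<in>) xs As"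
  by (induction As arbitrary: xs) (auto simp: set_Cons_def list_all2_Cons2)

lemma in_listset_level:
  "\<beta>s \<in> listset (map (\<lambda>k. level \<tau> (mu \<tau> k)) ks) \<longleftrightarrow>
     set \<beta>s \<subseteq> multi_indices \<and> map (pairing \<tau>) \<beta>s = map (mu \<tau>) ks"
  unfolding in_listset list_all2_map2
  by (induction ks arbitrary: \<beta>s) (auto simp: level_def list_all2_Cons2 map_eq_Cons_conv)

lemma decomps_level:
  assumes "\<tau> > 0" "m \<ge> 1"
  shows "(\<Union>\<gamma>\<in>level \<tau> (mu \<tau> m). decomps \<gamma>) =
    (\<Union>j\<in>{1..m}. \<Union>ks\<in>mu_tuples \<tau> m j. listset (map (\<lambda>k. level \<tau> (mu \<tau> k)) ks))"
    (is "?L = ?R")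
proof (intro equalityI subsetI)
  fix \<beta>s assume "\<beta>s \<in> ?L"
  then have b: "set \<beta>s \<subseteq> multi_indices" "pairing \<tau> (sum_list \<beta>s) = mu \<tau> m"
    by (auto simp: level_def decomps_def)
  define ks where "ks = map (\<lambda>\<beta>. SOME k. pairing \<tau> \<beta> = mu \<tau> k) \<beta>s"
  have k: "pairing \<tau> \<beta> = mu \<tau> (SOME k. pairing \<tau> \<beta> = mu \<tau> k)" for \<beta>
    using mu_surj[OF assms(1), of "pairing \<tau> \<beta>"] by (intro someI_ex[of "\<lambda>k. pairing \<tau> \<beta> = mu \<tau> k"]) auto
  then have ks: "map (pairing \<tau>) \<beta>s = map (mu \<tau>) ks" by (simp add: ks_def)
  then have s: "(\<Sum>k\<leftarrow>ks. mu \<tau> k) = mu \<tau> m" using b(2) by (simp add: pairing_sum_list)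
  have "k \<ge> 1" if k_in: "k \<in> set ks" for k
  proof -
    obtain \<beta> where "\<beta> \<in> set \<beta>s" "mu \<tau> k = pairing \<tau> \<beta>"
      using k_in k[symmetric] by (auto simp: ks_def)
    then have "mu \<tau> k > 0" using b pairing_pos[OF assms(1)] by auto
    then show ?thesis by (cases k) auto
  qed
  then have pos: "set ks \<subseteq> {1..}" by auto
  have "ks \<noteq> []" using s mu_pos[OF assms] by auto
  then have "length ks \<in> {1..m}" using mu_tuples_length[OF assms(1) s pos] by (cases ks) auto
  moreover have "ks \<in> mu_tuples \<tau> m (length ks)" using s pos by (simp add: mu_tuples_def)
  moreover have "\<beta>s \<in> listset (map (\<lambda>k. level \<tau> (mu \<tau> k)) ks)"
    unfolding in_listset_level using b ks by simp
  ultimately show "\<beta>s \<in> ?R" by blast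
next
  fix \<beta>s assume "\<beta>s \<in> ?R"
  then obtain j ks where *: "ks \<in> mu_tuples \<tau> m j" "\<beta>s \<in> listset (map (\<lambda>k. level \<tau> (mu \<tau> k)) ks)"
    by blast
  then have b: "set \<beta>s \<subseteq> multi_indices" "pairing \<tau> (sum_list \<beta>s) = mu \<tau> m"
    by (simp_all add: in_listset_level pairing_sum_list mu_tuples_def)
  moreover have "sum_list \<beta>s \<noteq> 0" using b mu_pos[OF assms] by auto
  ultimately show "\<beta>s \<in> ?L" by (auto simp: level_def decomps_def multi_indices_def)
qed

lemma finite_mu_tuples:
  assumes "\<tau> > 0"
  shows "finite (mu_tuples \<tau> m j)"
proof (rule finite_subset)
  interpret harmonic_data \<tau> "\<lambda>_. 0" "\<lambda>_ _. 0" by unfold_locales (rule assms)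
  show "mu_tuples \<tau> m j \<subseteq> {ks. set ks \<subseteq> {..m} \<and> length ks = j}"
    using mu_tuples_le by (fastforce simp: mu_tuples_def)
qed (intro finite_lists_length_eq finite_atMost)

context harmonic_data
begin

lemma sum_forcing_level:
  assumes "m \<ge> 1"
  shows "(\<Sum>\<gamma>\<in>level \<tau> (mu \<tau> m). forcing \<gamma> \<theta>) =
    (\<Sum>j=1..m. a j * (\<Sum>ks\<in>mu_tuples \<tau> m j. \<Prod>k\<leftarrow>ks. \<Sum>\<beta>\<in>level \<tau> (mu \<tau> k). P_multi \<beta> \<theta>))"
proof -
  let ?g = "\<lambda>\<beta>s. a (length \<beta>s) * (\<Prod>\<beta>\<leftarrow>\<beta>s. P_multi \<beta> \<theta>)"
  let ?B = "\<lambda>ks. listset (map (\<lambda>k. level \<tau> (mu \<tau> k)) ks)"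
  have fB: "finite (?B ks)" for ks
    by (intro finite_listset) (auto simp: finite_level[OF tau_pos])
  have len: "length \<beta>s = length ks" if "\<beta>s \<in> ?B ks" for \<beta>s ks
    using that by (simp add: in_listset_level) (metis length_map)
  have inj: "ks = ks'" if "\<beta>s \<in> ?B ks" "\<beta>s \<in> ?B ks'" for \<beta>s ks ks'
  proof -
    have "map (mu \<tau>) ks = map (mu \<tau>) ks'" using that by (simp add: in_listset_level)
    moreover have "inj (mu \<tau>)" using strict_mono_eq[OF strict_mono_mu[OF tau_pos]] by (auto simp: inj_def)
    ultimately show ?thesis by (simp add: inj_map_eq_map)
  qed
  have "(\<Sum>\<gamma>\<in>level \<tau> (mu \<tau> m). forcing \<gamma> \<theta>) = (\<Sum>\<beta>s\<in>(\<Union>\<gamma>\<in>level \<tau> (mu \<tau> m). decomps \<gamma>). ?g \<beta>s)"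
    unfolding forcing_def using finite_level[OF tau_pos] finite_decomps
    by (subst sum.UNION_disjoint) (auto simp: decomps_def)
  also have "\<dots> = (\<Sum>j=1..m. \<Sum>\<beta>s\<in>(\<Union>ks\<in>mu_tuples \<tau> m j. ?B ks). ?g \<beta>s)"
    unfolding decomps_level[OF tau_pos assms]
  proof (rule sum.UNION_disjoint)
    show "\<forall>j\<in>{1..m}. finite (\<Union>ks\<in>mu_tuples \<tau> m j. ?B ks)"
      using finite_mu_tuples[OF tau_pos] fB by blast
    show "\<forall>i\<in>{1..m}. \<forall>j\<in>{1..m}. i \<noteq> j \<longrightarrow>
       (\<Union>ks\<in>mu_tuples \<tau> m i. ?B ks) \<inter> (\<Union>ks\<in>mu_tuples \<tau> m j. ?B ks) = {}"
      by (auto simp: mu_tuples_def dest!: len)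
  qed simp
  also have "\<dots> = (\<Sum>j=1..m. \<Sum>ks\<in>mu_tuples \<tau> m j. \<Sum>\<beta>s\<in>?B ks. ?g \<beta>s)"
    using finite_mu_tuples[OF tau_pos] fB inj
    by (intro sum.cong refl sum.UNION_disjoint) blast+
  also have "\<dots> = (\<Sum>j=1..m. \<Sum>ks\<in>mu_tuples \<tau> m j. a j * (\<Prod>k\<leftarrow>ks. \<Sum>\<beta>\<in>level \<tau> (mu \<tau> k). P_multi \<beta> \<theta>))"
  proof (intro sum.cong refl)
    fix j ks assume "ks \<in> mu_tuples \<tau> m j"
    then have "(\<Sum>\<beta>s\<in>?B ks. ?g \<beta>s) = (\<Sum>\<beta>s\<in>?B ks. a j * (\<Prod>\<beta>\<leftarrow>\<beta>s. P_multi \<beta> \<theta>))"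
      using len by (intro sum.cong refl) (auto simp: mu_tuples_def)
    then show "(\<Sum>\<beta>s\<in>?B ks. ?g \<beta>s) = a j * (\<Prod>k\<leftarrow>ks. \<Sum>\<beta>\<in>level \<tau> (mu \<tau> k). P_multi \<beta> \<theta>)"
      by (simp add: prod_list_sum_eq_sum_listset sum_distrib_left)
  qed
  finally show ?thesis by (simp add: sum_distrib_left)
qed

end

locale harmonic_sequence = harmonic_data +
  assumes X_harmonic: "\<And>i. i \<ge> 1 \<Longrightarrow> X i \<in> harmonics i"
begin

lemma P_multi_trig:
  assumes "\<alpha> \<in> multi_indices"
  obtains B where "trig (deg_index \<alpha>) B (P_multi \<alpha>)"
proof -
  have "trig (deg_index \<alpha>) (weight (1 / \<tau>\<^sup>2) (\<lambda>j. \<bar>a j\<bar>) (\<lambda>i. L2_norm (X i)) \<alpha> * exp (pairing \<tau> \<alpha> * 0)) (P_multi \<alpha>)"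
    by (rule trig_P_multi) (use harmonics_trig[OF X_harmonic] assms in auto)
  with that show thesis .
qed

lemma P_multi_equation_forcing:
  assumes "Poly_Mapping.lookup \<alpha> 0 \<noteq> 0"
  shows "deriv (deriv (P_multi \<alpha>)) \<theta> + (pairing \<tau> \<alpha>)\<^sup>2 * P_multi \<alpha> \<theta> = forcing (\<alpha> - unit_index 0) \<theta>"
proof -
  let ?w = "\<lambda>\<beta>. SOME B. trig (deg_index \<beta>) B (P_multi \<beta>)"
  have "trig (deg_index \<beta>) (?w \<beta>) (P_multi \<beta>)" if "\<beta> \<in> multi_indices" for \<beta>
    using P_multi_trig[OF that] by (metis someI_ex)
  then have "trig (deg_index (\<alpha> - unit_index 0)) ((\<Sum>\<beta>s\<in>decomps (\<alpha> - unit_index 0). \<bar>a (length \<beta>s)\<bar> *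
       (\<Prod>\<beta>\<leftarrow>\<beta>s. ?w \<beta>)) * exp (pairing \<tau> (\<alpha> - unit_index 0) * 0)) (forcing (\<alpha> - unit_index 0))"
    by (intro trig_forcing) (auto simp: decomps_def)
  from P_multi_equation(2)[OF assms this[unfolded deg_index_minus_unit[OF assms]]] show ?thesis .
qed

lemma P_multi_equation_zero:
  assumes "Poly_Mapping.lookup \<alpha> 0 = 0"
  shows "deriv (deriv (P_multi \<alpha>)) \<theta> + (pairing \<tau> \<alpha>)\<^sup>2 * P_multi \<alpha> \<theta> = 0"
proof (cases "\<exists>i\<ge>1. \<alpha> = unit_index i")
  case True
  then obtain i where i: "i \<ge> 1" "\<alpha> = unit_index i" by blast
  have "X i \<in> kernel (real i)" using X_harmonic[OF i(1)] harmonics_eq_kernel[OF i(1)] by simp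
  then show ?thesis using i by (simp add: P_multi_unit kernel_def solves_def rho_def)
next
  case False
  then have "P_multi \<alpha> = (\<lambda>_. 0)" using assms by (intro P_multi_zero) auto
  then show ?thesis by simp
qed

definition homogeneous_part :: "real \<Rightarrow> real \<Rightarrow> real" where
  "homogeneous_part x \<theta> = (\<Sum>\<alpha> | \<alpha> \<in> level \<tau> x \<and> Poly_Mapping.lookup \<alpha> 0 = 0. P_multi \<alpha> \<theta>)"

definition forced_part :: "real \<Rightarrow> real \<Rightarrow> real" where
  "forced_part x \<theta> = (\<Sum>\<alpha> | \<alpha> \<in> level \<tau> x \<and> Poly_Mapping.lookup \<alpha> 0 \<noteq> 0. P_multi \<alpha> \<theta>)"

lemma sum_level_split:
  "(\<Sum>\<alpha>\<in>level \<tau> x. P_multi \<alpha> \<theta>) = homogeneous_part x \<theta> + forced_part x \<theta>"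
proof -
  have "level \<tau> x = {\<alpha>. \<alpha> \<in> level \<tau> x \<and> Poly_Mapping.lookup \<alpha> 0 = 0} \<union>
     {\<alpha>. \<alpha> \<in> level \<tau> x \<and> Poly_Mapping.lookup \<alpha> 0 \<noteq> 0}" by blast
  then show ?thesis
    unfolding homogeneous_part_def forced_part_def using finite_level[OF tau_pos, of x]
    by (subst sum.union_disjoint[symmetric]) auto
qed

lemma homogeneous_part:
  assumes "x > 0"
  shows "homogeneous_part x = (if x \<in> \<int> then X (nat \<lfloor>x\<rfloor>) else (\<lambda>_. 0))"
proof
  fix \<theta>
  let ?S = "{\<alpha>. \<alpha> \<in> level \<tau> x \<and> Poly_Mapping.lookup \<alpha> 0 = 0}"
  have fin: "finite ?S" using finite_level[OF tau_pos, of x] by simp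
  show "homogeneous_part x \<theta> = (if x \<in> \<int> then X (nat \<lfloor>x\<rfloor>) else (\<lambda>_. 0)) \<theta>"
  proof (cases "x \<in> \<int>")
    case True
    then obtain n where n: "x = real n" "n \<ge> 1"
      using assms by (metis Ints_cases of_int_0_less_iff of_nat_nat One_nat_def Suc_leI less_imp_le
          of_int_of_nat_eq zero_less_nat_eq)
    have "homogeneous_part x \<theta> = (\<Sum>\<alpha>\<in>{unit_index n}. P_multi \<alpha> \<theta>)"
      unfolding homogeneous_part_def
    proof (rule sum.mono_neutral_right[OF fin])
      show "{unit_index n} \<subseteq> ?S" using n by (simp add: level_def rho_def lookup_unit_zero)
      show "\<forall>\<alpha>\<in>?S - {unit_index n}. P_multi \<alpha> \<theta> = 0"
      proof
        fix \<alpha> assume \<alpha>: "\<alpha> \<in> ?S - {unit_index n}"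
        have "\<alpha> \<noteq> unit_index i" if "i \<ge> 1" for i
          using \<alpha> n that by (auto simp: level_def rho_def)
        then show "P_multi \<alpha> \<theta> = 0" using \<alpha> by (simp add: P_multi_zero)
      qed
    qed
    then show ?thesis using True n by (simp add: P_multi_unit)
  next
    case False
    have "P_multi \<alpha> \<theta> = 0" if "\<alpha> \<in> ?S" for \<alpha>
    proof -
      have "\<alpha> \<noteq> unit_index i" if "i \<ge> 1" for i
        using \<open>\<alpha> \<in> ?S\<close> False that by (auto simp: level_def rho_def)
      then show ?thesis using that by (simp add: P_multi_zero)
    qed
    then show ?thesis using False by (simp add: homogeneous_part_def)
  qed
qed

lemma forced_part_orthogonal:
  assumes "x > 0"
  shows "smooth_circle (forced_part x)" "orthogonal_to (forced_part x) (kernel x)"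
    "deriv (deriv (forced_part x)) \<theta> + x\<^sup>2 * forced_part x \<theta> =
      (\<Sum>\<alpha> | \<alpha> \<in> level \<tau> x \<and> Poly_Mapping.lookup \<alpha> 0 \<noteq> 0. forcing (\<alpha> - unit_index 0) \<theta>)"
proof -
  let ?S = "{\<alpha>. \<alpha> \<in> level \<tau> x \<and> Poly_Mapping.lookup \<alpha> 0 \<noteq> 0}"
  have fin: "finite ?S" using finite_level[OF tau_pos, of x] by simp
  define d where "d = Max (insert 0 (deg_index ` ?S))"
  have "\<exists>B. trig d B (P_multi \<alpha>)" if "\<alpha> \<in> ?S" for \<alpha>
  proof -
    have "deg_index \<alpha> \<le> d" unfolding d_def using that fin by (intro Max_ge) auto
    then show ?thesis using that P_multi_trig[of \<alpha>] trig_mono by (metis (lifting) level_def mem_Collect_eq order_refl)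
  qed
  then obtain B where B: "\<And>\<alpha>. \<alpha> \<in> ?S \<Longrightarrow> trig d (B \<alpha>) (P_multi \<alpha>)" by metis
  have t: "trig d (\<Sum>\<alpha>\<in>?S. B \<alpha>) (forced_part x)"
    unfolding forced_part_def[abs_def] by (rule trig_sum[OF B])
  have "deg_index \<alpha> < x" if "\<alpha> \<in> ?S" for \<alpha>
    using that lookup_zero_ge[OF tau_pos, of \<alpha>] tau_pos by (simp add: level_def)
  then have "real d < x"
    using Max_in[of "insert 0 (deg_index ` ?S)"] fin assms by (auto simp: d_def)
  with t show "smooth_circle (forced_part x)" "orthogonal_to (forced_part x) (kernel x)"
    by (auto intro: trig_smooth trig_orthogonal_kernel)
  have "deriv (deriv (forced_part x)) \<theta> = (\<Sum>\<alpha>\<in>?S. deriv (deriv (P_multi \<alpha>)) \<theta>)"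
    unfolding forced_part_def[abs_def] by (subst trig_second_deriv_sum[OF B]) auto
  then have "deriv (deriv (forced_part x)) \<theta> + x\<^sup>2 * forced_part x \<theta> =
     (\<Sum>\<alpha>\<in>?S. deriv (deriv (P_multi \<alpha>)) \<theta> + x\<^sup>2 * P_multi \<alpha> \<theta>)"
    by (simp add: forced_part_def sum.distrib sum_distrib_left)
  also have "\<dots> = (\<Sum>\<alpha>\<in>?S. forcing (\<alpha> - unit_index 0) \<theta>)"
    using P_multi_equation_forcing by (intro sum.cong refl) (auto simp: level_def)
  finally show "deriv (deriv (forced_part x)) \<theta> + x\<^sup>2 * forced_part x \<theta> =
      (\<Sum>\<alpha>\<in>?S. forcing (\<alpha> - unit_index 0) \<theta>)" .
qed

lemma level_shift:
  assumes "x > 0"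
  shows "bij_betw (\<lambda>\<alpha>. \<alpha> - unit_index 0)
    {\<alpha>. \<alpha> \<in> level \<tau> (\<tau> + x) \<and> Poly_Mapping.lookup \<alpha> 0 \<noteq> 0} (level \<tau> x)"
proof (rule bij_betw_byWitness[where f' = "\<lambda>\<gamma>. \<gamma> + unit_index 0"])
  show "(\<lambda>\<alpha>. \<alpha> - unit_index 0) ` {\<alpha>. \<alpha> \<in> level \<tau> (\<tau> + x) \<and> Poly_Mapping.lookup \<alpha> 0 \<noteq> 0} \<subseteq> level \<tau> x"
  proof (intro image_subsetI)
    fix \<alpha> assume "\<alpha> \<in> {\<alpha>. \<alpha> \<in> level \<tau> (\<tau> + x) \<and> Poly_Mapping.lookup \<alpha> 0 \<noteq> 0}"
    then have p: "pairing \<tau> (\<alpha> - unit_index 0) = x" by (simp add: pairing_minus_unit level_def)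
    then have "\<alpha> - unit_index 0 \<noteq> 0" using assms by auto
    with p show "\<alpha> - unit_index 0 \<in> level \<tau> x" by (simp add: level_def multi_indices_def)
  qed
  show "(\<lambda>\<gamma>. \<gamma> + unit_index 0) ` level \<tau> x \<subseteq> {\<alpha>. \<alpha> \<in> level \<tau> (\<tau> + x) \<and> Poly_Mapping.lookup \<alpha> 0 \<noteq> 0}"
  proof (intro image_subsetI)
    fix \<gamma> assume "\<gamma> \<in> level \<tau> x"
    then have "pairing \<tau> (\<gamma> + unit_index 0) = \<tau> + x" by (simp add: level_def pairing_add rho_def)
    moreover have "Poly_Mapping.lookup (\<gamma> + unit_index 0) 0 \<noteq> 0" by (simp add: lookup_add unit_index_def)
    moreover from this have "\<gamma> + unit_index 0 \<noteq> 0" by (metis lookup_zero)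
    ultimately show "\<gamma> + unit_index 0 \<in> {\<alpha>. \<alpha> \<in> level \<tau> (\<tau> + x) \<and> Poly_Mapping.lookup \<alpha> 0 \<noteq> 0}"
      by (simp add: level_def multi_indices_def)
  qed
  show "\<forall>\<alpha>\<in>{\<alpha>. \<alpha> \<in> level \<tau> (\<tau> + x) \<and> Poly_Mapping.lookup \<alpha> 0 \<noteq> 0}. \<alpha> - unit_index 0 + unit_index 0 = \<alpha>"
    using minus_unit_add by blast
  show "\<forall>\<gamma>\<in>level \<tau> x. \<gamma> + unit_index 0 - unit_index 0 = \<gamma>"
    using add_unit_minus by blast
qed

lemma forced_part_zero:
  assumes "\<And>\<alpha>. \<alpha> \<in> level \<tau> x \<Longrightarrow> Poly_Mapping.lookup \<alpha> 0 = 0"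
  shows "forced_part x \<theta> = 0"
proof -
  have e: "{\<alpha>. \<alpha> \<in> level \<tau> x \<and> Poly_Mapping.lookup \<alpha> 0 \<noteq> 0} = {}" using assms by auto
  show ?thesis unfolding forced_part_def e by simp
qed

lemma forced_part_tau: "forced_part \<tau> \<theta> = a 0 / \<tau>\<^sup>2"
proof -
  have "\<alpha> = unit_index 0" if "\<alpha> \<in> level \<tau> \<tau>" "Poly_Mapping.lookup \<alpha> 0 \<noteq> 0" for \<alpha>
  proof -
    have "pairing \<tau> (\<alpha> - unit_index 0) = 0" using that by (simp add: pairing_minus_unit level_def)
    then have "\<alpha> - unit_index 0 = 0"
      using pairing_pos[OF tau_pos, of "\<alpha> - unit_index 0"] by (auto simp: multi_indices_def)
    then show ?thesis using minus_unit_add[OF that(2)] by simp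
  qed
  moreover have "unit_index 0 \<in> level \<tau> \<tau>" "Poly_Mapping.lookup (unit_index 0) 0 \<noteq> 0"
    by (auto simp: level_def rho_def, simp add: unit_index_def)
  ultimately have e: "{\<alpha>. \<alpha> \<in> level \<tau> \<tau> \<and> Poly_Mapping.lookup \<alpha> 0 \<noteq> 0} = {unit_index 0}" by blast
  show ?thesis unfolding forced_part_def e by (simp add: P_multi_unit_zero)
qed

lemma P_seq_eq_sum_level:
  assumes "l \<ge> 1"
  shows "P_seq l = (\<lambda>\<theta>. \<Sum>\<alpha>\<in>level \<tau> (mu \<tau> l). P_multi \<alpha> \<theta>)"
  using assms
proof (induction l rule: less_induct)
  case (less l)
  let ?x = "mu \<tau> l"
  have x: "?x > 0" by (rule mu_pos[OF tau_pos less.prems])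
  have range: "?x \<in> range (pairing \<tau>)" by (rule mu_in_range[OF tau_pos])
  have rho0: "rho \<tau> 0 = \<tau>" by (simp add: rho_def)
  have sum: "(\<lambda>\<theta>. \<Sum>\<alpha>\<in>level \<tau> ?x. P_multi \<alpha> \<theta>) = (\<lambda>\<theta>. homogeneous_part ?x \<theta> + forced_part ?x \<theta>)"
    by (simp add: sum_level_split)
  consider "?x < \<tau>" | "?x = \<tau>" | "?x > \<tau>" "\<not> (\<exists>m\<ge>1. ?x = \<tau> + mu \<tau> m)"
    | "?x > \<tau>" "\<exists>m\<ge>1. ?x = \<tau> + mu \<tau> m"
    using linorder_less_linear[of ?x \<tau>] by blast
  then show ?case
  proof cases
    case 1
    have z: "Poly_Mapping.lookup \<alpha> 0 = 0" if "\<alpha> \<in> level \<tau> ?x" for \<alpha>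
      using that 1 lookup_zero_ge[OF tau_pos, of \<alpha>] by (force simp: level_def)
    have "P_seq l = X l" using 1 by (subst P_seq.simps) (simp add: rho0)
    moreover have "homogeneous_part ?x = X l"
      using index_set_integer[OF range x z] mu_below[OF tau_pos 1] homogeneous_part[OF x] by simp
    ultimately show ?thesis unfolding sum by (simp add: forced_part_zero[OF z])
  next
    case 2
    have "P_seq l = (if \<tau> \<notin> \<int> then (\<lambda>\<theta>. a 0 / \<tau>\<^sup>2) else (\<lambda>\<theta>. a 0 / \<tau>\<^sup>2 + X (nat \<lfloor>\<tau>\<rfloor>) \<theta>))"
      using 2 by (subst P_seq.simps) (simp add: rho0)
    then show ?thesis unfolding sum by (auto simp: 2 homogeneous_part[OF tau_pos] forced_part_tau)
  next
    case 3
    have z: "Poly_Mapping.lookup \<alpha> 0 = 0" if "\<alpha> \<in> level \<tau> ?x" for \<alpha>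
    proof (rule ccontr)
      assume nz: "Poly_Mapping.lookup \<alpha> 0 \<noteq> 0"
      then have p: "pairing \<tau> (\<alpha> - unit_index 0) = ?x - \<tau>"
        using that by (simp add: pairing_minus_unit level_def)
      then obtain m where "?x - \<tau> = mu \<tau> m" using mu_surj[OF tau_pos] by (metis rangeI)
      moreover from this have "m \<ge> 1" using 3(1) by (cases m) auto
      ultimately show False using 3(2) by (metis add.commute diff_add_cancel)
    qed
    have "P_seq l = X (nat \<lfloor>?x\<rfloor>)" using 3 by (subst P_seq.simps) (simp add: rho0)
    then show ?thesis
      unfolding sum using index_set_integer[OF range x z]
      by (simp add: homogeneous_part[OF x] forced_part_zero[OF z])
  next
    case 4
    then obtain m where m: "m \<ge> 1" "?x = \<tau> + mu \<tau> m" by blast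
    have the: "(THE m. m \<ge> 1 \<and> ?x = rho \<tau> 0 + mu \<tau> m) = m"
      using m strict_mono_eq[OF strict_mono_mu[OF tau_pos]] by (intro the_equality) (auto simp: rho0)
    have "mu \<tau> m < ?x" using m tau_pos by simp
    then have ml: "m < l" using strict_mono_less[OF strict_mono_mu[OF tau_pos]] by simp
    define g where "g = (\<lambda>\<theta>. \<Sum>j = 1..m. a j * (\<Sum>ks\<in>mu_tuples \<tau> m j. \<Prod>k\<leftarrow>ks. P_seq k \<theta>))"
    have g: "g \<theta> = (\<Sum>\<gamma>\<in>level \<tau> (mu \<tau> m). forcing \<gamma> \<theta>)" for \<theta>
      unfolding sum_forcing_level[OF m(1)] g_def
    proof (intro sum.cong refl arg_cong2[where f = "(*)"] arg_cong[where f = prod_list] map_cong)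
      fix j ks k assume "ks \<in> mu_tuples \<tau> m j" "k \<in> set ks"
      then have "k \<le> m" "k \<ge> 1" using mu_tuples_le by (auto simp: mu_tuples_def)
      then show "P_seq k \<theta> = (\<Sum>\<beta>\<in>level \<tau> (mu \<tau> k). P_multi \<beta> \<theta>)"
        using less.IH[of k] ml by simp
    qed
    have "(\<Sum>\<alpha> | \<alpha> \<in> level \<tau> ?x \<and> Poly_Mapping.lookup \<alpha> 0 \<noteq> 0. forcing (\<alpha> - unit_index 0) \<theta>) = g \<theta>" for \<theta>
      unfolding g m(2) using sum.reindex_bij_betw[OF level_shift[OF mu_pos[OF tau_pos m(1)]], of "\<lambda>\<gamma>. forcing \<gamma> \<theta>"] .
    then have solves: "solves ?x g (forced_part ?x)"
      using forced_part_orthogonal[OF x] by (simp add: solves_def)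
    note orth = forced_part_orthogonal(2)[OF x]
    have P: "P_seq l = (if ?x \<notin> \<int> then (THE p. solves ?x g p)
           else (\<lambda>\<theta>. X (nat \<lfloor>?x\<rfloor>) \<theta> +
             (THE q. solves ?x g q \<and> orthogonal_to q (harmonics (nat \<lfloor>?x\<rfloor>))) \<theta>))"
      using 4 unfolding g_def by (subst P_seq.simps) (simp add: rho0 the[unfolded rho0 One_nat_def] Let_def)
    show ?thesis
    proof (cases "?x \<in> \<int>")
      case True
      then obtain n where n: "?x = real n" "n \<ge> 1"
        using x by (metis Ints_cases of_int_0_less_iff of_nat_nat One_nat_def Suc_leI less_imp_le
            of_int_of_nat_eq zero_less_nat_eq)
      then have k: "harmonics (nat \<lfloor>?x\<rfloor>) = kernel ?x" using harmonics_eq_kernel[of n] by simp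
      have "(THE q. solves ?x g q \<and> orthogonal_to q (harmonics (nat \<lfloor>?x\<rfloor>))) = forced_part ?x"
        unfolding k using solves orth orthogonal_solution_unique[OF _ _ solves orth x]
        by (intro the_equality conjI) blast+
      then show ?thesis unfolding sum P using True by (simp add: homogeneous_part[OF x])
    next
      case False
      have "L2_inner p q = 0" if "q \<in> kernel ?x" for p q
        using kernel_noninteger[OF that x False] by (simp add: L2_inner_def)
      then have "orthogonal_to p (kernel ?x)" for p by (simp add: orthogonal_to_def)
      then have "(THE p. solves ?x g p) = forced_part ?x"
        using solves orthogonal_solution_unique[OF _ _ solves orth x] by (intro the_equality) blast+
      then show ?thesis unfolding sum P using False by (simp add: homogeneous_part[OF x])
    qed
  qed
qed

end

subsection \<open>The solution\<close>

lemma power_le_fact_exp: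
  fixes x :: real
  assumes "x \<ge> 0"
  shows "x ^ n * exp (- x) \<le> fact n"
proof -
  have s: "(\<lambda>n. x ^ n / fact n) sums exp x"
    using exp_converges[of x] by (simp add: divide_inverse mult.commute)
  have "(\<Sum>i\<in>{n}. x ^ i / fact i) \<le> suminf (\<lambda>i. x ^ i / fact i)"
    using assms sums_summable[OF s] by (intro sum_le_suminf) auto
  then have "x ^ n / fact n \<le> exp x" using sums_unique[OF s] by simp
  then show ?thesis by (simp add: exp_minus field_simps)
qed

locale weighted_sequence = harmonic_sequence +
  fixes w :: "(nat \<Rightarrow>\<^sub>0 nat) \<Rightarrow> real" and t\<^sub>1 R :: real
  assumes trig_w: "\<And>\<alpha>. \<alpha> \<in> multi_indices \<Longrightarrow> trig (deg_index \<alpha>) (w \<alpha> * exp (pairing \<tau> \<alpha> * t\<^sub>1)) (P_multi \<alpha>)"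
    and w_summable: "w summable_on multi_indices"
    and w_le: "infsum w multi_indices \<le> R"
    and R_pos: "R > 0"
begin

definition term_deriv :: "coord list \<Rightarrow> (nat \<Rightarrow>\<^sub>0 nat) \<Rightarrow> real \<Rightarrow> real \<Rightarrow> real" where
  "term_deriv ds \<alpha> t \<theta> = (- pairing \<tau> \<alpha>) ^ count_list ds Time *
     (deriv ^^ count_list ds Angle) (P_multi \<alpha>) \<theta> * exp (- pairing \<tau> \<alpha> * t)"

definition solution :: "real \<Rightarrow> real \<Rightarrow> real" where
  "solution t \<theta> = (\<Sum>\<^sub>\<infinity>\<alpha>\<in>multi_indices. P_multi \<alpha> \<theta> * exp (- pairing \<tau> \<alpha> * t))"

lemma w_nonneg: "\<alpha> \<in> multi_indices \<Longrightarrow> w \<alpha> \<ge> 0"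
  using trig_nonneg[OF trig_w, of \<alpha>] by (simp add: zero_le_mult_iff)

lemma term_bound:
  assumes "\<alpha> \<in> multi_indices"
  shows "\<bar>P_multi \<alpha> \<theta> * exp (- pairing \<tau> \<alpha> * t)\<bar> \<le> w \<alpha> * exp (- pairing \<tau> \<alpha> * (t - t\<^sub>1))"
proof -
  have "\<bar>P_multi \<alpha> \<theta> * exp (- pairing \<tau> \<alpha> * t)\<bar> \<le> w \<alpha> * exp (pairing \<tau> \<alpha> * t\<^sub>1) * exp (- pairing \<tau> \<alpha> * t)"
    using trig_bound[OF trig_w[OF assms], of \<theta>] by (simp add: abs_mult)
  also have "\<dots> = w \<alpha> * exp (- pairing \<tau> \<alpha> * (t - t\<^sub>1))"
    by (simp add: algebra_simps flip: exp_add)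
  finally show ?thesis .
qed

lemma count_list_coord: "count_list ds Time + count_list ds Angle = length ds"
proof (induction ds)
  case (Cons d ds)
  then show ?case by (cases d) auto
qed simp

lemma term_deriv_bound:
  assumes "\<alpha> \<in> multi_indices" "t \<ge> t\<^sub>1 + 1"
  shows "\<bar>term_deriv ds \<alpha> t \<theta>\<bar> \<le> fact (length ds) * w \<alpha>"
proof -
  let ?k = "pairing \<tau> \<alpha>" and ?p = "count_list ds Time" and ?q = "count_list ds Angle"
  have k: "?k \<ge> 0" and dk: "real (deg_index \<alpha>) \<le> ?k"
    using pairing_nonneg[OF tau_pos] tau_pos by (auto simp: pairing_eq)
  have w: "w \<alpha> \<ge> 0" using w_nonneg[OF assms(1)] .
  have "\<bar>term_deriv ds \<alpha> t \<theta>\<bar> = ?k ^ ?p * \<bar>(deriv ^^ ?q) (P_multi \<alpha>) \<theta>\<bar> * exp (- ?k * t)"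
    using k by (simp add: term_deriv_def abs_mult power_abs)
  also have "\<dots> \<le> ?k ^ ?p * (?k ^ ?q * (w \<alpha> * exp (?k * t\<^sub>1))) * exp (- ?k * t)"
  proof (intro mult_right_mono mult_left_mono)
    have "\<bar>(deriv ^^ ?q) (P_multi \<alpha>) \<theta>\<bar> \<le> real (deg_index \<alpha>) ^ ?q * (w \<alpha> * exp (?k * t\<^sub>1))"
      using trig_bound[OF trig_higher_deriv[OF trig_w[OF assms(1)]]] .
    also have "\<dots> \<le> ?k ^ ?q * (w \<alpha> * exp (?k * t\<^sub>1))"
      using dk w by (intro mult_right_mono power_mono) auto
    finally show "\<bar>(deriv ^^ ?q) (P_multi \<alpha>) \<theta>\<bar> \<le> ?k ^ ?q * (w \<alpha> * exp (?k * t\<^sub>1))" .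
  qed (use k in auto)
  also have "\<dots> = w \<alpha> * (?k ^ length ds * exp (- ?k * (t - t\<^sub>1)))"
    by (simp add: algebra_simps flip: count_list_coord[of ds] exp_add power_add)
  also have "\<dots> \<le> w \<alpha> * (?k ^ length ds * exp (- ?k))"
  proof (intro mult_left_mono w)
    have "?k * 1 \<le> ?k * (t - t\<^sub>1)" using k assms(2) by (intro mult_left_mono) auto
    then show "exp (- ?k * (t - t\<^sub>1)) \<le> exp (- ?k)" by simp
  qed (use k in auto)
  also have "\<dots> \<le> w \<alpha> * fact (length ds)"
    by (intro mult_left_mono w power_le_fact_exp k)
  finally show ?thesis by (simp add: mult.commute)
qed

lemma term_deriv_has_partial_deriv:
  assumes "\<alpha> \<in> multi_indices"
  shows "has_partial_deriv t\<^sub>0 d (term_deriv ds \<alpha>) (term_deriv (d # ds) \<alpha>)"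
proof (cases d)
  case Time
  then show ?thesis
    by (auto simp: has_partial_deriv_def term_deriv_def intro!: derivative_eq_intros)
next
  case Angle
  have "((deriv ^^ n) (P_multi \<alpha>) has_real_derivative deriv ((deriv ^^ n) (P_multi \<alpha>)) \<theta>) (at \<theta>)" for n \<theta>
    by (rule trig_deriv'(2)[OF trig_higher_deriv[OF trig_w[OF assms]]])
  from DERIV_cmult_right[OF DERIV_cmult[OF this]] show ?thesis
    unfolding has_partial_deriv_def term_deriv_def Angle by simp
qed

lemma term_deriv_continuous:
  assumes "\<alpha> \<in> multi_indices"
  shows "continuous_on S (\<lambda>(t, \<theta>). term_deriv ds \<alpha> t \<theta>)"
proof -
  have "continuous_on UNIV ((deriv ^^ n) (P_multi \<alpha>))" for n
    using smooth_circle_continuous[OF trig_smooth[OF trig_higher_deriv[OF trig_w[OF assms]]]] .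
  from continuous_on_compose2[OF this continuous_on_snd[OF continuous_on_id]]
  have "continuous_on S (\<lambda>x. (deriv ^^ n) (P_multi \<alpha>) (snd x))" for n by simp
  then show ?thesis
    unfolding term_deriv_def case_prod_unfold by (intro continuous_intros)
qed

lemma term_deriv_Nil: "term_deriv [] = (\<lambda>\<alpha> t \<theta>. P_multi \<alpha> \<theta> * exp (- pairing \<tau> \<alpha> * t))"
  by (intro ext) (simp add: term_deriv_def)

lemma solution_series:
  shows "smooth_cylinder (t\<^sub>1 + 1) solution"
    "Cm_has_sum (t\<^sub>1 + 1) m (\<lambda>\<alpha> t \<theta>. P_multi \<alpha> \<theta> * exp (- pairing \<tau> \<alpha> * t)) multi_indices solution"
    "t \<ge> t\<^sub>1 + 1 \<Longrightarrow> partials (t\<^sub>1 + 1) ds solution t \<theta> = (\<Sum>\<^sub>\<infinity>\<alpha>\<in>multi_indices. term_deriv ds \<alpha> t \<theta>)"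
proof -
  have eq: "solution = (\<lambda>t \<theta>. \<Sum>\<^sub>\<infinity>\<alpha>\<in>multi_indices. term_deriv [] \<alpha> t \<theta>)"
    by (intro ext) (simp add: solution_def term_deriv_Nil)
  have summ: "(\<lambda>\<alpha>. fact (length ds) * w \<alpha>) summable_on multi_indices" for ds :: "coord list"
    by (rule summable_on_cmult_right[OF w_summable])
  have per: "term_deriv [] \<alpha> t (\<theta> + 2 * pi) = term_deriv [] \<alpha> t \<theta>" if "\<alpha> \<in> multi_indices" for \<alpha> t \<theta>
    using trig_periodic[OF trig_w[OF that]] by (simp add: term_deriv_Nil)
  note * = Cm_series[where U = term_deriv and B = "\<lambda>ds \<alpha>. fact (length ds) * w \<alpha>", OF term_deriv_has_partial_deriv
      term_deriv_bound summ term_deriv_continuous per, folded eq]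
  show "smooth_cylinder (t\<^sub>1 + 1) solution"
    "Cm_has_sum (t\<^sub>1 + 1) m (\<lambda>\<alpha> t \<theta>. P_multi \<alpha> \<theta> * exp (- pairing \<tau> \<alpha> * t)) multi_indices solution"
    "t \<ge> t\<^sub>1 + 1 \<Longrightarrow> partials (t\<^sub>1 + 1) ds solution t \<theta> = (\<Sum>\<^sub>\<infinity>\<alpha>\<in>multi_indices. term_deriv ds \<alpha> t \<theta>)"
    using * by (simp_all add: term_deriv_Nil)
qed

lemma term_deriv_summable:
  assumes "t \<ge> t\<^sub>1 + 1"
  shows "(\<lambda>\<alpha>. term_deriv ds \<alpha> t \<theta>) summable_on multi_indices"
  by (subst summable_on_iff_abs_summable_on_real,
      rule Infinite_Sum.abs_summable_on_comparison_test'[OF summable_on_cmult_right[OF w_summable, of "fact (length ds)"]])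
    (use term_deriv_bound assms in auto)

lemma solution_has_sum:
  assumes "t \<ge> t\<^sub>1 + 1"
  shows "((\<lambda>\<alpha>. P_multi \<alpha> \<theta> * exp (- pairing \<tau> \<alpha> * t)) has_sum solution t \<theta>) multi_indices"
  unfolding solution_def using term_deriv_summable[OF assms, of "[]" \<theta>] by (simp add: term_deriv_Nil)

lemma tail_bound:
  assumes "((\<lambda>\<alpha>. P_multi \<alpha> \<theta> * exp (- pairing \<tau> \<alpha> * t)) has_sum s) S" "S \<subseteq> multi_indices"
    and c: "\<And>\<alpha>. \<alpha> \<in> S \<Longrightarrow> c \<le> pairing \<tau> \<alpha>" and t: "t \<ge> t\<^sub>1"
  shows "\<bar>s\<bar> \<le> R * exp (c * t\<^sub>1) * exp (- c * t)"
proof -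
  have sS: "(w has_sum infsum w S) S"
    using summable_on_subset[OF w_summable assms(2)] by simp
  have "norm s \<le> infsum w S * exp (- c * (t - t\<^sub>1))"
  proof (rule norm_infsum_le[OF assms(1) has_sum_cmult_left[OF sS]])
    fix \<alpha> assume \<alpha>: "\<alpha> \<in> S"
    then have m: "\<alpha> \<in> multi_indices" using assms(2) by blast
    have "w \<alpha> * exp (- pairing \<tau> \<alpha> * (t - t\<^sub>1)) \<le> w \<alpha> * exp (- c * (t - t\<^sub>1))"
      using c[OF \<alpha>] t by (intro mult_left_mono w_nonneg[OF m]) (auto intro: mult_right_mono)
    then show "norm (P_multi \<alpha> \<theta> * exp (- pairing \<tau> \<alpha> * t)) \<le> w \<alpha> * exp (- c * (t - t\<^sub>1))"
      using term_bound[OF m, of \<theta> t] by simp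
  qed
  also have "\<dots> \<le> R * exp (- c * (t - t\<^sub>1))"
  proof (rule mult_right_mono)
    have "infsum w S \<le> infsum w multi_indices"
      by (rule has_sum_mono2[OF sS has_sum_infsum[OF w_summable] assms(2)]) (use w_nonneg in auto)
    then show "infsum w S \<le> R" using w_le by linarith
  qed simp
  also have "\<dots> = R * exp (c * t\<^sub>1) * exp (- c * t)"
    by (simp add: algebra_simps flip: exp_add)
  finally show ?thesis by simp
qed

lemma solution_decay:
  assumes "t \<ge> t\<^sub>1 + 1"
  shows "\<bar>solution t \<theta>\<bar> \<le> R * exp (mu \<tau> 1 * t\<^sub>1) * exp (- mu \<tau> 1 * t)"
proof (rule tail_bound[OF solution_has_sum[OF assms] order_refl])
  show "mu \<tau> 1 \<le> pairing \<tau> \<alpha>" if "\<alpha> \<in> multi_indices" for \<alpha>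
    using mu_le_of_gt[OF tau_pos, of "pairing \<tau> \<alpha>" 0] pairing_pos[OF tau_pos that] by simp
qed (use assms in simp)

lemma solution_expansion:
  assumes "t \<ge> t\<^sub>1 + 1"
  shows "\<bar>solution t \<theta> - (\<Sum>j = 1..l. P_seq j \<theta> * exp (- mu \<tau> j * t))\<bar>
    \<le> R * exp (mu \<tau> (l + 1) * t\<^sub>1) * exp (- mu \<tau> (l + 1) * t)"
proof -
  let ?u = "\<lambda>\<alpha>. P_multi \<alpha> \<theta> * exp (- pairing \<tau> \<alpha> * t)"
  define A where "A = (\<Union>j\<in>{1..l}. level \<tau> (mu \<tau> j))"
  have finA: "finite A" unfolding A_def using finite_level[OF tau_pos] by blast
  have sub: "A \<subseteq> multi_indices" by (auto simp: A_def level_def)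
  have inj: "mu \<tau> i = mu \<tau> j \<longleftrightarrow> i = j" for i j
    by (rule strict_mono_eq[OF strict_mono_mu[OF tau_pos]])
  have "sum ?u A = (\<Sum>j=1..l. \<Sum>\<alpha>\<in>level \<tau> (mu \<tau> j). ?u \<alpha>)"
    unfolding A_def using finite_level[OF tau_pos]
    by (intro sum.UNION_disjoint) (auto simp: level_def inj)
  also have "\<dots> = (\<Sum>j = 1..l. P_seq j \<theta> * exp (- mu \<tau> j * t))"
  proof (rule sum.cong[OF refl])
    fix j assume "j \<in> {1..l}"
    then have "P_seq j \<theta> = (\<Sum>\<alpha>\<in>level \<tau> (mu \<tau> j). P_multi \<alpha> \<theta>)"
      by (subst P_seq_eq_sum_level) auto
    then show "(\<Sum>\<alpha>\<in>level \<tau> (mu \<tau> j). ?u \<alpha>) = P_seq j \<theta> * exp (- mu \<tau> j * t)"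
      by (simp add: sum_distrib_right level_def)
  qed
  finally have "(?u has_sum (\<Sum>j = 1..l. P_seq j \<theta> * exp (- mu \<tau> j * t))) A"
    using has_sum_finite[OF finA, of ?u] by simp
  from has_sum_Diff[OF solution_has_sum[OF assms] this sub]
  have "(?u has_sum (solution t \<theta> - (\<Sum>j = 1..l. P_seq j \<theta> * exp (- mu \<tau> j * t)))) (multi_indices - A)" .
  then show ?thesis
  proof (rule tail_bound)
    fix \<alpha> assume \<alpha>: "\<alpha> \<in> multi_indices - A"
    obtain m where m: "pairing \<tau> \<alpha> = mu \<tau> m" using mu_surj[OF tau_pos] by blast
    have "m \<noteq> 0" using m \<alpha> pairing_pos[OF tau_pos, of \<alpha>] by (cases m) auto
    moreover have "m \<notin> {1..l}" using \<alpha> m by (auto simp: A_def level_def)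
    ultimately have "l + 1 \<le> m" by auto
    then show "mu \<tau> (l + 1) \<le> pairing \<tau> \<alpha>"
      unfolding m by (simp only: strict_mono_less_eq[OF strict_mono_mu[OF tau_pos]])
  qed (use assms in auto)
qed

lemma solution_equation:
  assumes t: "t \<ge> t\<^sub>1 + 1"
    and a: "summable (\<lambda>j. \<bar>a j\<bar> * R ^ j)" "ereal R < conv_radius a"
    and f: "\<And>s. ereal \<bar>s\<bar> < conv_radius a \<Longrightarrow> (\<lambda>j. a j * s ^ j) sums f s"
  shows "ereal \<bar>solution t \<theta>\<bar> < conv_radius a"
    "partials (t\<^sub>1 + 1) [Time, Time] solution t \<theta> + partials (t\<^sub>1 + 1) [Angle, Angle] solution t \<theta>
      = exp (- \<tau> * t) * f (solution t \<theta>)"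
proof -
  let ?u = "\<lambda>\<alpha>. P_multi \<alpha> \<theta> * exp (- pairing \<tau> \<alpha> * t)"
  note v = solution_has_sum[OF t, of \<theta>]
  define T where "T = (\<Sum>\<^sub>\<infinity>\<alpha>\<in>multi_indices. \<bar>?u \<alpha>\<bar>)"
  have absu: "((\<lambda>\<alpha>. \<bar>?u \<alpha>\<bar>) has_sum T) multi_indices"
    using has_sum_imp_summable[OF v] unfolding T_def summable_on_iff_abs_summable_on_real[of ?u] by simp
  have "T \<le> infsum w multi_indices"
  proof (rule has_sum_mono[OF absu has_sum_infsum[OF w_summable]])
    fix \<alpha> assume \<alpha>: "\<alpha> \<in> multi_indices"
    have "pairing \<tau> \<alpha> * (t - t\<^sub>1) \<ge> 0" using pairing_nonneg[OF tau_pos] t by simp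
    then have "exp (- pairing \<tau> \<alpha> * (t - t\<^sub>1)) \<le> 1" by simp
    from mult_left_mono[OF this w_nonneg[OF \<alpha>]] show "\<bar>?u \<alpha>\<bar> \<le> w \<alpha>"
      using term_bound[OF \<alpha>, of \<theta> t] by simp
  qed
  then have TR: "T \<le> R" using w_le by linarith
  have T0: "T \<ge> 0" using has_sum_nonneg[OF absu] by simp
  have "\<bar>solution t \<theta>\<bar> \<le> T" using norm_infsum_le[OF v absu] by simp
  with TR have "ereal \<bar>solution t \<theta>\<bar> \<le> ereal R" by simp
  also note a(2)
  finally show conv: "ereal \<bar>solution t \<theta>\<bar> < conv_radius a" .
  have "summable (\<lambda>j. \<bar>a j\<bar> * T ^ j)"
    by (rule summable_comparison_test'[OF a(1), of 0])
      (use T0 TR in \<open>auto simp: abs_mult intro!: mult_left_mono power_mono\<close>)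
  from has_sum_power_series_lists[OF v absu this f[OF conv]]
  have all: "((\<lambda>\<beta>s. a (length \<beta>s) * (\<Prod>\<beta>\<leftarrow>\<beta>s. ?u \<beta>)) has_sum f (solution t \<theta>)) {\<beta>s. set \<beta>s \<subseteq> multi_indices}" .
  have img: "{\<beta>s. set \<beta>s \<subseteq> multi_indices} = snd ` Sigma UNIV decomps"
    by (force simp: decomps_def image_def)
  have "inj_on snd (Sigma UNIV decomps)" by (auto simp: inj_on_def decomps_def)
  then have "((\<lambda>x. a (length (snd x)) * (\<Prod>\<beta>\<leftarrow>snd x. ?u \<beta>)) has_sum f (solution t \<theta>)) (Sigma UNIV decomps)"
    using all unfolding img by (simp add: has_sum_reindex o_def)
  then have "((\<lambda>\<gamma>. \<Sum>\<beta>s\<in>decomps \<gamma>. a (length \<beta>s) * (\<Prod>\<beta>\<leftarrow>\<beta>s. ?u \<beta>)) has_sum f (solution t \<theta>)) UNIV"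
    by (rule has_sum_SigmaD) (simp add: has_sum_finite finite_decomps)
  moreover have "(\<Sum>\<beta>s\<in>decomps \<gamma>. a (length \<beta>s) * (\<Prod>\<beta>\<leftarrow>\<beta>s. ?u \<beta>)) = forcing \<gamma> \<theta> * exp (- pairing \<tau> \<gamma> * t)" for \<gamma>
  proof -
    have "(\<Prod>\<beta>\<leftarrow>\<beta>s. ?u \<beta>) = (\<Prod>\<beta>\<leftarrow>\<beta>s. P_multi \<beta> \<theta>) * exp (- pairing \<tau> (sum_list \<beta>s) * t)" for \<beta>s
      by (induction \<beta>s) (auto simp: pairing_add distrib_right exp_diff exp_minus field_simps exp_add)
    then show ?thesis
      by (auto simp: forcing_def sum_distrib_right decomps_def intro!: sum.cong)
  qed
  ultimately have "((\<lambda>\<gamma>. forcing \<gamma> \<theta> * exp (- pairing \<tau> \<gamma> * t)) has_sum f (solution t \<theta>)) UNIV" by simp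
  from has_sum_cmult_right[OF this, of "exp (- \<tau> * t)"]
  have s1: "((\<lambda>\<gamma>. exp (- \<tau> * t) * (forcing \<gamma> \<theta> * exp (- pairing \<tau> \<gamma> * t))) has_sum exp (- \<tau> * t) * f (solution t \<theta>)) UNIV" .
  let ?Z = "{\<alpha>. Poly_Mapping.lookup \<alpha> 0 \<noteq> 0} :: (nat \<Rightarrow>\<^sub>0 nat) set"
  have bij: "bij_betw (\<lambda>\<alpha>. \<alpha> - unit_index 0) ?Z UNIV"
  proof (rule bij_betw_byWitness[where f' = "\<lambda>\<gamma>. \<gamma> + unit_index 0"])
    show "\<forall>\<alpha>\<in>?Z. \<alpha> - unit_index 0 + unit_index 0 = \<alpha>" using minus_unit_add by blast
    show "\<forall>\<gamma>\<in>UNIV. \<gamma> + unit_index 0 - unit_index 0 = \<gamma>" using add_unit_minus by blast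
    show "(\<lambda>\<gamma>. \<gamma> + unit_index 0) ` UNIV \<subseteq> ?Z"
      by (intro image_subsetI) (simp add: lookup_add unit_index_def)
  qed simp
  let ?g = "\<lambda>\<alpha>. (deriv (deriv (P_multi \<alpha>)) \<theta> + (pairing \<tau> \<alpha>)\<^sup>2 * P_multi \<alpha> \<theta>) * exp (- pairing \<tau> \<alpha> * t)"
  have "((\<lambda>\<alpha>. exp (- \<tau> * t) * (forcing (\<alpha> - unit_index 0) \<theta> * exp (- pairing \<tau> (\<alpha> - unit_index 0) * t)))
     has_sum exp (- \<tau> * t) * f (solution t \<theta>)) ?Z"
    by (rule iffD2[OF has_sum_reindex_bij_betw[OF bij,
          of "\<lambda>\<gamma>. exp (- \<tau> * t) * (forcing \<gamma> \<theta> * exp (- pairing \<tau> \<gamma> * t))"] s1])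
  then have "(?g has_sum exp (- \<tau> * t) * f (solution t \<theta>)) multi_indices"
  proof (rule has_sum_cong_neutral[THEN iffD1, rotated -1])
    fix \<alpha> assume "\<alpha> \<in> multi_indices - ?Z"
    then show "?g \<alpha> = 0" using P_multi_equation_zero[of \<alpha>] by simp
  next
    fix \<alpha> assume "\<alpha> \<in> ?Z - multi_indices"
    then have False by (auto simp: multi_indices_def)
    then show "exp (- \<tau> * t) * (forcing (\<alpha> - unit_index 0) \<theta> * exp (- pairing \<tau> (\<alpha> - unit_index 0) * t)) = 0" ..
  next
    fix \<alpha> assume "\<alpha> \<in> ?Z \<inter> multi_indices"
    then have z: "Poly_Mapping.lookup \<alpha> 0 \<noteq> 0" by simp
    have "exp (- \<tau> * t) * exp (- pairing \<tau> (\<alpha> - unit_index 0) * t) = exp (- pairing \<tau> \<alpha> * t)"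
      by (simp add: pairing_minus_unit[OF z] algebra_simps flip: exp_add)
    then show "exp (- \<tau> * t) * (forcing (\<alpha> - unit_index 0) \<theta> * exp (- pairing \<tau> (\<alpha> - unit_index 0) * t)) = ?g \<alpha>"
      unfolding P_multi_equation_forcing[OF z] by (metis mult.left_commute)
  qed
  moreover have "(?g has_sum (partials (t\<^sub>1 + 1) [Time, Time] solution t \<theta> +
     partials (t\<^sub>1 + 1) [Angle, Angle] solution t \<theta>)) multi_indices"
  proof -
    have "((\<lambda>\<alpha>. term_deriv [Time, Time] \<alpha> t \<theta> + term_deriv [Angle, Angle] \<alpha> t \<theta>) has_sum
      (partials (t\<^sub>1 + 1) [Time, Time] solution t \<theta> + partials (t\<^sub>1 + 1) [Angle, Angle] solution t \<theta>)) multi_indices"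
      unfolding solution_series(3)[OF t] using term_deriv_summable[OF t]
      by (intro has_sum_add has_sum_infsum)
    moreover have "term_deriv [Time, Time] \<alpha> t \<theta> + term_deriv [Angle, Angle] \<alpha> t \<theta> = ?g \<alpha>" for \<alpha>
      by (simp add: term_deriv_def power2_eq_square algebra_simps)
    ultimately show ?thesis by simp
  qed
  ultimately show "partials (t\<^sub>1 + 1) [Time, Time] solution t \<theta> + partials (t\<^sub>1 + 1) [Angle, Angle] solution t \<theta>
      = exp (- \<tau> * t) * f (solution t \<theta>)" by (rule has_sum_unique[rotated])
qed

end

lemma sum_power_le_double:
  fixes x :: real
  assumes "0 \<le> x" "x \<le> 1 / 2"
  shows "(\<Sum>i=1..N. x ^ i) \<le> 2 * x"
proof -
  have "(\<Sum>i=1..N. x ^ i) \<le> 2 * x - 2 * x ^ Suc N"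
  proof (induction N)
    case (Suc N)
    have "x * x ^ Suc N \<le> 1 / 2 * x ^ Suc N" using assms by (intro mult_right_mono) auto
    with Suc show ?case by simp
  qed simp
  moreover have "0 \<le> x ^ Suc N" using assms by simp
  ultimately show ?thesis by linarith
qed

lemma starting_time_exists:
  fixes a\<^sub>0 \<tau> A R :: real
  assumes "\<tau> > 0" "R > 0"
  shows "\<exists>t\<ge>0. A * exp (- t) \<le> 1 / 2 \<and> A * exp (- t) \<le> R / 4 \<and> exp (- \<tau> * t) / \<tau>\<^sup>2 * (\<bar>a\<^sub>0\<bar> + 1) \<le> R / 2"
proof -
  have e: "((\<lambda>t. exp (- k * t)) \<longlongrightarrow> 0) at_top" if "k > 0" for k :: real
    using filterlim_tendsto_pos_mult_at_top[OF tendsto_const that filterlim_ident]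
    by (auto intro!: filterlim_compose[OF exp_at_bot] simp: filterlim_uminus_at_top)
  have "((\<lambda>t. A * exp (- 1 * t)) \<longlongrightarrow> A * 0) at_top" by (intro tendsto_intros e) simp
  then have A: "((\<lambda>t. A * exp (- t)) \<longlongrightarrow> 0) at_top" by simp
  have "((\<lambda>t. exp (- \<tau> * t) / \<tau>\<^sup>2 * (\<bar>a\<^sub>0\<bar> + 1)) \<longlongrightarrow> 0 / \<tau>\<^sup>2 * (\<bar>a\<^sub>0\<bar> + 1)) at_top"
    using assms by (intro tendsto_intros e) auto
  then have B: "((\<lambda>t. exp (- \<tau> * t) / \<tau>\<^sup>2 * (\<bar>a\<^sub>0\<bar> + 1)) \<longlongrightarrow> 0) at_top" by simp
  have "\<forall>\<^sub>F t in at_top. t \<ge> 0 \<and> A * exp (- t) < 1 / 2 \<and> A * exp (- t) < R / 4 \<and>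
      exp (- \<tau> * t) / \<tau>\<^sup>2 * (\<bar>a\<^sub>0\<bar> + 1) < R / 2"
    using assms by (intro eventually_conj eventually_ge_at_top order_tendstoD(2)[OF A] order_tendstoD(2)[OF B]) auto
  from eventually_happens'[OF _ this] show ?thesis by (auto intro: less_imp_le)
qed

theorem theorem6p2:
  fixes a\<^sub>0 \<tau>\<^sub>0 A M :: real
  assumes "\<tau>\<^sub>0 > 0" and "A > 0" and "M > 0"
  shows "\<exists>t\<^sub>0>0. \<forall>(f :: real \<Rightarrow> real) (a :: nat \<Rightarrow> real) (\<epsilon>\<^sub>0 :: real) (X :: nat \<Rightarrow> real \<Rightarrow> real).
    \<epsilon>\<^sub>0 > 0 \<longrightarrow> given_by_power_series f a \<epsilon>\<^sub>0 \<longrightarrow>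
    a 0 = a\<^sub>0 \<longrightarrow> (\<forall>j\<ge>1. \<bar>a j\<bar> \<le> M ^ j) \<longrightarrow>
    (\<forall>i\<ge>1. X i \<in> harmonics i) \<longrightarrow> (\<forall>i\<ge>1. L2_norm (X i) \<le> A ^ i) \<longrightarrow>
    (\<exists>v :: real \<Rightarrow> real \<Rightarrow> real.
      smooth_cylinder t\<^sub>0 v \<and>
      (\<forall>m. Cm_has_sum t\<^sub>0 m
         (\<lambda>\<alpha> t \<theta>. harmonic_data.P_multi \<tau>\<^sub>0 a X \<alpha> \<theta> * exp (- pairing \<tau>\<^sub>0 \<alpha> * t)) multi_indices v) \<and>
      (\<forall>t\<ge>t\<^sub>0. \<forall>\<theta>. ereal \<bar>v t \<theta>\<bar> < conv_radius a \<and>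
         partials t\<^sub>0 [Time, Time] v t \<theta> + partials t\<^sub>0 [Angle, Angle] v t \<theta>
           = exp (- \<tau>\<^sub>0 * t) * f (v t \<theta>)) \<and>
      (\<exists>C>0. \<exists>\<gamma>>0. \<forall>t\<ge>t\<^sub>0. \<forall>\<theta>. \<bar>v t \<theta>\<bar> \<le> C * exp (- \<gamma> * t)) \<and>
      (\<forall>l\<ge>1. \<exists>C>0. \<forall>t\<ge>t\<^sub>0. \<forall>\<theta>.
         \<bar>v t \<theta> - (\<Sum>j = 1..l. harmonic_data.P_seq \<tau>\<^sub>0 a X j \<theta> * exp (- mu \<tau>\<^sub>0 j * t))\<bar>
           \<le> C * exp (- mu \<tau>\<^sub>0 (l + 1) * t)))"
proof -
  define R where "R = 1 / (2 * M)"
  have R: "R > 0" "M * R = 1 / 2" using assms by (auto simp: R_def)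
  obtain t\<^sub>1 where t1: "t\<^sub>1 \<ge> 0" "A * exp (- t\<^sub>1) \<le> 1 / 2" "A * exp (- t\<^sub>1) \<le> R / 4"
    "exp (- \<tau>\<^sub>0 * t\<^sub>1) / \<tau>\<^sub>0\<^sup>2 * (\<bar>a\<^sub>0\<bar> + 1) \<le> R / 2"
    using starting_time_exists[OF assms(1) R(1)] by blast
  define \<epsilon> where "\<epsilon> = exp (- \<tau>\<^sub>0 * t\<^sub>1) / \<tau>\<^sub>0\<^sup>2"
  define b where "b = (\<lambda>i. (A * exp (- t\<^sub>1)) ^ i)"
  define c where "c = (\<lambda>j. if j = 0 then \<bar>a\<^sub>0\<bar> else M ^ j)"
  have b: "(\<Sum>i=1..N. b i) \<le> R / 2" for N
    using sum_power_le_double[of "A * exp (- t\<^sub>1)" N] t1 assms(2) by (simp add: b_def)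
  have c: "(\<Sum>j\<le>k. c j * R ^ j) \<le> \<bar>a\<^sub>0\<bar> + 1" for k
  proof -
    have "(\<Sum>j\<le>k. c j * R ^ j) = c 0 + (\<Sum>j=1..k. c j * R ^ j)"
      by (simp add: atMost_atLeast0 sum.atLeast_Suc_atMost)
    also have "(\<Sum>j=1..k. c j * R ^ j) = (\<Sum>j=1..k. (1 / 2) ^ j)"
      by (intro sum.cong) (auto simp: c_def R(2) simp flip: power_mult_distrib)
    also have "\<dots> \<le> 2 * (1 / 2)" by (rule sum_power_le_double) auto
    finally show ?thesis by (simp add: c_def)
  qed
  have nonneg: "\<epsilon> \<ge> 0" "c j \<ge> 0" "b i \<ge> 0" "R \<ge> 0" for i j
    using assms R by (auto simp: \<epsilon>_def c_def b_def)
  have "R / 2 + \<epsilon> * (\<bar>a\<^sub>0\<bar> + 1) \<le> R"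
    using t1(4) unfolding \<epsilon>_def by linarith
  note W = has_sum_weight[OF nonneg b c this]
  show ?thesis
  proof (intro exI[of _ "t\<^sub>1 + 1"] conjI allI impI)
    show "t\<^sub>1 + 1 > 0" using t1 by simp
    fix f :: "real \<Rightarrow> real" and a :: "nat \<Rightarrow> real" and \<epsilon>\<^sub>0 :: real and X :: "nat \<Rightarrow> real \<Rightarrow> real"
    assume f: "given_by_power_series f a \<epsilon>\<^sub>0" and a: "a 0 = a\<^sub>0" "\<forall>j\<ge>1. \<bar>a j\<bar> \<le> M ^ j"
      and X: "\<forall>i\<ge>1. X i \<in> harmonics i" "\<forall>i\<ge>1. L2_norm (X i) \<le> A ^ i"
    interpret harmonic_sequence \<tau>\<^sub>0 a X
      by unfold_locales (use assms X in auto)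
    have ac: "\<bar>a j\<bar> \<le> c j" for j using a by (cases "j = 0") (auto simp: c_def)
    have Xb: "trig i (b i * exp (real i * t\<^sub>1)) (X i)" if "i \<ge> 1" for i
    proof -
      have "exp (- t\<^sub>1) ^ i * exp (real i * t\<^sub>1) = 1"
        by (simp flip: exp_of_nat_mult exp_add)
      then have "b i * exp (real i * t\<^sub>1) = A ^ i"
        by (simp add: b_def power_mult_distrib mult.assoc)
      then show ?thesis
        using trig_mono[OF harmonics_trig[OF X_harmonic[OF that] that] order_refl] X(2) that by simp
    qed
    interpret weighted_sequence \<tau>\<^sub>0 a X "weight \<epsilon> c b" t\<^sub>1 R
    proof
      show "trig (deg_index \<alpha>) (weight \<epsilon> c b \<alpha> * exp (pairing \<tau>\<^sub>0 \<alpha> * t\<^sub>1)) (P_multi \<alpha>)"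
        if "\<alpha> \<in> multi_indices" for \<alpha>
        by (rule trig_P_multi[OF Xb ac \<epsilon>_def that])
    qed (use W R in simp_all)
    have summ: "summable (\<lambda>j. \<bar>a j\<bar> * z ^ j)" if "0 \<le> z" "M * z < 1" for z
    proof (rule summable_comparison_test'[of "\<lambda>j. (M * z) ^ j" 1])
      show "summable (\<lambda>j. (M * z) ^ j)" using that assms by (intro summable_geometric) auto
      show "norm (\<bar>a j\<bar> * z ^ j) \<le> (M * z) ^ j" if "1 \<le> j" for j
        using a(2) that \<open>0 \<le> z\<close> by (simp add: abs_mult power_mult_distrib mult_right_mono)
    qed
    have radius: "ereal R < conv_radius a"
    proof -
      define z where "z = 3 / (4 * M)"
      have z: "0 \<le> z" "M * z < 1" "R < z" using assms by (auto simp: z_def R_def field_simps)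
      have "summable (\<lambda>j. a j * z ^ j)"
        by (rule summable_norm_cancel) (use summ[OF z(1,2)] z(1) in \<open>simp add: abs_mult power_abs\<close>)
      from conv_radius_geI[OF this] have "ereal z \<le> conv_radius a" using z(1) by simp
      moreover have "ereal R < ereal z" using z(3) by simp
      ultimately show ?thesis by (rule less_le_trans[rotated])
    qed
    have fs: "(\<lambda>j. a j * s ^ j) sums f s" if "ereal \<bar>s\<bar> < conv_radius a" for s
      using f that by (simp add: given_by_power_series_def)
    have eq: "ereal \<bar>solution t \<theta>\<bar> < conv_radius a \<and>
        partials (t\<^sub>1 + 1) [Time, Time] solution t \<theta> + partials (t\<^sub>1 + 1) [Angle, Angle] solution t \<theta>
           = exp (- \<tau>\<^sub>0 * t) * f (solution t \<theta>)" if "t \<ge> t\<^sub>1 + 1" for t \<theta>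
      using solution_equation[OF that summ radius fs] R by simp
    have decay: "\<exists>C>0. \<exists>\<gamma>>0. \<forall>t\<ge>t\<^sub>1 + 1. \<forall>\<theta>. \<bar>solution t \<theta>\<bar> \<le> C * exp (- \<gamma> * t)"
      using solution_decay R(1) mu_pos[OF assms(1), of 1]
      by (intro exI[of _ "R * exp (mu \<tau>\<^sub>0 1 * t\<^sub>1)"] exI[of _ "mu \<tau>\<^sub>0 1"] conjI) (auto simp del: mu.simps)
    have exp': "\<exists>C>0. \<forall>t\<ge>t\<^sub>1 + 1. \<forall>\<theta>.
         \<bar>solution t \<theta> - (\<Sum>j = 1..l. P_seq j \<theta> * exp (- mu \<tau>\<^sub>0 j * t))\<bar> \<le> C * exp (- mu \<tau>\<^sub>0 (l + 1) * t)" for l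
      using solution_expansion R(1)
      by (intro exI[of _ "R * exp (mu \<tau>\<^sub>0 (l + 1) * t\<^sub>1)"] conjI) (auto simp del: mu.simps)
    show "\<exists>v :: real \<Rightarrow> real \<Rightarrow> real.
      smooth_cylinder (t\<^sub>1 + 1) v \<and>
      (\<forall>m. Cm_has_sum (t\<^sub>1 + 1) m
         (\<lambda>\<alpha> t \<theta>. P_multi \<alpha> \<theta> * exp (- pairing \<tau>\<^sub>0 \<alpha> * t)) multi_indices v) \<and>
      (\<forall>t\<ge>t\<^sub>1 + 1. \<forall>\<theta>. ereal \<bar>v t \<theta>\<bar> < conv_radius a \<and>
         partials (t\<^sub>1 + 1) [Time, Time] v t \<theta> + partials (t\<^sub>1 + 1) [Angle, Angle] v t \<theta>
           = exp (- \<tau>\<^sub>0 * t) * f (v t \<theta>)) \<and>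
      (\<exists>C>0. \<exists>\<gamma>>0. \<forall>t\<ge>t\<^sub>1 + 1. \<forall>\<theta>. \<bar>v t \<theta>\<bar> \<le> C * exp (- \<gamma> * t)) \<and>
      (\<forall>l\<ge>1. \<exists>C>0. \<forall>t\<ge>t\<^sub>1 + 1. \<forall>\<theta>.
         \<bar>v t \<theta> - (\<Sum>j = 1..l. P_seq j \<theta> * exp (- mu \<tau>\<^sub>0 j * t))\<bar> \<le> C * exp (- mu \<tau>\<^sub>0 (l + 1) * t))"
      using solution_series(1,2) eq decay exp' by (intro exI[of _ solution]) blast
  qed
qed

end
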